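(* There exist universal constants $C_1, C_2 > 0$ such that for all integers $n \ge 2$ and $1 \le k < n$ there is a randomized linear sketching scheme for vectors in $\mathbb{R}^n$, consisting of a random matrix $\Phi$ with $O(k \log n)$ rows (whose distribution does not depend on the input) and a recovery procedure $\mathcal{R}$, with the following properties. For every $\mathbf{x} \in \mathbb{R}^n$, the vector $\hat{\mathbf{x}} = \mathcal{R}(\Phi \mathbf{x})$ satisfies $$\Pr\Big[\|\hat{\mathbf{x}} - \mathbf{x}\|_\infty \le \frac{C_1}{k} \cdot \min_{\beta \in \mathbb{R}} \mathrm{err}_1^k(\mathbf{x} - \beta)\Big] \ge 1 - \frac{C_2}{n}.$$ Moreover, the sketch $\Phi\mathbf{x}$ can be computed in time $O(n \log n)$, its size is $O(k\log n)$, and the recovery $\mathcal{R}(\Phi\mathbf{x})$ can be computed in time $O(n\log n)$.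
   Context: For $\mathbf{x}\in\mathbb{R}^n$ and $\beta\in\mathbb{R}$, $\mathbf{x}-\beta$ denotes the vector $(x_1-\beta,\dots,x_n-\beta)$. A vector is $k$-sparse if it has at most $k$ nonzero coordinates. For $p \ge 1$, $\mathrm{err}_p^k(\mathbf{x}) = \min_{k\text{-sparse } \mathbf{x}'} \|\mathbf{x}-\mathbf{x}'\|_p$, i.e. the $\ell_p$-norm of $\mathbf{x}$ after zeroing out its $k$ coordinates of largest absolute value. The probability is over the randomness of $\Phi$ (and of the scheme). *)

theory Defs
  imports
    "HOL-Probability.Product_PMF"
    "Jordan_Normal_Form.Matrix"
begin

unbundle no vec_syntax and no inner_syntax

section \<open>Norms and best sparse approximation\<close>

type_synonym rvec = "real Matrix.vec"

definition lp_norm :: "real \<Rightarrow> rvec \<Rightarrow> real" where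
  "lp_norm p x = (\<Sum>i<dim_vec x. \<bar>x $ i\<bar> powr p) powr (1 / p)"

text \<open>Only meant for vectors of positive dimension.\<close>

definition linf_norm :: "rvec \<Rightarrow> real" where
  "linf_norm x = Max {\<bar>x $ i\<bar> | i. i < dim_vec x}"

definition k_sparse :: "nat \<Rightarrow> rvec \<Rightarrow> bool" where
  "k_sparse k x \<longleftrightarrow> card {i. i < dim_vec x \<and> x $ i \<noteq> 0} \<le> k"

text \<open>
  The infima below and in \<open>min_bias_err\<close> range over nonempty sets of nonnegative reals,
  and both are attained (for \<open>p \<ge> 1\<close> and positive dimension), so they are minima.
\<close>

definition sparse_err :: "real \<Rightarrow> nat \<Rightarrow> rvec \<Rightarrow> real" where
  "sparse_err p k x = Inf {lp_norm p (x - x') | x'. x' \<in> carrier_vec (dim_vec x) \<and> k_sparse k x'}"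

definition shift_vec :: "rvec \<Rightarrow> real \<Rightarrow> rvec" where
  "shift_vec x \<beta> = map_vec (\<lambda>a. a - \<beta>) x"

definition min_bias_err :: "real \<Rightarrow> nat \<Rightarrow> rvec \<Rightarrow> real" where
  "min_bias_err p k x = (INF \<beta>. sparse_err p k (shift_vec x \<beta>))"


section \<open>Machine model: a word RAM with real registers\<close>

text \<open>
  Running times are measured on the usual unit-cost real RAM. It has words, i.e. integers
  modulo \<open>W\<close>, which serve as indices and counters, and reals, which can only be added,
  subtracted, multiplied, divided and compared; words can be converted to reals but not
  conversely (in particular there is no rounding). Real constants other than those generated
  from words are not available. Memory is organised in named registers and named
  arrays addressed by words; a program only mentions finitely many of them. \<open>Tape\<close> reads
  a cell of the read-only random tape.
\<close>

type_synonym name = string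
type_synonym tape = "nat \<Rightarrow> nat"

datatype wexp =
    Const nat
  | WReg name
  | WLoad name wexp
  | Tape wexp
  | WAdd wexp wexp
  | WSub wexp wexp
  | WMul wexp wexp
  | WDiv wexp wexp
  | WMod wexp wexp

datatype rexp =
    OfWord wexp
  | RReg name
  | RLoad name wexp
  | RAdd rexp rexp
  | RSub rexp rexp
  | RMul rexp rexp
  | RDiv rexp rexp

datatype bexp =
    WLess wexp wexp
  | RLess rexp rexp
  | BNot bexp
  | BAnd bexp bexp

datatype prog =
    Skip
  | WSet name wexp
  | WStore name wexp wexp
  | RSet name rexp
  | RStore name wexp rexp
  | Seq prog prog
  | Cond bexp prog prog
  | Loop bexp prog

record state =
  wreg :: "name \<Rightarrow> nat"
  warr :: "name \<Rightarrow> nat \<Rightarrow> nat"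
  rreg :: "name \<Rightarrow> real"
  rarr :: "name \<Rightarrow> nat \<Rightarrow> real"

text \<open>
  Word subtraction is truncated at zero. The operations without an explicit \<open>mod W\<close> map
  words to words anyway.
\<close>

fun wval :: "nat \<Rightarrow> tape \<Rightarrow> state \<Rightarrow> wexp \<Rightarrow> nat" where
  "wval W \<omega> s (Const c) = c mod W"
| "wval W \<omega> s (WReg x) = wreg s x"
| "wval W \<omega> s (WLoad a e) = warr s a (wval W \<omega> s e)"
| "wval W \<omega> s (Tape e) = \<omega> (wval W \<omega> s e)"
| "wval W \<omega> s (WAdd e f) = (wval W \<omega> s e + wval W \<omega> s f) mod W"
| "wval W \<omega> s (WSub e f) = wval W \<omega> s e - wval W \<omega> s f"
| "wval W \<omega> s (WMul e f) = (wval W \<omega> s e * wval W \<omega> s f) mod W"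
| "wval W \<omega> s (WDiv e f) = wval W \<omega> s e div wval W \<omega> s f"
| "wval W \<omega> s (WMod e f) = wval W \<omega> s e mod wval W \<omega> s f"

fun rval :: "nat \<Rightarrow> tape \<Rightarrow> state \<Rightarrow> rexp \<Rightarrow> real" where
  "rval W \<omega> s (OfWord e) = real (wval W \<omega> s e)"
| "rval W \<omega> s (RReg x) = rreg s x"
| "rval W \<omega> s (RLoad a e) = rarr s a (wval W \<omega> s e)"
| "rval W \<omega> s (RAdd e f) = rval W \<omega> s e + rval W \<omega> s f"
| "rval W \<omega> s (RSub e f) = rval W \<omega> s e - rval W \<omega> s f"
| "rval W \<omega> s (RMul e f) = rval W \<omega> s e * rval W \<omega> s f"
| "rval W \<omega> s (RDiv e f) = rval W \<omega> s e / rval W \<omega> s f"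

fun bval :: "nat \<Rightarrow> tape \<Rightarrow> state \<Rightarrow> bexp \<Rightarrow> bool" where
  "bval W \<omega> s (WLess e f) \<longleftrightarrow> wval W \<omega> s e < wval W \<omega> s f"
| "bval W \<omega> s (RLess e f) \<longleftrightarrow> rval W \<omega> s e < rval W \<omega> s f"
| "bval W \<omega> s (BNot b) \<longleftrightarrow> \<not> bval W \<omega> s b"
| "bval W \<omega> s (BAnd b c) \<longleftrightarrow> bval W \<omega> s b \<and> bval W \<omega> s c"

text \<open>
  \<open>exec W \<omega> p s t s'\<close>: started in \<open>s\<close>, the program \<open>p\<close> halts in \<open>s'\<close> after \<open>t\<close> steps.
  Every executed assignment and every evaluated test costs one step. The expressions
  occurring in a fixed program have bounded size, so this agrees up to a constant factor
  with counting single operations.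
\<close>

inductive exec :: "nat \<Rightarrow> tape \<Rightarrow> prog \<Rightarrow> state \<Rightarrow> nat \<Rightarrow> state \<Rightarrow> bool"
  for W :: nat and \<omega> :: tape where
  Skip: "exec W \<omega> Skip s 1 s"
| WSet: "exec W \<omega> (WSet x e) s 1 (s\<lparr>wreg := (wreg s)(x := wval W \<omega> s e)\<rparr>)"
| WStore: "exec W \<omega> (WStore a i e) s 1
    (s\<lparr>warr := (warr s)(a := (warr s a)(wval W \<omega> s i := wval W \<omega> s e))\<rparr>)"
| RSet: "exec W \<omega> (RSet x e) s 1 (s\<lparr>rreg := (rreg s)(x := rval W \<omega> s e)\<rparr>)"
| RStore: "exec W \<omega> (RStore a i e) s 1
    (s\<lparr>rarr := (rarr s)(a := (rarr s a)(wval W \<omega> s i := rval W \<omega> s e))\<rparr>)"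
| Seq: "exec W \<omega> p s t s' \<Longrightarrow> exec W \<omega> q s' t' s'' \<Longrightarrow> exec W \<omega> (Seq p q) s (t + t') s''"
| CondTrue: "bval W \<omega> s b \<Longrightarrow> exec W \<omega> p s t s' \<Longrightarrow> exec W \<omega> (Cond b p q) s (Suc t) s'"
| CondFalse: "\<not> bval W \<omega> s b \<Longrightarrow> exec W \<omega> q s t s' \<Longrightarrow> exec W \<omega> (Cond b p q) s (Suc t) s'"
| LoopFalse: "\<not> bval W \<omega> s b \<Longrightarrow> exec W \<omega> (Loop b p) s 1 s"
| LoopTrue: "bval W \<omega> s b \<Longrightarrow> exec W \<omega> p s t s' \<Longrightarrow> exec W \<omega> (Loop b p) s' t' s'' \<Longrightarrow>
    exec W \<omega> (Loop b p) s (Suc (t + t')) s''"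

text \<open>
  Input: the parameters \<open>n\<close>, \<open>k\<close> and a real vector; everything else is initialised to zero.
\<close>

definition init_state :: "nat \<Rightarrow> nat \<Rightarrow> rvec \<Rightarrow> state" where
  "init_state n k u =
     \<lparr>wreg = (\<lambda>_. 0)(''n'' := n, ''k'' := k),
      warr = (\<lambda>_ _. 0),
      rreg = (\<lambda>_. 0),
      rarr = (\<lambda>_ _. 0)(''in'' := (\<lambda>i. if i < dim_vec u then u $ i else 0))\<rparr>"

definition computes_within ::
  "nat \<Rightarrow> tape \<Rightarrow> prog \<Rightarrow> nat \<Rightarrow> nat \<Rightarrow> rvec \<Rightarrow> rvec \<Rightarrow> real \<Rightarrow> bool" where
  "computes_within W \<omega> p n k u v T \<longleftrightarrow>
     (\<exists>t s. exec W \<omega> p (init_state n k u) t s \<and> real t \<le> T \<and>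
            vec (dim_vec v) (rarr s ''out'') = v)"

text \<open>
  The random tape: independent, uniformly distributed words, one for every address.
  It is shared by sketching and recovery.
\<close>

definition random_tape :: "nat \<Rightarrow> tape pmf" where
  "random_tape W = Pi_pmf {..<W} 0 (\<lambda>_. pmf_of_set {..<W})"

end

theory Submission
  imports Defs
begin

text \<open>
  The sketch adds up the coordinates in \<open>2 L + 1\<close> rows of \<open>s = 320 k\<close> buckets, where
  \<open>L\<close> is about \<open>log n\<close>. In row 0 the buckets form a fixed balanced partition. Less than half of them
  contain an outlier or have an untypically large deviation, so the median of the bucket means
  is a bias estimate with error \<open>O(E / n)\<close>, deterministically. The other rows hash the
  coordinates by fresh words of the tape. After subtracting the estimated bias, a bucket estimates each of its
  coordinates up to \<open>E / k\<close> unless the remaining coordinates in it are too heavy, which has probability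
  at most 1/16 by Markov's inequality. A coordinate is recovered as the median over the
  rows, which fails with probability at most \<open>4 ^ L / 16 ^ L \<le> 1 / n\<^sup>2\<close>. If this takes at least \<open>n\<close> buckets,
  the identity matrix is a short enough sketch.

  Computing \<open>n\<close> medians of \<open>O(log n)\<close> numbers in time \<open>O(n log n)\<close> needs no linear-time selection: the buckets
  are extracted in the order of their values from a tournament tree, and a coordinate is assigned the
  value of the bucket in which it is met for the \<open>(L + 1)\<close>-st time.
\<close>

section \<open>Timed execution\<close>

text \<open>The constant 320 is 2 * 10 * 16. Two tape words agree modulo \<open>s\<close> with
  probability at most \<open>2 / s\<close>; the coordinates that can spoil a bucket have total
  weight at most \<open>10 * k\<close>, namely \<open>k\<close> for the outliers, \<open>k\<close>
  for the deviations and \<open>8 * k\<close> for the error of the bias; and Markov's inequality is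
  to give 1/16. Row 0 is not hashed so that the bias bound holds on every tape. The weights can then
  be fixed before the tape is drawn, and the hash rows, which read disjoint blocks of the tape, are
  independent. The programs are verified for one fixed tape at a time; probability enters only when
  the tapes with too many heavy rows are bounded. Weights are divided by \<open>E\<close>, so
  \<open>E\<close> has to be positive although the best error may be zero. Accuracy is therefore
  shown for every \<open>r\<close> above the claimed bound, and the bound itself is reached by
  continuity of the measure; this also replaces minimisers by near-minimisers. Words have size
  \<open>n ^ 20\<close> because constants such as 320 must fit into a word even for
  \<open>n = 2\<close>.\<close>

definition runs :: "nat \<Rightarrow> tape \<Rightarrow> prog \<Rightarrow> state \<Rightarrow> nat \<Rightarrow> (state \<Rightarrow> bool) \<Rightarrow> bool" where
  "runs W \<omega> p s T Q \<longleftrightarrow> (\<exists>t s'. exec W \<omega> p s t s' \<and> t \<le> T \<and> Q s')"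

lemma runs_mono:
  assumes "runs W \<omega> p s T Q" "T \<le> T'" "\<And>s'. Q s' \<Longrightarrow> Q' s'"
  shows "runs W \<omega> p s T' Q'"
  using assms unfolding runs_def by (meson order_trans)

lemma runs_Skip: "1 \<le> T \<Longrightarrow> Q s \<Longrightarrow> runs W \<omega> Skip s T Q"
  unfolding runs_def by (blast intro: exec.intros)

lemma runs_WSet:
  "1 \<le> T \<Longrightarrow> Q (s\<lparr>wreg := (wreg s)(x := wval W \<omega> s e)\<rparr>) \<Longrightarrow> runs W \<omega> (WSet x e) s T Q"
  unfolding runs_def by (blast intro: exec.intros)

lemma runs_WStore:
  "1 \<le> T \<Longrightarrow> Q (s\<lparr>warr := (warr s)(a := (warr s a)(wval W \<omega> s i := wval W \<omega> s e))\<rparr>) \<Longrightarrow>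
   runs W \<omega> (WStore a i e) s T Q"
  unfolding runs_def by (blast intro: exec.intros)

lemma runs_RSet:
  "1 \<le> T \<Longrightarrow> Q (s\<lparr>rreg := (rreg s)(x := rval W \<omega> s e)\<rparr>) \<Longrightarrow> runs W \<omega> (RSet x e) s T Q"
  unfolding runs_def by (blast intro: exec.intros)

lemma runs_RStore:
  "1 \<le> T \<Longrightarrow> Q (s\<lparr>rarr := (rarr s)(a := (rarr s a)(wval W \<omega> s i := rval W \<omega> s e))\<rparr>) \<Longrightarrow>
   runs W \<omega> (RStore a i e) s T Q"
  unfolding runs_def by (blast intro: exec.intros)

text \<open>\<open>runs\<close> acts as a weakest precondition with a time bound, so the claim about
  \<open>q\<close> can itself serve as the postcondition of \<open>p\<close>.\<close>

lemma runs_Seq: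
  assumes "runs W \<omega> p s T (\<lambda>s'. runs W \<omega> q s' T' Q)" "T + T' \<le> T''"
  shows "runs W \<omega> (Seq p q) s T'' Q"
proof -
  obtain t s' t' s'' where "exec W \<omega> p s t s'" "t \<le> T" "exec W \<omega> q s' t' s''" "t' \<le> T'" "Q s''"
    using assms(1) unfolding runs_def by blast
  then show ?thesis
    using assms(2) unfolding runs_def by (intro exI[of _ "t + t'"] exI[of _ s'']) (auto intro: exec.Seq)
qed

lemma runs_Cond:
  assumes "bval W \<omega> s b \<Longrightarrow> runs W \<omega> p s T Q" "\<not> bval W \<omega> s b \<Longrightarrow> runs W \<omega> q s T Q" "T < T'"
  shows "runs W \<omega> (Cond b p q) s T' Q"
proof (cases "bval W \<omega> s b")
  case True
  then obtain t s' where "exec W \<omega> p s t s'" "t \<le> T" "Q s'"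
    using assms(1) unfolding runs_def by blast
  with True assms(3) show ?thesis
    unfolding runs_def by (intro exI[of _ "Suc t"] exI[of _ s']) (auto intro: exec.CondTrue)
next
  case False
  then obtain t s' where "exec W \<omega> q s t s'" "t \<le> T" "Q s'"
    using assms(2) unfolding runs_def by blast
  with False assms(3) show ?thesis
    unfolding runs_def by (intro exI[of _ "Suc t"] exI[of _ s']) (auto intro: exec.CondFalse)
qed

text \<open>The index of the invariant is a time budget from which every iteration is paid.\<close>

lemma runs_Loop:
  assumes "I v s"
    and step: "\<And>v s. I v s \<Longrightarrow> bval W \<omega> s b \<Longrightarrow> \<exists>T u. runs W \<omega> p s T (I u) \<and> u + T < v"
    and exit: "\<And>v s. I v s \<Longrightarrow> \<not> bval W \<omega> s b \<Longrightarrow> Q s"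
    and "v < T'"
  shows "runs W \<omega> (Loop b p) s T' Q"
proof -
  have "runs W \<omega> (Loop b p) s (Suc v) Q"
    using assms(1)
  proof (induction v arbitrary: s rule: less_induct)
    case (less v)
    show ?case
    proof (cases "bval W \<omega> s b")
      case True
      then obtain T u t s' where *: "exec W \<omega> p s t s'" "t \<le> T" "I u s'" "u + T < v"
        using step[OF less.prems] unfolding runs_def by blast
      then obtain t' s'' where "exec W \<omega> (Loop b p) s' t' s''" "t' \<le> Suc u" "Q s''"
        using less.IH[of u s'] unfolding runs_def by auto
      with True * show ?thesis
        unfolding runs_def by (intro exI[of _ "Suc (t + t')"] exI[of _ s'']) (auto intro: exec.LoopTrue)
    next
      case False
      then show ?thesis
        unfolding runs_def using exit[OF less.prems]
        by (intro exI[of _ 1] exI[of _ s]) (auto intro: exec.LoopFalse[unfolded One_nat_def])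
    qed
  qed
  then show ?thesis
    by (rule runs_mono) (use assms(4) in auto)
qed

text \<open>The budget for \<open>j\<close> remaining iterations is \<open>j * Suc T\<close>, where
  the extra unit pays for the test; the strict bound on \<open>T'\<close> pays for the last, failing
  test.\<close>

lemma runs_Loop_const:
  assumes "I j s"
    and step: "\<And>j s. I j s \<Longrightarrow> bval W \<omega> s b \<Longrightarrow> 0 < j \<and> runs W \<omega> p s T (I (j - 1))"
    and exit: "\<And>j s. I j s \<Longrightarrow> \<not> bval W \<omega> s b \<Longrightarrow> Q s"
    and "j * Suc T < T'"
  shows "runs W \<omega> (Loop b p) s T' Q"
proof (rule runs_Loop[where I = "\<lambda>v s. \<exists>j. v = j * Suc T \<and> I j s"])
  show "\<exists>i. j * Suc T = i * Suc T \<and> I i s"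
    using assms(1) by blast
next
  fix v s assume "\<exists>j. v = j * Suc T \<and> I j s" and b: "bval W \<omega> s b"
  then obtain j where j: "v = j * Suc T" "I j s" by blast
  from step[OF j(2) b] have "0 < j" and r: "runs W \<omega> p s T (I (j - 1))" by auto
  then obtain i where i: "j = Suc i" by (cases j) auto
  have "runs W \<omega> p s T (\<lambda>s. \<exists>j. i * Suc T = j * Suc T \<and> I j s)"
    using i by (intro runs_mono[OF r]) auto
  moreover have "i * Suc T + T < v"
    using i j by simp
  ultimately show "\<exists>T' u. runs W \<omega> p s T' (\<lambda>s. \<exists>j. u = j * Suc T \<and> I j s) \<and> u + T' < v"
    by blast
qed (use exit assms(4) in auto)

text \<open>Symbolic execution: each rule consumes the leading assignment and passes on the budget
  \<open>T - 1\<close>, so straight-line code is processed by repeated introduction.\<close>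

lemma runs_Seq_assign:
  "1 \<le> T \<Longrightarrow> runs W \<omega> q (s\<lparr>wreg := (wreg s)(x := wval W \<omega> s e)\<rparr>) (T - 1) Q \<Longrightarrow>
    runs W \<omega> (Seq (WSet x e) q) s T Q"
  "1 \<le> T \<Longrightarrow> runs W \<omega> q (s\<lparr>warr := (warr s)(a := (warr s a)(wval W \<omega> s i := wval W \<omega> s e))\<rparr>) (T - 1) Q \<Longrightarrow>
    runs W \<omega> (Seq (WStore a i e) q) s T Q"
  "1 \<le> T \<Longrightarrow> runs W \<omega> q (s\<lparr>rreg := (rreg s)(x := rval W \<omega> s r)\<rparr>) (T - 1) Q \<Longrightarrow>
    runs W \<omega> (Seq (RSet x r) q) s T Q"
  "1 \<le> T \<Longrightarrow> runs W \<omega> q (s\<lparr>rarr := (rarr s)(a := (rarr s a)(wval W \<omega> s i := rval W \<omega> s r))\<rparr>) (T - 1) Q \<Longrightarrow>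
    runs W \<omega> (Seq (RStore a i r) q) s T Q"
  by (rule runs_Seq[where T = 1 and T' = "T - 1"];
      simp add: runs_WSet runs_WStore runs_RSet runs_RStore)+

lemmas runs_intros = runs_Seq_assign runs_WSet runs_WStore runs_RSet runs_RStore

section \<open>Tournament trees\<close>

text \<open>
  The leaves of a tree over \<open>e\<close> keys are the nodes \<open>e, \<dots>, 2 * e - 1\<close>, node \<open>v\<close> has the
  children \<open>2 * v\<close> and \<open>2 * v + 1\<close>, and the root is node 1. A node stores one plus
  the index of the smallest key below it that has not been extracted, or zero if there is none.
\<close>

definition winner :: "(nat \<Rightarrow> real) \<Rightarrow> nat \<Rightarrow> nat \<Rightarrow> nat" where
  "winner K x y = (if 0 < x \<and> \<not> (0 < y \<and> K (y - 1) < K (x - 1)) then x else y)"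

text \<open>\<open>V\<close> holds the inner nodes whose value may be out of date while the tree is
  built or repaired. Node 0 is never constrained, so \<open>{0}\<close> is as good as
  \<open>{}\<close>.\<close>

definition tournament :: "(nat \<Rightarrow> real) \<Rightarrow> nat \<Rightarrow> nat set \<Rightarrow> (nat \<Rightarrow> nat) \<Rightarrow> nat set \<Rightarrow> bool" where
  "tournament K e A t V \<longleftrightarrow>
     (\<forall>b<e. t (e + b) = (if b \<in> A then b + 1 else 0)) \<and>
     (\<forall>v. 0 < v \<and> v < e \<and> v \<notin> V \<longrightarrow> t v = winner K (t (2 * v)) (t (2 * v + 1)))"

lemma tournament_leaf: "tournament K e A t V \<Longrightarrow> b < e \<Longrightarrow> t (e + b) = (if b \<in> A then b + 1 else 0)"
  unfolding tournament_def by blast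

lemma tournament_inner:
  "tournament K e A t V \<Longrightarrow> 0 < v \<Longrightarrow> v < e \<Longrightarrow> v \<notin> V \<Longrightarrow> t v = winner K (t (2 * v)) (t (2 * v + 1))"
  unfolding tournament_def by blast

text \<open>Induction from the leaves upwards, with \<open>2 * e - v\<close> decreasing towards the
  children: an inner node copies its value from a child.\<close>

lemma tournament_node:
  assumes "tournament K e A t {}" "A \<subseteq> {..<e}" "0 < v" "v < 2 * e" "t v \<noteq> 0"
  shows "t v - 1 \<in> A"
  using assms(3-5)
proof (induction "2 * e - v" arbitrary: v rule: less_induct)
  case less
  show ?case
  proof (cases "v < e")
    case True
    then have t: "t v = winner K (t (2 * v)) (t (2 * v + 1))"
      using tournament_inner[OF assms(1)] less.prems by simp
    have "t v = t (2 * v) \<or> t v = t (2 * v + 1)"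
      unfolding t winner_def by auto
    then show ?thesis
    proof
      assume "t v = t (2 * v)"
      then show ?thesis using less.hyps[of "2 * v"] less.prems True by auto
    next
      assume "t v = t (2 * v + 1)"
      then show ?thesis using less.hyps[of "2 * v + 1"] less.prems True by auto
    qed
  next
    case False
    then have "v = e + (v - e)" "v - e < e"
      using less.prems by linarith+
    then obtain b where "v = e + b" "b < e" by blast
    with less.prems(3) show ?thesis
      using tournament_leaf[OF assms(1)] by (auto split: if_splits)
  qed
qed

text \<open>On the way from \<open>v\<close> to its parent \<open>v div 2\<close> the stored key
  cannot grow, and a nonzero value cannot be replaced by zero.\<close>

lemma tournament_root:
  assumes "tournament K e A t {}" "0 < v" "v < 2 * e" "t v \<noteq> 0"
  shows "t 1 \<noteq> 0 \<and> K (t 1 - 1) \<le> K (t v - 1)"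
  using assms(2-4)
proof (induction v rule: less_induct)
  case (less v)
  show ?case
  proof (cases "v = 1")
    case False
    define u where "u = v div 2"
    have u: "0 < u" "u < e" "u < v" "v = 2 * u \<or> v = 2 * u + 1"
      using less.prems False unfolding u_def by linarith+
    have "t u = winner K (t (2 * u)) (t (2 * u + 1))"
      using tournament_inner[OF assms(1)] u by simp
    then have "t u \<noteq> 0 \<and> K (t u - 1) \<le> K (t v - 1)"
      using u(4) less.prems(3) unfolding winner_def by (auto split: if_splits)
    moreover from this have "t 1 \<noteq> 0 \<and> K (t 1 - 1) \<le> K (t u - 1)"
      using less.IH[of u] u by auto
    ultimately show ?thesis by auto
  qed (use less.prems in auto)
qed

definition champion :: "(nat \<Rightarrow> nat) \<Rightarrow> nat" where
  "champion t = t 1 - 1"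

lemma tournament_champion:
  assumes "tournament K e A t {}" "A \<subseteq> {..<e}" "A \<noteq> {}"
  shows "champion t \<in> A" "\<And>a. a \<in> A \<Longrightarrow> K (champion t) \<le> K a"
proof -
  have *: "t 1 \<noteq> 0 \<and> K (t 1 - 1) \<le> K a" if "a \<in> A" for a
  proof -
    have "a < e" "t (e + a) = a + 1"
      using tournament_leaf[OF assms(1)] assms(2) that by auto
    then show ?thesis
      using tournament_root[OF assms(1), of "e + a"] by auto
  qed
  then show "\<And>a. a \<in> A \<Longrightarrow> K (champion t) \<le> K a"
    unfolding champion_def by blast
  have "t 1 \<noteq> 0" "0 < e"
    using * assms(2,3) by auto
  then show "champion t \<in> A"
    using tournament_node[OF assms(1,2), of 1] by (simp add: champion_def)
qed

text \<open>Replaying the match at \<open>v\<close> repairs \<open>v\<close> and can invalidate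
  nothing but its parent, which therefore has to lie in \<open>V'\<close> unless \<open>v\<close> is
  the root.\<close>

lemma tournament_play:
  assumes "tournament K e A t V" "0 < v" "v < e" "\<And>u. 0 < u \<Longrightarrow> u \<in> V \<Longrightarrow> u \<noteq> v \<Longrightarrow> u \<in> V'"
    and "v div 2 \<in> V' \<or> v = 1"
  shows "tournament K e A (t(v := winner K (t (2 * v)) (t (2 * v + 1)))) V'"
  unfolding tournament_def
proof (intro conjI allI impI)
  let ?t = "t(v := winner K (t (2 * v)) (t (2 * v + 1)))"
  fix u assume u: "0 < u \<and> u < e \<and> u \<notin> V'"
  then have *: "2 * u \<noteq> v" "2 * u + 1 \<noteq> v"
    using assms(5) by auto
  show "?t u = winner K (?t (2 * u)) (?t (2 * u + 1))"
  proof (cases "u = v")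
    case True
    then show ?thesis using * by simp
  next
    case False
    then have "t u = winner K (t (2 * u)) (t (2 * u + 1))"
      using tournament_inner[OF assms(1)] assms(4) u by blast
    then show ?thesis using False * by simp
  qed
qed (use assms(3) tournament_leaf[OF assms(1)] in auto)

definition twice_v :: wexp where
  "twice_v = WMul (Const 2) (WReg ''v'')"

definition play_prog :: prog where
  "play_prog =
    Cond (BAnd (WLess (Const 0) (WLoad ''t'' twice_v))
            (BNot (BAnd (WLess (Const 0) (WLoad ''t'' (WAdd twice_v (Const 1))))
               (RLess (RLoad ''K'' (WSub (WLoad ''t'' (WAdd twice_v (Const 1))) (Const 1)))
                  (RLoad ''K'' (WSub (WLoad ''t'' twice_v) (Const 1)))))))
      (WStore ''t'' (WReg ''v'') (WLoad ''t'' twice_v))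
      (WStore ''t'' (WReg ''v'') (WLoad ''t'' (WAdd twice_v (Const 1))))"

lemma runs_play:
  assumes "2 * wreg s ''v'' + 1 < W" "2 < W" "2 \<le> T"
    and "Q (s\<lparr>warr := (warr s)(''t'' := (warr s ''t'')(wreg s ''v'' :=
      winner (rarr s ''K'') (warr s ''t'' (2 * wreg s ''v'')) (warr s ''t'' (2 * wreg s ''v'' + 1))))\<rparr>)"
  shows "runs W \<omega> play_prog s T Q"
proof -
  have [simp]: "wval W \<omega> s twice_v = 2 * wreg s ''v''"
    "wval W \<omega> s (WAdd twice_v (Const 1)) = 2 * wreg s ''v'' + 1"
    using assms(1,2) by (simp_all add: twice_v_def)
  show ?thesis
    unfolding play_prog_def
  proof (rule runs_Cond[where T = 1], goal_cases)
    case 1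
    then show ?case
      using assms by (intro runs_WStore) (auto simp: winner_def)
  next
    case 2
    then show ?case
      using assms by (intro runs_WStore) (auto simp: winner_def)
  qed (use assms(3) in simp)
qed

definition build_prog :: prog where
  "build_prog =
    Seq (WSet ''v'' (Const 0))
    (Seq (Loop (WLess (WReg ''v'') (WReg ''e''))
       (Seq (WStore ''t'' (WAdd (WReg ''e'') (WReg ''v'')) (WAdd (WReg ''v'') (Const 1)))
         (WSet ''v'' (WAdd (WReg ''v'') (Const 1)))))
    (Seq (WSet ''v'' (WSub (WReg ''e'') (Const 1)))
      (Loop (WLess (Const 0) (WReg ''v''))
        (Seq play_prog (WSet ''v'' (WSub (WReg ''v'') (Const 1)))))))"

definition extract_prog :: prog where
  "extract_prog =
    Seq (WSet ''b'' (WSub (WLoad ''t'' (Const 1)) (Const 1)))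
    (Seq (WSet ''v'' (WAdd (WReg ''e'') (WReg ''b'')))
    (Seq (WStore ''t'' (WReg ''v'') (Const 0))
    (Seq (WSet ''v'' (WDiv (WReg ''v'') (Const 2)))
      (Loop (WLess (Const 0) (WReg ''v''))
        (Seq play_prog (WSet ''v'' (WDiv (WReg ''v'') (Const 2))))))))"

definition tree_frame :: "state \<Rightarrow> state \<Rightarrow> bool" where
  "tree_frame s s' \<longleftrightarrow> rreg s' = rreg s \<and> rarr s' = rarr s \<and>
     (\<forall>a. a \<noteq> ''t'' \<longrightarrow> warr s' a = warr s a) \<and>
     (\<forall>x. x \<noteq> ''v'' \<longrightarrow> x \<noteq> ''b'' \<longrightarrow> wreg s' x = wreg s x)"

text \<open>Inner nodes are computed in decreasing order, so both children are final when a node is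
  played. The exempt set \<open>{..j}\<close> consists of the nodes still to be played; at first it
  contains all inner nodes, so that filling the leaves suffices.\<close>

lemma runs_build:
  assumes e: "wreg s ''e'' = e" "1 \<le> e" "2 * e < W" "7 * e + 4 \<le> T"
  shows "runs W \<omega> build_prog s T (\<lambda>s'. tree_frame s s' \<and>
    tournament (rarr s ''K'') e {..<e} (warr s' ''t'') {})"
proof -
  let ?K = "rarr s ''K''"
  let ?J = "\<lambda>j s'. j \<le> e \<and> tree_frame s s' \<and> wreg s' ''v'' = e - j \<and>
    (\<forall>b<e - j. warr s' ''t'' (e + b) = b + 1)"
  let ?I = "\<lambda>j s'. j < e \<and> tree_frame s s' \<and> wreg s' ''v'' = j \<and>
    tournament ?K e {..<e} (warr s' ''t'') {..j}"
  have play: "runs W \<omega> (Loop (WLess (Const 0) (WReg ''v''))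
        (Seq play_prog (WSet ''v'' (WSub (WReg ''v'') (Const 1))))) s' (4 * e)
        (\<lambda>s'. tree_frame s s' \<and> tournament ?K e {..<e} (warr s' ''t'') {})"
    if "?I (e - 1) s'" for s'
  proof (rule runs_Loop_const[where I = ?I and T = 3, OF that])
    fix j s1 assume I: "?I j s1" and "bval W \<omega> s1 (WLess (Const 0) (WReg ''v''))"
    then have j: "0 < j" by auto
    have t: "tournament ?K e {..<e} ((warr s1 ''t'')(j := winner ?K (warr s1 ''t'' (2 * j))
        (warr s1 ''t'' (2 * j + 1)))) {..j - 1}"
      using I j by (intro tournament_play[where V = "{..j}"]) auto
    have "tree_frame s s1" "wreg s1 ''v'' = j" "j - 1 < e" "2 * j + 1 < W" "2 < W" "1 mod W = 1"
      using I j e by auto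
    with j t show "0 < j \<and> runs W \<omega> (Seq play_prog (WSet ''v'' (WSub (WReg ''v'') (Const 1)))) s1 3 (?I (j - 1))"
      by (intro conjI runs_Seq[where T = 2 and T' = 1] runs_play runs_intros) (simp_all add: tree_frame_def)
  next
    fix j s1 assume "?I j s1" "\<not> bval W \<omega> s1 (WLess (Const 0) (WReg ''v''))"
    then have "tree_frame s s1" "tournament ?K e {..<e} (warr s1 ''t'') {0}"
      by auto
    then show "tree_frame s s1 \<and> tournament ?K e {..<e} (warr s1 ''t'') {}"
      unfolding tournament_def by blast
  qed (use e in auto)
  have leaves: "runs W \<omega> (Loop (WLess (WReg ''v'') (WReg ''e''))
       (Seq (WStore ''t'' (WAdd (WReg ''e'') (WReg ''v'')) (WAdd (WReg ''v'') (Const 1)))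
         (WSet ''v'' (WAdd (WReg ''v'') (Const 1))))) (s\<lparr>wreg := (wreg s)(''v'' := 0)\<rparr>) (3 * e + 1) (?J 0)"
  proof (rule runs_Loop_const[where I = ?J and j = e and T = 2])
    fix j s1 assume J: "?J j s1" and b: "bval W \<omega> s1 (WLess (WReg ''v'') (WReg ''e''))"
    have ve: "wreg s1 ''e'' = e" "wreg s1 ''v'' = e - j"
      using J e by (simp_all add: tree_frame_def)
    with b have j: "0 < j" "j \<le> e" using J by auto
    have "tree_frame s s1" "j - 1 \<le> e" "1 mod W = 1" "(e + (e - j)) mod W = e + (e - j)"
      "(e - j + 1) mod W = e - j + 1" "e - (j - 1) = e - j + 1"
      using J j e by auto
    moreover have "\<forall>b<e - j + 1. ((warr s1 ''t'')(e + (e - j) := e - j + 1)) (e + b) = b + 1"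
      using J by (auto simp: less_Suc_eq)
    ultimately show "0 < j \<and> runs W \<omega> (Seq (WStore ''t'' (WAdd (WReg ''e'') (WReg ''v'')) (WAdd (WReg ''v'') (Const 1)))
         (WSet ''v'' (WAdd (WReg ''v'') (Const 1)))) s1 2 (?J (j - 1))"
      using j ve by (intro conjI runs_intros) (simp_all add: tree_frame_def)
  qed (use e in \<open>auto simp: tree_frame_def\<close>)
  have leaves': "tournament ?K e {..<e} (warr s' ''t'') {..e - 1}" if "?J 0 s'" for s'
    using that unfolding tournament_def by auto
  show ?thesis
    unfolding build_prog_def
  proof (rule runs_Seq_assign)
    have "runs W \<omega> (Seq (WSet ''v'' (WSub (WReg ''e'') (Const 1)))
            (Loop (WLess (Const 0) (WReg ''v''))
              (Seq play_prog (WSet ''v'' (WSub (WReg ''v'') (Const 1))))))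
          s' (4 * e + 1) (\<lambda>s'. tree_frame s s' \<and> tournament ?K e {..<e} (warr s' ''t'') {})"
      if J: "?J 0 s'" for s'
    proof -
      have "wreg s' ''e'' = e" "1 mod W = 1"
        using J e by (simp_all add: tree_frame_def)
      then show ?thesis
        using e J leaves'[OF J] by (intro runs_Seq_assign runs_mono[OF play]) (auto simp: tree_frame_def)
    qed
    then show "runs W \<omega>
     (Seq (Loop (WLess (WReg ''v'') (WReg ''e''))
       (Seq (WStore ''t'' (WAdd (WReg ''e'') (WReg ''v'')) (WAdd (WReg ''v'') (Const 1)))
         (WSet ''v'' (WAdd (WReg ''v'') (Const 1)))))
      (Seq (WSet ''v'' (WSub (WReg ''e'') (Const 1)))
      (Loop (WLess (Const 0) (WReg ''v''))
        (Seq play_prog (WSet ''v'' (WSub (WReg ''v'') (Const 1)))))))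
     (s\<lparr>wreg := (wreg s)(''v'' := wval W \<omega> s (Const 0))\<rparr>) (T - 1)
     (\<lambda>s'. tree_frame s s' \<and> tournament (rarr s ''K'') e {..<e} (warr s' ''t'') {})"
      using e leaves by (intro runs_Seq[where T = "3 * e + 1" and T' = "4 * e + 1"])
        (simp, erule runs_mono, simp_all)
  qed (use e in auto)
qed

text \<open>Erasing the champion's leaf makes only its parent stale; every match moves this single
  stale node one level up, until it leaves the tree. Halving a node number below
  \<open>2 ^ L\<close> bounds the climb by \<open>L\<close> matches.\<close>

lemma runs_extract:
  assumes e: "wreg s ''e'' = e" "2 * e < W" "e \<le> 2 ^ L" "4 * L + 5 \<le> T"
    and tour: "tournament (rarr s ''K'') e A (warr s ''t'') {}" "A \<subseteq> {..<e}" "A \<noteq> {}"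
  shows "runs W \<omega> extract_prog s T (\<lambda>s'. tree_frame s s' \<and> wreg s' ''b'' = champion (warr s ''t'') \<and>
    tournament (rarr s ''K'') e (A - {champion (warr s ''t'')}) (warr s' ''t'') {})"
proof -
  let ?K = "rarr s ''K''"
  define b where "b = champion (warr s ''t'')"
  have b: "b \<in> A" "b < e" using tournament_champion(1)[OF tour] tour(2) by (auto simp: b_def)
  let ?v = "\<lambda>s'. wreg s' ''v''"
  let ?I = "\<lambda>j s'. ?v s' < 2 ^ j \<and> ?v s' < e \<and> tree_frame s s' \<and> wreg s' ''b'' = b \<and>
    tournament ?K e (A - {b}) (warr s' ''t'') {?v s'}"
  have climb: "runs W \<omega> (Loop (WLess (Const 0) (WReg ''v''))
        (Seq play_prog (WSet ''v'' (WDiv (WReg ''v'') (Const 2))))) s' (4 * L + 1)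
        (\<lambda>s'. tree_frame s s' \<and> wreg s' ''b'' = b \<and> tournament ?K e (A - {b}) (warr s' ''t'') {})"
    if "?I L s'" for s'
  proof (rule runs_Loop_const[where I = ?I and T = 3, OF that])
    fix j s1 assume I: "?I j s1" and "bval W \<omega> s1 (WLess (Const 0) (WReg ''v''))"
    then have v: "0 < ?v s1" by auto
    with I have j: "0 < j" by (cases j) auto
    then have j2: "(2::nat) ^ j = 2 * 2 ^ (j - 1)"
      by (metis Suc_diff_1 power_Suc)
    have t: "tournament ?K e (A - {b}) ((warr s1 ''t'')(?v s1 := winner ?K (warr s1 ''t'' (2 * ?v s1))
        (warr s1 ''t'' (2 * ?v s1 + 1)))) {?v s1 div 2}"
      using I v by (intro tournament_play[where V = "{?v s1}"]) auto
    have "tree_frame s s1" "wreg s1 ''b'' = b" "2 * ?v s1 + 1 < W" "2 < W" "2 mod W = 2"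
      "?v s1 div 2 < 2 ^ (j - 1)" "?v s1 div 2 < e"
      using I v e j2 by auto
    with j t show "0 < j \<and> runs W \<omega> (Seq play_prog (WSet ''v'' (WDiv (WReg ''v'') (Const 2)))) s1 3 (?I (j - 1))"
      by (intro conjI runs_Seq[where T = 2 and T' = 1] runs_play runs_intros) (simp_all add: tree_frame_def)
  next
    fix j s1 assume "?I j s1" "\<not> bval W \<omega> s1 (WLess (Const 0) (WReg ''v''))"
    then have "tree_frame s s1" "wreg s1 ''b'' = b" "tournament ?K e (A - {b}) (warr s1 ''t'') {0}"
      by auto
    then show "tree_frame s s1 \<and> wreg s1 ''b'' = b \<and> tournament ?K e (A - {b}) (warr s1 ''t'') {}"
      unfolding tournament_def by blast
  qed auto
  have "tournament ?K e (A - {b}) ((warr s ''t'')(e + b := 0)) {(e + b) div 2}"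
    unfolding tournament_def
  proof (intro conjI allI impI)
    fix u assume u: "0 < u \<and> u < e \<and> u \<notin> {(e + b) div 2}"
    then have "2 * u \<noteq> e + b" "2 * u + 1 \<noteq> e + b" by auto
    then show "((warr s ''t'')(e + b := 0)) u =
      winner ?K (((warr s ''t'')(e + b := 0)) (2 * u)) (((warr s ''t'')(e + b := 0)) (2 * u + 1))"
      using tournament_inner[OF tour(1)] u by simp
  qed (use tournament_leaf[OF tour(1)] in auto)
  moreover have "(e + b) div 2 < e" "(e + b) div 2 < 2 ^ L" "4 * L + 1 \<le> T - 4" using b e by auto
  moreover have "(2::nat) mod W = 2" "W \<noteq> Suc 0" "(e + b) mod W = e + b" using b e by auto
  moreover have "warr s ''t'' (Suc 0) - Suc 0 = b" by (simp add: b_def champion_def)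
  ultimately have "runs W \<omega> extract_prog s T
    (\<lambda>s'. tree_frame s s' \<and> wreg s' ''b'' = b \<and> tournament ?K e (A - {b}) (warr s' ''t'') {})"
    unfolding extract_prog_def using e(1,4) b(2)
    by (intro runs_Seq_assign runs_mono[OF climb]) (simp_all add: tree_frame_def)
  then show ?thesis
    by (simp only: b_def)
qed

section \<open>The random tape\<close>

text \<open>A residue class has at most \<open>W div s + 1\<close> members below \<open>W\<close>,
  and \<open>s \<le> W\<close> bounds this by \<open>2 * W / s\<close>. The factor 2 is the price
  for words whose range is not a multiple of \<open>s\<close>.\<close>

lemma uniform_mod_le:
  fixes W s t :: nat
  assumes "0 < s" "s \<le> W"
  shows "measure_pmf.prob (pmf_of_set {..<W}) {y. y mod s = t} \<le> 2 / real s"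
proof -
  have "{..<W} \<inter> {y. y mod s = t} \<subseteq> (\<lambda>a. a * s + t) ` {..W div s}"
  proof
    fix y assume y: "y \<in> {..<W} \<inter> {y. y mod s = t}"
    then have "y = y div s * s + t" "y div s \<le> W div s"
      by (auto intro: div_le_mono)
    then show "y \<in> (\<lambda>a. a * s + t) ` {..W div s}" by blast
  qed
  then have "card ({..<W} \<inter> {y. y mod s = t}) \<le> card {..W div s}"
    using card_image_le[of "{..W div s}"] by (meson card_mono finite_atMost finite_imageI order_trans)
  then have "s * card ({..<W} \<inter> {y. y mod s = t}) \<le> s * Suc (W div s)"
    by (intro mult_le_mono2) simp
  also have "\<dots> \<le> s + W" by simp
  also have "\<dots> \<le> 2 * W" using assms by simp
  finally have "real s * real (card ({..<W} \<inter> {y. y mod s = t})) \<le> 2 * real W"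
    by (metis of_nat_le_iff of_nat_mult of_nat_numeral)
  then show ?thesis
    using assms by (subst measure_pmf_of_set) (auto simp: field_simps lessThan_empty_iff)
qed

text \<open>Given all words except \<open>\<omega> q'\<close>, the residue of
  \<open>\<omega> q\<close> is a fixed target for one uniform word.\<close>

lemma tape_collision_le:
  assumes "0 < s" "s \<le> W" "q < W" "q' < W" "q \<noteq> q'"
  shows "measure_pmf.prob (random_tape W) {\<omega>. \<omega> q' mod s = \<omega> q mod s} \<le> 2 / real s"
proof -
  define U where "U = pmf_of_set {..<W}"
  define F where "F = Pi_pmf ({..<W} - {q'}) 0 (\<lambda>_. U)"
  have W: "{..<W} = insert q' ({..<W} - {q'})" using assms by auto
  have "random_tape W = bind_pmf F (\<lambda>f. map_pmf (\<lambda>y. f(q' := y)) U)"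
    unfolding random_tape_def F_def U_def[symmetric]
    by (subst W, subst Pi_pmf_insert', simp, simp, subst bind_commute_pmf) (simp add: map_pmf_def)
  then have "emeasure (measure_pmf (random_tape W)) {\<omega>. \<omega> q' mod s = \<omega> q mod s} =
      (\<integral>\<^sup>+f. emeasure (measure_pmf U) {y. y mod s = f q mod s} \<partial>measure_pmf F)"
    using assms(5) by (simp add: vimage_def)
  also have "\<dots> \<le> (\<integral>\<^sup>+f. ennreal (2 / real s) \<partial>measure_pmf F)"
    using uniform_mod_le[OF assms(1,2)]
    by (intro nn_integral_mono) (simp add: measure_pmf.emeasure_eq_measure U_def ennreal_leI)
  also have "\<dots> = ennreal (2 / real s)" by simp
  finally show ?thesis
    by (simp add: measure_pmf.emeasure_eq_measure)
qed

text \<open>Markov's inequality at threshold 1 for a weighted sum of collision indicators, whose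
  expectation follows from the pairwise bound by linearity.\<close>

lemma weighted_collision_le:
  fixes w :: "nat \<Rightarrow> real"
  assumes "0 < s" "s \<le> W" "a + n \<le> W" "i < n" and w: "\<And>i'. 0 \<le> w i'"
  shows "measure_pmf.prob (random_tape W)
    {\<omega>. 1 \<le> (\<Sum>i'\<in>{i'. i' < n \<and> i' \<noteq> i \<and> \<omega> (a + i') mod s = \<omega> (a + i) mod s}. w i')} \<le> 2 / real s * (\<Sum>i'<n. w i')"
proof -
  let ?M = "measure_pmf (random_tape W)"
  let ?C = "\<lambda>i'. {\<omega>. \<omega> (a + i') mod s = \<omega> (a + i) mod s}"
  let ?X = "\<lambda>\<omega>. \<Sum>i'\<in>{..<n} - {i}. w i' * indicator (?C i') \<omega>"
  have X: "(\<Sum>i'\<in>{i'. i' < n \<and> i' \<noteq> i \<and> \<omega> (a + i') mod s = \<omega> (a + i) mod s}. w i') = ?X \<omega>" for \<omega>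
    by (rule sum.mono_neutral_cong_left) (auto simp: indicator_def)
  have int: "integrable ?M (\<lambda>\<omega>. w i' * indicator (?C i') \<omega>)" for i'
    by (intro integrable_mult_right integrable_real_indicator) (auto simp: measure_pmf.emeasure_eq_measure)
  have "measure ?M {\<omega> \<in> space ?M. 1 \<le> ?X \<omega>} \<le> (\<integral>\<omega>. ?X \<omega> \<partial>?M) / 1"
    using w by (intro integral_Markov_inequality_measure[where A = "{}"] Bochner_Integration.integrable_sum int)
      (auto intro!: sum_nonneg)
  also have "(\<integral>\<omega>. ?X \<omega> \<partial>?M) / 1 = (\<Sum>i'\<in>{..<n} - {i}. \<integral>\<omega>. w i' * indicator (?C i') \<omega> \<partial>?M)"
    by (subst div_by_1, rule Bochner_Integration.integral_sum[OF int])
  also have "\<dots> = (\<Sum>i'\<in>{..<n} - {i}. w i' * measure ?M (?C i'))"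
    by (intro sum.cong) auto
  also have "\<dots> \<le> (\<Sum>i'\<in>{..<n} - {i}. w i' * (2 / real s))"
    using assms by (intro sum_mono mult_left_mono tape_collision_le) auto
  also have "\<dots> \<le> (\<Sum>i'<n. w i' * (2 / real s))"
    using w by (intro sum_mono2) auto
  also have "\<dots> = 2 / real s * (\<Sum>i'<n. w i')"
    by (simp only: sum_distrib_right[symmetric] mult.commute)
  finally show ?thesis
    unfolding X by simp
qed

text \<open>\<open>P\<close> looks only at coordinates in \<open>A\<close> and \<open>R\<close> only
  at the others, and the product distribution splits into independent parts on \<open>A\<close> and
  \<open>I - A\<close>.\<close>

lemma Pi_pmf_prob_conj:
  assumes "finite I" "A \<subseteq> I"
    and P: "\<And>f g. (\<And>x. x \<in> A \<Longrightarrow> f x = g x) \<Longrightarrow> P f = P g"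
    and R: "\<And>f g. (\<And>x. x \<notin> A \<Longrightarrow> f x = g x) \<Longrightarrow> R f = R g"
  shows "measure_pmf.prob (Pi_pmf I d p) {f. P f \<and> R f} =
    measure_pmf.prob (Pi_pmf I d p) {f. P f} * measure_pmf.prob (Pi_pmf I d p) {f. R f}"
proof -
  define MA where "MA = Pi_pmf A d p"
  define MB where "MB = Pi_pmf (I - A) d p"
  have I: "Pi_pmf I d p = map_pmf (\<lambda>(f, g) x. if x \<in> A then f x else g x) (pair_pmf MA MB)"
    using Pi_pmf_union[of A "I - A" d p] assms(1,2) finite_subset[of A I]
    by (simp add: MA_def MB_def Un_absorb1 Int_Diff)
  have P': "P (\<lambda>x. if x \<in> A then f x else g x) = P f" for f g by (rule P) simp
  have R': "R (\<lambda>x. if x \<in> A then f x else g x) = R g" for f g by (rule R) simp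
  have ind: "emeasure (measure_pmf (pair_pmf MA MB)) {(f, g). X f \<and> Y g} =
     emeasure (measure_pmf MA) {f. X f} * emeasure (measure_pmf MB) {g. Y g}" for X Y
  proof -
    have "emeasure (measure_pmf (pair_pmf MA MB)) {(f, g). X f \<and> Y g} =
      (\<integral>\<^sup>+z. indicator {(f, g). X f \<and> Y g} z \<partial>measure_pmf (pair_pmf MA MB))"
      by simp
    also have "\<dots> = (\<integral>\<^sup>+f. \<integral>\<^sup>+g. indicator {f. X f} f * indicator {g. Y g} g \<partial>measure_pmf MB \<partial>measure_pmf MA)"
      by (subst nn_integral_pair_pmf') (auto intro!: nn_integral_cong simp: indicator_def)
    also have "\<dots> = emeasure (measure_pmf MA) {f. X f} * emeasure (measure_pmf MB) {g. Y g}"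
      by (simp add: nn_integral_cmult nn_integral_multc)
    finally show ?thesis .
  qed
  have e: "emeasure (measure_pmf (Pi_pmf I d p)) {f. X f} =
      emeasure (measure_pmf (pair_pmf MA MB)) {(f, g). X (\<lambda>x. if x \<in> A then f x else g x)}" for X
    unfolding I by (simp add: vimage_def case_prod_unfold)
  have "emeasure (measure_pmf (Pi_pmf I d p)) {f. P f \<and> R f} =
    emeasure (measure_pmf (Pi_pmf I d p)) {f. P f} * emeasure (measure_pmf (Pi_pmf I d p)) {f. R f}"
    using ind[of P R] ind[of P "\<lambda>_. True"] ind[of "\<lambda>_. True" R] unfolding e P' R' by simp
  then show ?thesis
    by (simp add: measure_pmf.emeasure_eq_measure ennreal_mult'[symmetric])
qed

text \<open>One block is split off at a time: by disjointness, the events of the other blocks do not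
  look at \<open>B j\<close>.\<close>

lemma Pi_pmf_prob_all:
  fixes P :: "'b \<Rightarrow> ('a \<Rightarrow> 'c) \<Rightarrow> bool"
  assumes "finite I" "finite J" "disjoint_family_on B J" "\<And>j. j \<in> J \<Longrightarrow> B j \<subseteq> I"
    and "\<And>j f g. j \<in> J \<Longrightarrow> (\<And>x. x \<in> B j \<Longrightarrow> f x = g x) \<Longrightarrow> P j f = P j g"
  shows "measure_pmf.prob (Pi_pmf I d p) {f. \<forall>j\<in>J. P j f} = (\<Prod>j\<in>J. measure_pmf.prob (Pi_pmf I d p) {f. P j f})"
  using assms(2-5)
proof (induction J rule: finite_induct)
  case empty
  then show ?case by simp
next
  case (insert j J)
  have disj: "x \<notin> B j" if j': "j' \<in> J" "x \<in> B j'" for x j'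
    using disjoint_family_onD[OF insert.prems(1), of j j'] insert.hyps(2) j' by auto
  have "{f. \<forall>j'\<in>insert j J. P j' f} = {f. P j f \<and> (\<forall>j'\<in>J. P j' f)}" by auto
  also have "measure_pmf.prob (Pi_pmf I d p) \<dots> =
    measure_pmf.prob (Pi_pmf I d p) {f. P j f} * measure_pmf.prob (Pi_pmf I d p) {f. \<forall>j\<in>J. P j f}"
  proof (rule Pi_pmf_prob_conj[where A = "B j"])
    show "P j f = P j g" if "\<And>x. x \<in> B j \<Longrightarrow> f x = g x" for f g
      by (rule insert.prems(3)) (use that in auto)
    show "(\<forall>j\<in>J. P j f) = (\<forall>j\<in>J. P j g)" if "\<And>x. x \<notin> B j \<Longrightarrow> f x = g x" for f g
    proof (rule ball_cong[OF refl])
      fix j' assume "j' \<in> J"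
      then show "P j' f = P j' g"
        by (intro insert.prems(3)) (use that disj in auto)
    qed
  qed (use assms(1) insert.prems in auto)
  also have "measure_pmf.prob (Pi_pmf I d p) {f. \<forall>j\<in>J. P j f} = (\<Prod>j\<in>J. measure_pmf.prob (Pi_pmf I d p) {f. P j f})"
  proof (rule insert.IH)
    show "P j f = P j g" if "j \<in> J" "\<And>x. x \<in> B j \<Longrightarrow> f x = g x" for j f g
      by (rule insert.prems(3)) (use that(1) in simp, rule that(2))
  qed (use insert.prems in \<open>auto simp: disjoint_family_on_def\<close>)
  finally show ?case using insert.hyps by simp
qed

text \<open>Union bound over the sets of \<open>L\<close> rows that may fail together.\<close>

lemma Pi_pmf_prob_many_le:
  fixes P :: "'b \<Rightarrow> ('a \<Rightarrow> 'c) \<Rightarrow> bool" and \<epsilon> :: real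
  assumes "finite I" "finite J" "disjoint_family_on B J" "\<And>j. j \<in> J \<Longrightarrow> B j \<subseteq> I"
    and "\<And>j f g. j \<in> J \<Longrightarrow> (\<And>x. x \<in> B j \<Longrightarrow> f x = g x) \<Longrightarrow> P j f = P j g"
    and "0 \<le> \<epsilon>" "\<And>j. j \<in> J \<Longrightarrow> measure_pmf.prob (Pi_pmf I d p) {f. P j f} \<le> \<epsilon>"
  shows "measure_pmf.prob (Pi_pmf I d p) {f. L \<le> card {j \<in> J. P j f}} \<le> 2 ^ card J * \<epsilon> ^ L"
proof -
  let ?S = "{S. S \<subseteq> J \<and> card S = L}"
  have fin: "finite ?S" using assms(2) by simp
  have "{f. L \<le> card {j \<in> J. P j f}} \<subseteq> (\<Union>S\<in>?S. {f. \<forall>j\<in>S. P j f})"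
  proof
    fix f assume "f \<in> {f. L \<le> card {j \<in> J. P j f}}"
    then have "L \<le> card {j \<in> J. P j f}" by simp
    then obtain S where "S \<subseteq> {j \<in> J. P j f}" "card S = L"
      by (rule obtain_subset_with_card_n)
    then show "f \<in> (\<Union>S\<in>?S. {f. \<forall>j\<in>S. P j f})" by blast
  qed
  then have "measure_pmf.prob (Pi_pmf I d p) {f. L \<le> card {j \<in> J. P j f}} \<le>
      measure_pmf.prob (Pi_pmf I d p) (\<Union>S\<in>?S. {f. \<forall>j\<in>S. P j f})"
    by (intro measure_pmf.finite_measure_mono) auto
  also have "\<dots> \<le> (\<Sum>S\<in>?S. measure_pmf.prob (Pi_pmf I d p) {f. \<forall>j\<in>S. P j f})"
    by (rule measure_pmf.finite_measure_subadditive_finite) (use fin in auto)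
  also have "\<dots> \<le> (\<Sum>S\<in>?S. \<epsilon> ^ L)"
  proof (rule sum_mono)
    fix S assume S: "S \<in> ?S"
    then have fS: "finite S" using assms(2) finite_subset by auto
    have "measure_pmf.prob (Pi_pmf I d p) {f. \<forall>j\<in>S. P j f} = (\<Prod>j\<in>S. measure_pmf.prob (Pi_pmf I d p) {f. P j f})"
    proof (rule Pi_pmf_prob_all[where B = B])
      show "P j f = P j g" if "j \<in> S" "\<And>x. x \<in> B j \<Longrightarrow> f x = g x" for j f g
        by (rule assms(5)) (use S that(1) in blast, rule that(2))
      show "disjoint_family_on B S"
        using assms(3) S unfolding disjoint_family_on_def by blast
    qed (use S fS assms(1,4) in auto)
    also have "\<dots> \<le> (\<Prod>j\<in>S. \<epsilon>)"
      using S assms(7) by (intro prod_mono) auto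
    finally show "measure_pmf.prob (Pi_pmf I d p) {f. \<forall>j\<in>S. P j f} \<le> \<epsilon> ^ L"
      using S by simp
  qed
  also have "\<dots> = real (card ?S) * \<epsilon> ^ L" by simp
  \<comment> \<open>All subsets of \<open>J\<close> are counted instead of those of size
    \<open>L\<close>; for \<open>2 * L\<close> rows this is the factor \<open>4 ^ L\<close>.\<close>
  also have "\<dots> \<le> 2 ^ card J * \<epsilon> ^ L"
  proof (rule mult_right_mono)
    have "card ?S \<le> card (Pow J)"
      using assms(2) by (intro card_mono) auto
    then show "real (card ?S) \<le> 2 ^ card J"
      using assms(2) by (simp add: card_Pow)
  qed (use \<open>0 \<le> \<epsilon>\<close> in simp)
  finally show ?thesis .
qed

text \<open>For upward counters: \<open>i\<close> iterations are done, and the invariant alone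
  decides the test, so that the loop is left exactly at \<open>N\<close>.\<close>

lemma runs_count:
  assumes "I 0 s"
    and step: "\<And>i s. I i s \<Longrightarrow> i < N \<Longrightarrow> bval W \<omega> s b \<and> runs W \<omega> p s T (I (Suc i))"
    and exit: "\<And>s. I N s \<Longrightarrow> \<not> bval W \<omega> s b \<and> Q s"
    and "N * Suc T < T'"
  shows "runs W \<omega> (Loop b p) s T' Q"
proof (rule runs_Loop_const[where I = "\<lambda>j s. \<exists>i. i + j = N \<and> I i s" and T = T and j = N])
  fix j s assume "\<exists>i. i + j = N \<and> I i s" and b: "bval W \<omega> s b"
  then obtain i where i: "i + j = N" "I i s" by blast
  with exit b have "i < N" by (cases "i = N") auto
  with step[OF i(2)] i(1) have "0 < j" "runs W \<omega> p s T (I (Suc i))" by auto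
  moreover from this i(1) have "Suc i + (j - 1) = N" by simp
  ultimately show "0 < j \<and> runs W \<omega> p s T (\<lambda>s. \<exists>i. i + (j - 1) = N \<and> I i s)"
    by (blast intro: runs_mono[OF _ order_refl])
next
  fix j s assume "\<exists>i. i + j = N \<and> I i s" and b: "\<not> bval W \<omega> s b"
  then obtain i where i: "i + j = N" "I i s" by blast
  with step b have "i = N" by (cases "i < N") auto
  with exit[of s] i show "Q s" by simp
qed (use assms(1,4) in auto)

section \<open>The programs\<close>

text \<open>
  The sketch consists of \<open>2 * L + 1\<close> rows of \<open>s\<close> buckets each. The item \<open>q = j * n + i\<close>
  stands for the coordinate \<open>i\<close> in row \<open>j\<close>. Row 0 is a fixed balanced partition of the coordinates,
  used to estimate the bias; the other rows are hashed by the random tape.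
\<close>

definition slot :: "nat \<Rightarrow> nat \<Rightarrow> tape \<Rightarrow> nat \<Rightarrow> nat" where
  "slot n s \<omega> q = (if q < n then q mod s else \<omega> q mod s)"

definition bucket :: "nat \<Rightarrow> nat \<Rightarrow> tape \<Rightarrow> nat \<Rightarrow> nat" where
  "bucket n s \<omega> q = q div n * s + slot n s \<omega> q"

definition bucket_items :: "nat \<Rightarrow> nat \<Rightarrow> tape \<Rightarrow> nat \<Rightarrow> nat \<Rightarrow> nat set" where
  "bucket_items n s \<omega> N b = {q. q < N \<and> bucket n s \<omega> q = b}"

lemma bucket_items_0 [simp]: "bucket_items n s \<omega> 0 b = {}"
  by (simp add: bucket_items_def)

lemma finite_bucket_items [simp]: "finite (bucket_items n s \<omega> N b)"
  by (simp add: bucket_items_def)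

lemma bucket_items_Suc:
  "bucket_items n s \<omega> (Suc N) b =
    (if bucket n s \<omega> N = b then insert N (bucket_items n s \<omega> N b) else bucket_items n s \<omega> N b)"
  by (auto simp: bucket_items_def less_Suc_eq)

lemma notin_bucket_items [simp]: "N \<notin> bucket_items n s \<omega> N b"
  by (simp add: bucket_items_def)

definition incr :: "name \<Rightarrow> prog" where
  "incr x = WSet x (WAdd (WReg x) (Const 1))"

text \<open>\<open>l\<close> becomes \<open>clog n\<close>, found by doubling \<open>p\<close> until
  it reaches \<open>n\<close>.\<close>

definition init_prog :: prog where
  "init_prog =
    Seq (WSet ''p'' (Const 1))
    (Seq (Loop (WLess (WReg ''p'') (WReg ''n''))
       (Seq (WSet ''p'' (WAdd (WReg ''p'') (WReg ''p''))) (incr ''l'')))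
    (Seq (WSet ''s'' (WMul (Const 320) (WReg ''k'')))
    (Seq (WSet ''m'' (WMul (WAdd (WMul (Const 2) (WReg ''l'')) (Const 1)) (WReg ''s'')))
      (WSet ''N'' (WMul (WAdd (WMul (Const 2) (WReg ''l'')) (Const 1)) (WReg ''n''))))))"

text \<open>
  \<open>1 - q div n\<close> with truncated subtraction tells row 0 from the other rows.
\<close>

definition bucket_exp :: wexp where
  "bucket_exp =
    WAdd (WMul (WDiv (WReg ''q'') (WReg ''n'')) (WReg ''s''))
      (WMod (WAdd (WMul (WSub (Const 1) (WDiv (WReg ''q'') (WReg ''n''))) (WReg ''q''))
               (WMul (WSub (Const 1) (WSub (Const 1) (WDiv (WReg ''q'') (WReg ''n'')))) (Tape (WReg ''q''))))
        (WReg ''s''))"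

definition copy_prog :: prog where
  "copy_prog = Loop (WLess (WReg ''q'') (WReg ''n''))
    (Seq (RStore ''out'' (WReg ''q'') (RLoad ''in'' (WReg ''q''))) (incr ''q''))"

definition sketch_main :: prog where
  "sketch_main = Loop (WLess (WReg ''q'') (WReg ''N''))
    (Seq (RStore ''out'' bucket_exp (RAdd (RLoad ''out'' bucket_exp)
        (RLoad ''in'' (WMod (WReg ''q'') (WReg ''n''))))) (incr ''q''))"

text \<open>The same program has to serve all \<open>n\<close> and \<open>k\<close>, so the choice
  between hashing and the identity is made at run time; recovery repeats the same test.\<close>

definition sketch_prog :: prog where
  "sketch_prog = Seq init_prog (Cond (WLess (WReg ''m'') (WReg ''n'')) sketch_main copy_prog)"

text \<open>
  The items of a bucket form a linked list: \<open>h\<close> holds the heads, \<open>x\<close> the successors, and an item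
  is represented by its successor number because zero ends a list.
\<close>

definition count_prog :: prog where
  "count_prog = Loop (WLess (WReg ''q'') (WReg ''N''))
    (Seq (WStore ''c'' bucket_exp (WAdd (WLoad ''c'' bucket_exp) (Const 1)))
    (Seq (WStore ''x'' (WReg ''q'') (WLoad ''h'' bucket_exp))
    (Seq (WStore ''h'' bucket_exp (WAdd (WReg ''q'') (Const 1)))
      (incr ''q''))))"

definition bias_keys_prog :: prog where
  "bias_keys_prog = Loop (WLess (WReg ''q'') (WReg ''s''))
     (Seq (RStore ''K'' (WReg ''q'') (RDiv (RLoad ''in'' (WReg ''q'')) (OfWord (WLoad ''c'' (WReg ''q'')))))
        (incr ''q''))"

definition bias_select_prog :: prog where
  "bias_select_prog = Loop (WLess (WReg ''r'') (WAdd (WDiv (WReg ''s'') (Const 2)) (Const 1)))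
     (Seq extract_prog (Seq (RSet ''B'' (RLoad ''K'' (WReg ''b''))) (incr ''r'')))"

text \<open>By linearity this yields the bucket sums of the shifted vector: \<open>c\<close> says
  how many coordinates, each carrying the bias once, a bucket contains.\<close>

definition keys_prog :: prog where
  "keys_prog = Loop (WLess (WReg ''q'') (WReg ''m''))
     (Seq (RStore ''K'' (WReg ''q'') (RSub (RLoad ''in'' (WReg ''q''))
          (RMul (RReg ''B'') (OfWord (WLoad ''c'' (WReg ''q''))))))
        (incr ''q''))"

text \<open>The counter is incremented before it is compared with \<open>l + 2\<close>, so
  \<open>out\<close> is overwritten on the visits 1 to \<open>l + 1\<close> to a coordinate and is
  frozen afterwards.\<close>

definition visit_body :: prog where
  "visit_body = Seq (WSet ''q'' (WSub (WReg ''q'') (Const 1)))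
     (Seq (WSet ''i'' (WMod (WReg ''q'') (WReg ''n'')))
     (Seq (WStore ''d'' (WReg ''i'') (WAdd (WLoad ''d'' (WReg ''i'')) (Const 1)))
     (Seq (Cond (WLess (WLoad ''d'' (WReg ''i'')) (WAdd (WReg ''l'') (Const 2)))
            (RStore ''out'' (WReg ''i'') (RAdd (RLoad ''K'' (WReg ''b'')) (RReg ''B''))) Skip)
       (WSet ''q'' (WLoad ''x'' (WReg ''q''))))))"

definition visit_prog :: prog where
  "visit_prog = Loop (WLess (Const 0) (WReg ''q'')) visit_body"

definition sweep_prog :: prog where
  "sweep_prog = Loop (WLess (WReg ''r'') (WReg ''m''))
     (Seq extract_prog
     (Seq (WSet ''q'' (WLoad ''h'' (WReg ''b'')))
     (Seq visit_prog
       (incr ''r''))))"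

definition recovery_main :: prog where
  "recovery_main =
    Seq count_prog
    (Seq (WSet ''q'' (Const 0))
    (Seq bias_keys_prog
    (Seq (WSet ''e'' (WReg ''s''))
    (Seq build_prog
    (Seq (WSet ''r'' (Const 0))
    (Seq bias_select_prog
    (Seq (WSet ''q'' (Const 0))
    (Seq keys_prog
    (Seq (WSet ''e'' (WReg ''m''))
    (Seq build_prog
    (Seq (WSet ''r'' (Const 0))
      sweep_prog)))))))))))"

definition recovery_prog :: prog where
  "recovery_prog = Seq init_prog (Cond (WLess (WReg ''m'') (WReg ''n'')) recovery_main copy_prog)"

section \<open>Initialisation and the trivial sketch\<close>

text \<open>The ceiling of the binary logarithm, for positive \<open>n\<close>.\<close>

definition clog :: "nat \<Rightarrow> nat" where
  "clog n = (LEAST L. n \<le> 2 ^ L)"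

lemma clog: "n \<le> 2 ^ clog n"
  unfolding clog_def by (rule LeastI[of _ n]) simp

lemma less_clog: "i < clog n \<Longrightarrow> 2 ^ i < n"
  unfolding clog_def using not_less_Least not_less by blast

lemma runs_init:
  assumes "wreg s ''l'' = 0" "wreg s ''n'' = n" "wreg s ''k'' = k" "1 \<le> k" "320 < W" "2 * n < W"
    "(2 * clog n + 1) * (320 * k) < W" "(2 * clog n + 1) * n < W" "3 * clog n + 5 \<le> T"
    and Q: "\<And>s' :: state. wreg s' ''n'' = n \<Longrightarrow> wreg s' ''l'' = clog n \<Longrightarrow> wreg s' ''s'' = 320 * k \<Longrightarrow>
      wreg s' ''m'' = (2 * clog n + 1) * (320 * k) \<Longrightarrow> wreg s' ''N'' = (2 * clog n + 1) * n \<Longrightarrow>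
      wreg s' ''q'' = wreg s ''q'' \<Longrightarrow> warr s' = warr s \<Longrightarrow> rarr s' = rarr s \<Longrightarrow> Q s'"
  shows "runs W \<omega> init_prog s T Q"
proof -
  let ?I = "\<lambda>i s' :: state. wreg s' ''p'' = 2 ^ i \<and> wreg s' ''l'' = i \<and> wreg s' ''n'' = n \<and> wreg s' ''k'' = k \<and>
     wreg s' ''q'' = wreg s ''q'' \<and> warr s' = warr s \<and> rarr s' = rarr s"
  have loop: "runs W \<omega> (Loop (WLess (WReg ''p'') (WReg ''n''))
      (Seq (WSet ''p'' (WAdd (WReg ''p'') (WReg ''p''))) (incr ''l''))) (s\<lparr>wreg := (wreg s)(''p'' := 1)\<rparr>) (3 * clog n + 1) (?I (clog n))"
  proof (rule runs_count[where I = ?I and T = 2 and N = "clog n"])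
    fix i s' assume I: "?I i s'" and i: "i < clog n"
    have "(2::nat) ^ i < n" using less_clog[OF i] .
    moreover have "i < 2 ^ i" by simp
    ultimately have "2 ^ i + 2 ^ i < W" "Suc i < W" "2 ^ i < n" "W \<noteq> Suc 0"
      using assms(6) by linarith+
    with I show "bval W \<omega> s' (WLess (WReg ''p'') (WReg ''n'')) \<and>
      runs W \<omega> (Seq (WSet ''p'' (WAdd (WReg ''p'') (WReg ''p''))) (incr ''l'')) s' 2 (?I (Suc i))"
      unfolding incr_def by (intro conjI runs_intros) simp_all
  next
    fix s' assume "?I (clog n) s'"
    with clog[of n] show "\<not> bval W \<omega> s' (WLess (WReg ''p'') (WReg ''n'')) \<and> ?I (clog n) s'"
      by simp
  qed (use assms in simp_all)
  define D where "D = 2 * clog n + 1"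
  define w where "w = 320 * k"
  have "D * 1 \<le> D * w" "1 * w \<le> D * w"
    using assms(4) unfolding D_def w_def by (intro mult_le_mono; simp)+
  then have small: "D < W" "w < W" "D * w < W" "D * n < W" "2 * clog n < W" "W \<noteq> Suc 0" "2 < W" "320 < W"
    using assms(5,7,8) unfolding D_def[symmetric] w_def[symmetric] by (auto simp: D_def)
  have rest: "runs W \<omega> (Seq (WSet ''s'' (WMul (Const 320) (WReg ''k'')))
    (Seq (WSet ''m'' (WMul (WAdd (WMul (Const 2) (WReg ''l'')) (Const 1)) (WReg ''s'')))
      (WSet ''N'' (WMul (WAdd (WMul (Const 2) (WReg ''l'')) (Const 1)) (WReg ''n''))))) s' 3 Q" if I: "?I (clog n) s'" for s'
  proof -
    have "Suc (2 * clog n) mod W = D" "320 * k mod W = w"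
      using small by (simp_all add: D_def w_def)
    then show ?thesis
      using I small by (intro runs_intros Q[folded w_def D_def]) simp_all
  qed
  show ?thesis
    unfolding init_prog_def
  proof (intro runs_Seq_assign)
    show "runs W \<omega> (Seq (Loop (WLess (WReg ''p'') (WReg ''n''))
       (Seq (WSet ''p'' (WAdd (WReg ''p'') (WReg ''p''))) (incr ''l'')))
     (Seq (WSet ''s'' (WMul (Const 320) (WReg ''k'')))
     (Seq (WSet ''m'' (WMul (WAdd (WMul (Const 2) (WReg ''l'')) (Const 1)) (WReg ''s'')))
      (WSet ''N'' (WMul (WAdd (WMul (Const 2) (WReg ''l'')) (Const 1)) (WReg ''n''))))))
     (s\<lparr>wreg := (wreg s)(''p'' := wval W \<omega> s (Const 1))\<rparr>) (T - 1) Q"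
    proof (rule runs_Seq[where T = "3 * clog n + 1" and T' = 3])
      show "runs W \<omega> (Loop (WLess (WReg ''p'') (WReg ''n''))
         (Seq (WSet ''p'' (WAdd (WReg ''p'') (WReg ''p''))) (incr ''l'')))
        (s\<lparr>wreg := (wreg s)(''p'' := wval W \<omega> s (Const 1))\<rparr>) (3 * clog n + 1)
        (\<lambda>s'. runs W \<omega> (Seq (WSet ''s'' (WMul (Const 320) (WReg ''k'')))
           (Seq (WSet ''m'' (WMul (WAdd (WMul (Const 2) (WReg ''l'')) (Const 1)) (WReg ''s'')))
             (WSet ''N'' (WMul (WAdd (WMul (Const 2) (WReg ''l'')) (Const 1)) (WReg ''n''))))) s' 3 Q)"
        using runs_mono[OF loop order_refl rest] small(6) by simp
    qed (use assms(9) in simp)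
  qed (use assms(9) in simp)
qed

lemma runs_copy:
  assumes "wreg s ''q'' = 0" "wreg s ''n'' = n" "2 * n < W" "0 < n" "3 * n + 1 \<le> T"
  shows "runs W \<omega> copy_prog s T (\<lambda>s'. \<forall>i<n. rarr s' ''out'' i = rarr s ''in'' i)"
proof -
  let ?I = "\<lambda>i s' :: state. wreg s' ''q'' = i \<and> wreg s' ''n'' = n \<and> rarr s' ''in'' = rarr s ''in'' \<and> 
    (\<forall>j<i. rarr s' ''out'' j = rarr s ''in'' j)"
  show ?thesis
    unfolding copy_prog_def incr_def
  proof (rule runs_count[where I = ?I and T = 2 and N = n])
    fix i s' assume "?I i s'" "i < n"
    moreover from this assms have "Suc i < W" "W \<noteq> Suc 0" by simp_all
    ultimately show "bval W \<omega> s' (WLess (WReg ''q'') (WReg ''n'')) \<and>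
      runs W \<omega> (Seq (RStore ''out'' (WReg ''q'') (RLoad ''in'' (WReg ''q''))) 
        (WSet ''q'' (WAdd (WReg ''q'') (Const 1)))) s' 2 (?I (Suc i))"
      by (intro conjI runs_intros) (simp_all add: less_Suc_eq)
  qed (use assms in simp_all)
qed

lemma wval_bucket_exp:
  assumes "wreg s ''q'' = q" "wreg s ''n'' = n" "wreg s ''s'' = b"
    and "q < W" "1 < W" "\<omega> q < W" "0 < n" "0 < b" "bucket n b \<omega> q < W"
  shows "wval W \<omega> s bucket_exp = bucket n b \<omega> q"
proof -
  \<comment> \<open>Both summands of the bucket number are bounded by it, so no reduction modulo
    \<open>W\<close> takes effect.\<close>
  have *: "slot n b \<omega> q \<le> bucket n b \<omega> q" "q div n * b \<le> bucket n b \<omega> q"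
    by (simp_all add: bucket_def)
  have "q < n \<longleftrightarrow> q div n = 0"
    using assms(7) by (simp add: div_eq_0_iff)
  then consider "q < n" "q div n = 0" | "\<not> q < n" "1 \<le> q div n"
    by linarith
  then show ?thesis
  proof cases
    case 1
    then show ?thesis
      using assms * unfolding bucket_exp_def bucket_def slot_def by simp
  next
    case 2
    then have "1 - q div n = 0" by simp
    then show ?thesis
      using assms * 2 unfolding bucket_exp_def bucket_def slot_def by simp
  qed
qed

section \<open>Correctness and running time of the programs on a fixed tape\<close>

fun chain :: "(nat \<Rightarrow> nat) \<Rightarrow> nat \<Rightarrow> nat list \<Rightarrow> bool" where
  "chain x h [] \<longleftrightarrow> h = 0"
| "chain x h (q # qs) \<longleftrightarrow> h = Suc q \<and> chain x (x q) qs"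

text \<open>Used when an item is pushed onto a list: setting its successor leaves all existing lists
  intact.\<close>

lemma chain_update: "q \<notin> set qs \<Longrightarrow> chain (x(q := y)) h qs = chain x h qs"
  by (induction qs arbitrary: h) auto

text \<open>The case in which the sketch is shorter than the vector. From \<open>m < n\<close>
  follow \<open>D < n\<close> and \<open>N < n * n \<le> W\<close>, so every item number is a word
  and an address of the tape.\<close>

locale sketch =
  fixes n k W :: nat and \<omega> :: tape
  assumes n: "2 \<le> n" and k: "1 \<le> k" and W: "n * n \<le> W" and tape: "\<And>q. \<omega> q < W"
    and small: "(2 * clog n + 1) * (320 * k) < n"
begin

definition "s = 320 * k"
definition "D = 2 * clog n + 1"
definition "m = D * s"
definition "N = D * n"

lemma m_less: "m < n"
  using small by (simp only: m_def D_def s_def)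

lemma s_pos: "0 < s" "even s" "2 \<le> s"
  using k by (auto simp: s_def)

lemma D_pos: "0 < D"
  by (simp add: D_def)

lemma s_le_m: "s \<le> m"
  using D_pos by (simp add: m_def)

lemma D_le_m: "D \<le> m"
  using s_pos by (simp add: m_def)

lemma W_bounds: "N < W" "2 * n \<le> W" "n < W" "m < W" "2 < W" "2 * m < W"
proof -
  have "N < n * n"
    using D_le_m m_less n by (simp add: N_def)
  then show "N < W" using W by simp
  have "2 * n \<le> n * n" using n by simp
  then show "2 * n \<le> W" using W by linarith
  then show "n < W" "m < W" "2 < W" "2 * m < W" using n m_less s_le_m s_pos by auto
qed

abbreviation "bkt \<equiv> bucket n s \<omega>"

lemma slot_less: "slot n s \<omega> q < s"
  using s_pos by (simp add: slot_def)

lemma bkt_div: "bkt q div s = q div n"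
  using slot_less s_pos by (simp add: bucket_def)

lemma bkt_less: "q < N \<Longrightarrow> bkt q < m"
proof -
  assume "q < N"
  then have "q div n < D"
    by (simp add: N_def less_mult_imp_div_less)
  then have "bkt q div s < D" by (simp add: bkt_div)
  then show ?thesis
    using s_pos by (simp add: m_def div_less_iff_less_mult)
qed

definition env :: "state \<Rightarrow> bool" where
  "env st \<longleftrightarrow> wreg st ''n'' = n \<and> wreg st ''l'' = clog n \<and> wreg st ''s'' = s \<and> wreg st ''m'' = m \<and> wreg st ''N'' = N"

lemma wval_bkt:
  assumes "wreg st ''n'' = n" "wreg st ''s'' = s" "wreg st ''q'' < N"
  shows "wval W \<omega> st bucket_exp = bkt (wreg st ''q'')"
  using assms W_bounds bkt_less[OF assms(3)] n s_pos tape by (intro wval_bucket_exp) auto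

lemma runs_sketch_main:
  assumes "env s0" "wreg s0 ''q'' = 0" "rarr s0 ''out'' = (\<lambda>_. 0)" "3 * N + 1 \<le> T"
  shows "runs W \<omega> sketch_main s0 T
    (\<lambda>s'. \<forall>b. rarr s' ''out'' b = (\<Sum>q\<in>bucket_items n s \<omega> N b. rarr s0 ''in'' (q mod n)))"
proof -
  let ?I = "\<lambda>i s' :: state. env s' \<and> wreg s' ''q'' = i \<and> rarr s' ''in'' = rarr s0 ''in'' \<and>
    (\<forall>b. rarr s' ''out'' b = (\<Sum>q\<in>bucket_items n s \<omega> i b. rarr s0 ''in'' (q mod n)))"
  show ?thesis
    unfolding sketch_main_def incr_def
  proof (rule runs_count[where I = ?I and T = 2 and N = N])
    fix i s1 assume I: "?I i s1" and i: "i < N"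
    have val: "wval W \<omega> s1 bucket_exp = bkt i"
      using I i by (subst wval_bkt) (auto simp: env_def)
    moreover have "Suc i < W" "W \<noteq> Suc 0"
      using W_bounds i by auto
    ultimately show "bval W \<omega> s1 (WLess (WReg ''q'') (WReg ''N'')) \<and>
      runs W \<omega> (Seq (RStore ''out'' bucket_exp (RAdd (RLoad ''out'' bucket_exp)
        (RLoad ''in'' (WMod (WReg ''q'') (WReg ''n''))))) (WSet ''q'' (WAdd (WReg ''q'') (Const 1)))) s1 2 (?I (Suc i))"
      using I i by (intro conjI runs_intros) (simp_all add: env_def bucket_items_Suc)
  qed (use assms in \<open>simp_all add: env_def\<close>)
qed

lemma runs_count_prog:
  assumes "env s0" "wreg s0 ''q'' = 0" "warr s0 ''c'' = (\<lambda>_. 0)" "warr s0 ''h'' = (\<lambda>_. 0)" "5 * N + 1 \<le> T"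
  shows "runs W \<omega> count_prog s0 T
    (\<lambda>s'. env s' \<and> rarr s' = rarr s0 \<and> rreg s' = rreg s0 \<and> warr s' ''d'' = warr s0 ''d'' \<and>
       (\<forall>b. warr s' ''c'' b = card (bucket_items n s \<omega> N b)) \<and>
       (\<forall>b. \<exists>qs. set qs = bucket_items n s \<omega> N b \<and> distinct qs \<and> chain (warr s' ''x'') (warr s' ''h'' b) qs))"
proof -
  let ?C = "\<lambda>i s' :: state. \<forall>b. \<exists>qs. set qs = bucket_items n s \<omega> i b \<and> distinct qs \<and> chain (warr s' ''x'') (warr s' ''h'' b) qs"
  let ?I = "\<lambda>i s' :: state. env s' \<and> wreg s' ''q'' = i \<and> rarr s' = rarr s0 \<and> rreg s' = rreg s0 \<and> warr s' ''d'' = warr s0 ''d'' \<and>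
    (\<forall>b. warr s' ''c'' b = card (bucket_items n s \<omega> i b)) \<and> ?C i s'"
  show ?thesis
    unfolding count_prog_def incr_def
  proof (rule runs_count[where I = ?I and T = 4 and N = N])
    fix i s1 assume I: "?I i s1" and i: "i < N"
    let ?b = "bkt i" let ?x = "warr s1 ''x''" let ?h = "warr s1 ''h''"
    have val: "wval W \<omega> u bucket_exp = ?b" if "wreg u = wreg s1" for u
      using I i that by (subst wval_bkt) (auto simp: env_def)
    have "card (bucket_items n s \<omega> i ?b) \<le> card {..<i}"
      by (intro card_mono) (auto simp: bucket_items_def)
    then have "Suc (card (bucket_items n s \<omega> i ?b)) < W" "Suc i < W" "W \<noteq> Suc 0"
      using W_bounds i by auto
    moreover have "\<exists>qs. set qs = bucket_items n s \<omega> (Suc i) b \<and> distinct qs \<and>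
        chain (?x(i := ?h ?b)) ((?h(?b := Suc i)) b) qs" for b
    proof -
      from I obtain qs where qs: "set qs = bucket_items n s \<omega> i b" "distinct qs" "chain ?x (?h b) qs"
        by blast
      then have "i \<notin> set qs" by simp
      then have "chain (?x(i := ?h ?b)) (?h b) qs"
        using qs(3) by (simp add: chain_update)
      with qs \<open>i \<notin> set qs\<close> show ?thesis
        by (cases "b = ?b") (auto simp: bucket_items_Suc intro: exI[of _ "i # qs"] exI[of _ qs])
    qed
    ultimately show "bval W \<omega> s1 (WLess (WReg ''q'') (WReg ''N'')) \<and>
      runs W \<omega> (Seq (WStore ''c'' bucket_exp (WAdd (WLoad ''c'' bucket_exp) (Const 1)))
        (Seq (WStore ''x'' (WReg ''q'') (WLoad ''h'' bucket_exp))
        (Seq (WStore ''h'' bucket_exp (WAdd (WReg ''q'') (Const 1)))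
          (WSet ''q'' (WAdd (WReg ''q'') (Const 1)))))) s1 4 (?I (Suc i))"
      using I i by (intro conjI runs_intros) (simp_all add: env_def bucket_items_Suc val)
  qed (use assms in \<open>simp_all add: env_def exI[of _ "[]"]\<close>)
qed


lemma m_le_pow: "m \<le> 2 ^ clog n" "s \<le> 2 ^ clog n"
  using m_less clog[of n] s_le_m by linarith+

section \<open>Bucket keys and the selection of the bias\<close>

lemma runs_bias_keys:
  assumes "env s0" "wreg s0 ''q'' = 0" "3 * s + 1 \<le> T"
  shows "runs W \<omega> bias_keys_prog s0 T
    (\<lambda>s'. env s' \<and> warr s' = warr s0 \<and> rreg s' = rreg s0 \<and> (\<forall>a. a \<noteq> ''K'' \<longrightarrow> rarr s' a = rarr s0 a) \<and>
       (\<forall>b<s. rarr s' ''K'' b = rarr s0 ''in'' b / real (warr s0 ''c'' b)))"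
proof -
  let ?I = "\<lambda>i s' :: state. env s' \<and> wreg s' ''q'' = i \<and> warr s' = warr s0 \<and> rreg s' = rreg s0 \<and>
    (\<forall>a. a \<noteq> ''K'' \<longrightarrow> rarr s' a = rarr s0 a) \<and>
    (\<forall>b<i. rarr s' ''K'' b = rarr s0 ''in'' b / real (warr s0 ''c'' b))"
  show ?thesis
    unfolding bias_keys_prog_def incr_def
  proof (rule runs_count[where I = ?I and T = 2 and N = s])
    fix i s1 assume I: "?I i s1" and i: "i < s"
    have "Suc i < W" "W \<noteq> Suc 0"
      using W_bounds s_le_m i by auto
    then show "bval W \<omega> s1 (WLess (WReg ''q'') (WReg ''s'')) \<and>
      runs W \<omega> (Seq (RStore ''K'' (WReg ''q'') (RDiv (RLoad ''in'' (WReg ''q'')) (OfWord (WLoad ''c'' (WReg ''q'')))))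
        (WSet ''q'' (WAdd (WReg ''q'') (Const 1)))) s1 2 (?I (Suc i))"
      using I i by (intro conjI runs_intros) (simp_all add: env_def less_Suc_eq)
  qed (use assms in \<open>simp_all add: env_def\<close>)
qed

lemma runs_keys:
  assumes "env s0" "wreg s0 ''q'' = 0" "3 * m + 1 \<le> T"
  shows "runs W \<omega> keys_prog s0 T
    (\<lambda>s'. env s' \<and> warr s' = warr s0 \<and> rreg s' = rreg s0 \<and> (\<forall>a. a \<noteq> ''K'' \<longrightarrow> rarr s' a = rarr s0 a) \<and>
       (\<forall>b<m. rarr s' ''K'' b = rarr s0 ''in'' b - rreg s0 ''B'' * real (warr s0 ''c'' b)))"
proof -
  let ?I = "\<lambda>i s' :: state. env s' \<and> wreg s' ''q'' = i \<and> warr s' = warr s0 \<and> rreg s' = rreg s0 \<and>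
    (\<forall>a. a \<noteq> ''K'' \<longrightarrow> rarr s' a = rarr s0 a) \<and>
    (\<forall>b<i. rarr s' ''K'' b = rarr s0 ''in'' b - rreg s0 ''B'' * real (warr s0 ''c'' b))"
  show ?thesis
    unfolding keys_prog_def incr_def
  proof (rule runs_count[where I = ?I and T = 2 and N = m])
    fix i s1 assume I: "?I i s1" and i: "i < m"
    have "Suc i < W" "W \<noteq> Suc 0"
      using W_bounds i by auto
    then show "bval W \<omega> s1 (WLess (WReg ''q'') (WReg ''m'')) \<and>
      runs W \<omega> (Seq (RStore ''K'' (WReg ''q'') (RSub (RLoad ''in'' (WReg ''q''))
          (RMul (RReg ''B'') (OfWord (WLoad ''c'' (WReg ''q''))))))
        (WSet ''q'' (WAdd (WReg ''q'') (Const 1)))) s1 2 (?I (Suc i))"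
      using I i by (intro conjI runs_intros) (simp_all add: env_def less_Suc_eq)
  qed (use assms in \<open>simp_all add: env_def\<close>)
qed

text \<open>Expressed by counting on both sides, because accuracy requires a good bucket on each
  side of \<open>\<beta>\<close> and fewer than half of the buckets are bad.\<close>

definition median_of :: "(nat \<Rightarrow> real) \<Rightarrow> real \<Rightarrow> bool" where
  "median_of K \<beta> \<longleftrightarrow> s \<le> 2 * card {b. b < s \<and> K b \<le> \<beta>} \<and> s \<le> 2 * card {b. b < s \<and> \<beta> \<le> K b}"

text \<open>The state after \<open>i\<close> extractions: \<open>A\<close> is what remains in the
  tree, and \<open>\<beta>\<close>, the key extracted last, is characterised as the largest one so
  far.\<close>

definition extracted :: "(nat \<Rightarrow> real) \<Rightarrow> nat \<Rightarrow> real \<Rightarrow> nat set \<Rightarrow> bool" where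
  "extracted K i \<beta> A \<longleftrightarrow> A \<subseteq> {..<s} \<and> card A + i = s \<and> (\<forall>x\<in>{..<s} - A. \<forall>a\<in>A. K x \<le> K a) \<and>
    (0 < i \<longrightarrow> (\<exists>b\<in>{..<s} - A. \<beta> = K b \<and> (\<forall>x\<in>{..<s} - A. K x \<le> K b)))"

lemma extracted_step:
  assumes "extracted K i \<beta> A" "b \<in> A" "\<forall>a\<in>A. K b \<le> K a"
  shows "extracted K (Suc i) (K b) (A - {b})"
proof -
  have A: "A \<subseteq> {..<s}" "card A + i = s" "\<forall>x\<in>{..<s} - A. \<forall>a\<in>A. K x \<le> K a"
    using assms(1) unfolding extracted_def by simp_all
  then have fin: "finite A" using finite_subset by blast
  have eq: "{..<s} - (A - {b}) = insert b ({..<s} - A)"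
    using A(1) assms(2) by auto
  show ?thesis
    unfolding extracted_def eq
  proof (intro conjI impI)
    show "card (A - {b}) + Suc i = s"
      using A(2) card_Suc_Diff1[OF fin assms(2)] by simp
    show "\<exists>b'\<in>insert b ({..<s} - A). K b = K b' \<and> (\<forall>x\<in>insert b ({..<s} - A). K x \<le> K b')"
      using A(3) assms(2) by auto
  qed (use A assms in auto)
qed

text \<open>\<open>s\<close> is even. The \<open>s div 2 + 1\<close> extracted keys are at most
  \<open>\<beta>\<close>; the \<open>s div 2 - 1\<close> remaining ones and the key
  \<open>\<beta>\<close> itself, \<open>s div 2\<close> in all, are at least
  \<open>\<beta>\<close>.\<close>

lemma extracted_median:
  assumes "extracted K (s div 2 + 1) \<beta> A"
  shows "median_of K \<beta>"
proof -
  have A: "A \<subseteq> {..<s}" "card A + (s div 2 + 1) = s" "\<forall>x\<in>{..<s} - A. \<forall>a\<in>A. K x \<le> K a"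
    using assms unfolding extracted_def by simp_all
  obtain b where b: "b \<in> {..<s} - A" "\<beta> = K b" "\<forall>x\<in>{..<s} - A. K x \<le> K b"
    using assms unfolding extracted_def by auto
  have fin: "finite A" using A(1) finite_subset by blast
  have "card ({..<s} - A) = s div 2 + 1"
    using A fin by (simp add: card_Diff_subset)
  moreover have "card ({..<s} - A) \<le> card {x. x < s \<and> K x \<le> K b}"
    using b(3) by (intro card_mono) auto
  moreover have "card (insert b A) \<le> card {x. x < s \<and> K b \<le> K x}"
    using A b(1) by (intro card_mono) auto
  moreover have "card (insert b A) = Suc (card A)" using b(1) fin by simp
  moreover have "2 * (s div 2) = s" using s_pos(2) by simp
  ultimately show ?thesis
    using A(2) unfolding median_of_def b(2) by linarith
qed

lemma runs_bias_select:
  assumes "env s0" "wreg s0 ''r'' = 0" "wreg s0 ''e'' = s"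
    and t: "tournament K s {..<s} (warr s0 ''t'') {}" "rarr s0 ''K'' = K"
    and T: "(s div 2 + 1) * (4 * clog n + 8) + 1 \<le> T"
  shows "runs W \<omega> bias_select_prog s0 T
    (\<lambda>s'. env s' \<and> rarr s' = rarr s0 \<and> (\<forall>a. a \<noteq> ''t'' \<longrightarrow> warr s' a = warr s0 a) \<and> median_of K (rreg s' ''B''))"
proof -
  let ?I = "\<lambda>i s' :: state. env s' \<and> wreg s' ''r'' = i \<and> wreg s' ''e'' = s \<and> rarr s' = rarr s0 \<and>
    (\<forall>a. a \<noteq> ''t'' \<longrightarrow> warr s' a = warr s0 a) \<and>
    (\<exists>A. extracted K i (rreg s' ''B'') A \<and> tournament K s A (warr s' ''t'') {})"
  let ?post = "\<lambda>s1 A s'. tree_frame s1 s' \<and> wreg s' ''b'' = champion (warr s1 ''t'') \<and>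
       tournament (rarr s1 ''K'') s (A - {champion (warr s1 ''t'')}) (warr s' ''t'') {}"
  have W': "W \<noteq> Suc 0" "2 < W" "Suc (s div 2) < W" "2 * s < W"
    using W_bounds s_le_m s_pos by auto
  show ?thesis
    unfolding bias_select_prog_def incr_def
  proof (rule runs_count[where I = ?I and T = "4 * clog n + 7" and N = "s div 2 + 1"])
    fix i s1 assume I: "?I i s1" and i: "i < s div 2 + 1"
    then obtain A where A: "extracted K i (rreg s1 ''B'') A" "tournament K s A (warr s1 ''t'') {}"
      by blast
    have "i < s" using i s_pos by linarith
    then have "A \<subseteq> {..<s}" "card A \<noteq> 0"
      using A(1) unfolding extracted_def by simp_all
    moreover from this have "A \<noteq> {}" by auto
    ultimately have champ: "champion (warr s1 ''t'') \<in> A" "\<forall>a\<in>A. K (champion (warr s1 ''t'')) \<le> K a"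
      using tournament_champion[OF A(2)] by auto
    have ex: "runs W \<omega> extract_prog s1 (4 * clog n + 5) (?post s1 A)"
      using I A t(2) W' m_le_pow \<open>A \<subseteq> {..<s}\<close> \<open>card A \<noteq> 0\<close> by (intro runs_extract[where L = "clog n"]) auto
    have "runs W \<omega> (Seq (RSet ''B'' (RLoad ''K'' (WReg ''b''))) (WSet ''r'' (WAdd (WReg ''r'') (Const 1)))) s' 2 (?I (Suc i))"
      if post: "?post s1 A s'" for s'
    proof -
      have K: "rarr s1 ''K'' = K" using I t(2) by simp
      from post obtain b where b: "tree_frame s1 s'" "b \<in> A" "wreg s' ''b'' = b" "\<forall>a\<in>A. K b \<le> K a"
        "tournament K s (A - {b}) (warr s' ''t'') {}"
        using champ unfolding K by blast
      have ext: "extracted K (Suc i) (K b) (A - {b})"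
        using extracted_step[OF A(1) b(2,4)] .
      have "Suc i < W" using \<open>i < s\<close> W' by linarith
      have ex: "\<exists>A. extracted K (Suc i) (K b) A \<and> tournament K s A (warr s' ''t'') {}"
        using ext b(5) by blast
      have "rarr s' = rarr s0" using I b(1) by (simp add: tree_frame_def)
      with K I b(1) have "rarr s' ''K'' = K" by (simp add: tree_frame_def)
      then show ?thesis
        using I b(1,3) W' ex \<open>Suc i < W\<close>
        by (intro runs_intros) (simp_all add: env_def tree_frame_def)
    qed
    then have "runs W \<omega> (Seq extract_prog (Seq (RSet ''B'' (RLoad ''K'' (WReg ''b''))) (WSet ''r'' (WAdd (WReg ''r'') (Const 1))))) s1
        (4 * clog n + 7) (?I (Suc i))"
      by (intro runs_Seq[where T' = 2, OF runs_mono[OF ex order_refl]]) simp_all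
    moreover have "bval W \<omega> s1 (WLess (WReg ''r'') (WAdd (WDiv (WReg ''s'') (Const 2)) (Const 1)))"
      using I i W' by (simp add: env_def)
    ultimately show "bval W \<omega> s1 (WLess (WReg ''r'') (WAdd (WDiv (WReg ''s'') (Const 2)) (Const 1))) \<and>
      runs W \<omega> (Seq extract_prog (Seq (RSet ''B'' (RLoad ''K'' (WReg ''b''))) (WSet ''r'' (WAdd (WReg ''r'') (Const 1))))) s1
        (4 * clog n + 7) (?I (Suc i))" by blast
  next
    fix s1 assume I: "?I (s div 2 + 1) s1"
    then have "median_of K (rreg s1 ''B'')"
      using extracted_median by blast
    then show "\<not> bval W \<omega> s1 (WLess (WReg ''r'') (WAdd (WDiv (WReg ''s'') (Const 2)) (Const 1))) \<and>
      env s1 \<and> rarr s1 = rarr s0 \<and> (\<forall>a. a \<noteq> ''t'' \<longrightarrow> warr s1 a = warr s0 a) \<and> median_of K (rreg s1 ''B'')"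
      using I W' by (simp add: env_def)
  next
    have "extracted K 0 (rreg s0 ''B'') {..<s}"
      by (simp add: extracted_def)
    then show "?I 0 s0"
      using assms by blast
  next
    have "4 * clog n + 8 = Suc (4 * clog n + 7)" by simp
    then show "(s div 2 + 1) * Suc (4 * clog n + 7) < T"
      using T by (metis Suc_eq_plus1 Suc_le_eq)
  qed
qed


section \<open>Visiting the items: a median of the row values for every coordinate\<close>

definition items :: "nat \<Rightarrow> nat set" where
  "items i = {q. q < N \<and> q mod n = i}"

lemma finite_items [simp]: "finite (items i)"
  by (simp add: items_def)

text \<open>Turns counts of items into counts of rows: coordinate \<open>i\<close> has exactly one
  item \<open>j * n + i\<close> in each row \<open>j\<close>.\<close>

lemma card_items_filter:
  assumes "i < n"
  shows "card {q \<in> items i. P q} = card {j. j < D \<and> P (j * n + i)}"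
proof -
  have "bij_betw (\<lambda>j. j * n + i) {j. j < D \<and> P (j * n + i)} {q \<in> items i. P q}"
  proof (rule bij_betwI[where g = "\<lambda>q. q div n"])
    show "(\<lambda>j. j * n + i) \<in> {j. j < D \<and> P (j * n + i)} \<rightarrow> {q \<in> items i. P q}"
    proof
      fix j assume j: "j \<in> {j. j < D \<and> P (j * n + i)}"
      have "j * n + i < (j + 1) * n" using assms by simp
      moreover have "(j + 1) * n \<le> D * n" using j by (intro mult_le_mono1) simp
      ultimately show "j * n + i \<in> {q \<in> items i. P q}"
        using j assms by (auto simp: items_def N_def)
    qed
    show "(\<lambda>q. q div n) \<in> {q \<in> items i. P q} \<rightarrow> {j. j < D \<and> P (j * n + i)}"
    proof
      fix q assume q: "q \<in> {q \<in> items i. P q}"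
      then have "q div n * n + i = q" by (auto simp: items_def)
      with q show "q div n \<in> {j. j < D \<and> P (j * n + i)}"
        by (simp add: items_def N_def less_mult_imp_div_less)
    qed
  qed (use assms in \<open>auto simp: items_def\<close>)
  then show ?thesis by (simp add: bij_betw_same_card)
qed

lemma card_items: "i < n \<Longrightarrow> card (items i) = D"
  using card_items_filter[of i "\<lambda>_. True"] by simp

text \<open>The counting form of a median of the \<open>D = 2 * clog n + 1\<close> row
  values.\<close>

definition estimate :: "(nat \<Rightarrow> real) \<Rightarrow> nat \<Rightarrow> real \<Rightarrow> bool" where
  "estimate K i z \<longleftrightarrow> clog n < card {q \<in> items i. K (bkt q) \<le> z} \<and> clog n < card {q \<in> items i. z \<le> K (bkt q)}"

text \<open>
  Items are visited in the order of their keys, so the visit number \<open>clog n + 1\<close> to a coordinate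
  meets a median of its estimates.
\<close>

definition visited :: "(nat \<Rightarrow> real) \<Rightarrow> real \<Rightarrow> nat set \<Rightarrow> (nat \<Rightarrow> nat) \<Rightarrow> (nat \<Rightarrow> real) \<Rightarrow> bool" where
  "visited K \<beta> S d z \<longleftrightarrow> S \<subseteq> {..<N} \<and>
    (\<forall>i<n. d i = card {q \<in> S. q mod n = i} \<and> (clog n < d i \<longrightarrow> estimate K i (z i - \<beta>)))"

lemma visited_step:
  assumes S: "visited K \<beta> S d z" and q: "q < N" "q \<notin> S" "q mod n = i"
    and le: "\<And>p. p \<in> S \<Longrightarrow> K (bkt p) \<le> K (bkt q)"
    and ge: "\<And>p. p < N \<Longrightarrow> p \<notin> S \<Longrightarrow> K (bkt q) \<le> K (bkt p)"
  shows "visited K \<beta> (insert q S) (d(i := Suc (d i)))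
    (if Suc (d i) < clog n + 2 then z(i := K (bkt q) + \<beta>) else z)"
proof -
  have i: "i < n" using q(3) n by auto
  have sub: "S \<subseteq> {..<N}" using S unfolding visited_def by simp
  then have fin: "finite S" using finite_subset by blast
  let ?S = "\<lambda>i. {p \<in> S. p mod n = i}"
  have d: "d j = card (?S j)" "clog n < d j \<longrightarrow> estimate K j (z j - \<beta>)" if "j < n" for j
    using S that unfolding visited_def by simp_all
  have ins: "{p \<in> insert q S. p mod n = j} = (if j = i then insert q (?S j) else ?S j)" for j
    using q(3) by auto
  \<comment> \<open>This is the last visit that overwrites \<open>z i\<close>. The
    \<open>clog n\<close> earlier items of \<open>i\<close> and \<open>q\<close> itself have keys at
    most \<open>K (bkt q)\<close>; the \<open>D - clog n = clog n + 1\<close> items of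
    \<open>i\<close> outside \<open>S\<close>, again including \<open>q\<close>, have keys at least
    that.\<close>
  have est: "estimate K i (K (bkt q))" if di: "d i = clog n"
  proof -
    have ci: "card (insert q (?S i)) = clog n + 1"
      using d(1)[OF i] fin q(2) di by simp
    have "insert q (?S i) \<subseteq> {p \<in> items i. K (bkt p) \<le> K (bkt q)}"
      using sub q le by (auto simp: items_def)
    then have "clog n + 1 \<le> card {p \<in> items i. K (bkt p) \<le> K (bkt q)}"
      unfolding ci[symmetric] by (intro card_mono) auto
    moreover have "items i - ?S i \<subseteq> {p \<in> items i. K (bkt q) \<le> K (bkt p)}"
      using ge by (auto simp: items_def)
    then have "card (items i - ?S i) \<le> card {p \<in> items i. K (bkt q) \<le> K (bkt p)}"
      by (intro card_mono) auto
    moreover have "card (items i - ?S i) = D - clog n"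
      using sub fin d(1)[OF i] di card_items[OF i] by (subst card_Diff_subset) (auto simp: items_def)
    ultimately show ?thesis
      unfolding estimate_def by (simp add: D_def)
  qed
  show ?thesis
    unfolding visited_def
  proof (intro conjI allI impI)
    show "insert q S \<subseteq> {..<N}" using sub q(1) by simp
    fix j assume j: "j < n"
    show "(d(i := Suc (d i))) j = card {p \<in> insert q S. p mod n = j}"
      unfolding ins using d(1)[OF j] fin q(2) by auto
    assume c: "clog n < (d(i := Suc (d i))) j"
    show "estimate K j ((if Suc (d i) < clog n + 2 then z(i := K (bkt q) + \<beta>) else z) j - \<beta>)"
    proof (cases "j = i \<and> d i = clog n")
      case True
      then show ?thesis using est by simp
    next
      \<comment> \<open>What remains are other coordinates and visits after the decisive one;
        neither changes \<open>z j\<close>.\<close>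
      case False
      then have "clog n < d j" using c by (auto split: if_splits)
      then show ?thesis using d(2)[OF j] by auto
    qed
  qed
qed

lemma runs_visit_body:
  assumes "wreg s1 ''q'' = Suc q" "wreg s1 ''n'' = n" "wreg s1 ''l'' = l" "l + 2 < W" "Suc (warr s1 ''d'' (q mod n)) < W"
    and Q: "\<And>s' :: state. wreg s' ''q'' = warr s1 ''x'' q \<Longrightarrow>
      (\<forall>x. x \<noteq> ''q'' \<longrightarrow> x \<noteq> ''i'' \<longrightarrow> wreg s' x = wreg s1 x) \<Longrightarrow>
      warr s' = (warr s1)(''d'' := (warr s1 ''d'')(q mod n := Suc (warr s1 ''d'' (q mod n)))) \<Longrightarrow> rreg s' = rreg s1 \<Longrightarrow>
      rarr s' = (rarr s1)(''out'' := if Suc (warr s1 ''d'' (q mod n)) < l + 2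
        then (rarr s1 ''out'')(q mod n := rarr s1 ''K'' (wreg s1 ''b'') + rreg s1 ''B'') else rarr s1 ''out'') \<Longrightarrow> Q s'"
  shows "runs W \<omega> visit_body s1 6 Q"
proof -
  have [simp]: "W \<noteq> Suc 0" "2 < W" "Suc (Suc l) < W" "Suc l < W" using assms(4) by auto
  note [simp] = assms(1-3,5)
  show ?thesis
    unfolding visit_body_def
    apply (rule runs_Seq_assign, simp, simp)
    apply (rule runs_Seq_assign, simp, simp)
    apply (rule runs_Seq_assign, simp, simp)
    apply (rule runs_Seq[where T = 2 and T' = 1])
     apply (rule runs_Cond[where T = 1])
       apply (rule runs_RStore, simp, simp)
       apply (rule runs_WSet, simp, simp)
       apply (rule Q; simp)
      apply (rule runs_Skip, simp, simp)
      apply (rule runs_WSet, simp, simp)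
      apply (rule Q; simp)
     apply simp
    apply simp
    done
qed

lemma runs_visit:
  assumes s0: "env s0" "rarr s0 ''K'' = K" "rreg s0 ''B'' = \<beta>" "wreg s0 ''b'' = b"
    and chain: "chain (warr s0 ''x'') (wreg s0 ''q'') qs" "distinct qs" "set qs \<inter> S = {}" "set qs = bucket_items n s \<omega> N b"
    and S: "visited K \<beta> S (warr s0 ''d'') (rarr s0 ''out'')"
    and le: "\<And>p. p \<in> S \<Longrightarrow> K (bkt p) \<le> K b"
    and ge: "\<And>p. p < N \<Longrightarrow> p \<notin> S \<Longrightarrow> K b \<le> K (bkt p)"
    and T: "7 * length qs + 1 \<le> T"
  shows "runs W \<omega> visit_prog s0 T
    (\<lambda>s'. env s' \<and> wreg s' ''r'' = wreg s0 ''r'' \<and> wreg s' ''e'' = wreg s0 ''e'' \<and> rreg s' = rreg s0 \<and>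
       (\<forall>a. a \<noteq> ''out'' \<longrightarrow> rarr s' a = rarr s0 a) \<and> (\<forall>a. a \<noteq> ''d'' \<longrightarrow> warr s' a = warr s0 a) \<and>
       visited K \<beta> (S \<union> bucket_items n s \<omega> N b) (warr s' ''d'') (rarr s' ''out''))"
proof -
  let ?fr = "\<lambda>s' :: state. env s' \<and> wreg s' ''r'' = wreg s0 ''r'' \<and> wreg s' ''e'' = wreg s0 ''e'' \<and> wreg s' ''b'' = b \<and>
     rreg s' = rreg s0 \<and>
     (\<forall>a. a \<noteq> ''out'' \<longrightarrow> rarr s' a = rarr s0 a) \<and> (\<forall>a. a \<noteq> ''d'' \<longrightarrow> warr s' a = warr s0 a)"
  \<comment> \<open>\<open>ps\<close> is the part of the list still to be visited and
    \<open>R\<close> the set of all items visited so far; \<open>length ps\<close> iterations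
    remain.\<close>
  define J where "J = (\<lambda>ps h d z R. chain (warr s0 ''x'') h ps \<and> distinct ps \<and> set ps \<inter> R = {} \<and> S \<subseteq> R \<and>
     set ps \<subseteq> bucket_items n s \<omega> N b \<and> R \<union> set ps = S \<union> bucket_items n s \<omega> N b \<and> visited K \<beta> R d z)"
  let ?I = "\<lambda>j s'. ?fr s' \<and> (\<exists>ps R. length ps = j \<and> J ps (wreg s' ''q'') (warr s' ''d'') (rarr s' ''out'') R)"
  have W': "clog n + 2 < W"
    using W_bounds(3) D_le_m m_less W_bounds(5) by (simp add: D_def)
  show ?thesis
    unfolding visit_prog_def
  proof (rule runs_Loop_const[where I = ?I and T = 6 and j = "length qs"])
    have "J qs (wreg s0 ''q'') (warr s0 ''d'') (rarr s0 ''out'') S"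
      using chain S unfolding J_def by auto
    then show "?I (length qs) s0"
      using s0 by blast
  next
    fix j s1 assume I: "?I j s1" and b: "bval W \<omega> s1 (WLess (Const 0) (WReg ''q''))"
    then obtain ps R where ps: "length ps = j" "J ps (wreg s1 ''q'') (warr s1 ''d'') (rarr s1 ''out'') R" by blast
    note ps = ps(1) ps(2)[unfolded J_def]
    obtain q ps' where p: "ps = q # ps'"
      using b ps(2) by (cases ps) auto
    have fr: "?fr s1" using I by blast
    have c: "wreg s1 ''q'' = Suc q" "chain (warr s0 ''x'') (warr s0 ''x'' q) ps'"
      using ps(2) p by simp_all
    have q: "q < N" "bkt q = b" "q \<notin> R"
      using ps(2) p by (auto simp: bucket_items_def)
    define i where "i = q mod n"
    have "i < n" using n by (simp add: i_def)
    let ?d = "warr s1 ''d''" and ?z = "rarr s1 ''out''"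
    have step: "visited K \<beta> (insert q R) (?d(i := Suc (?d i)))
      (if Suc (?d i) < clog n + 2 then ?z(i := K (bkt q) + \<beta>) else ?z)"
    proof (rule visited_step)
      show "visited K \<beta> R ?d ?z" using ps(2) by blast
      show "K (bkt x) \<le> K (bkt q)" if "x \<in> R" for x
      proof (cases "x \<in> S")
        \<comment> \<open>An item outside \<open>S\<close> was visited within this loop, hence lies
          in bucket \<open>b\<close> and has the same key as \<open>q\<close>.\<close>
        case False
        then have "bkt x = b" using ps(2) that by (auto simp: bucket_items_def)
        then show ?thesis using q by simp
      qed (use le q in simp)
      show "K (bkt q) \<le> K (bkt x)" if "x < N" "x \<notin> R" for x
        using ge[of x] that ps(2) q(2) by auto
    qed (use q i_def in simp_all)
    let ?z' = "if Suc (?d i) < clog n + 2 then ?z(i := K (bkt q) + \<beta>) else ?z"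
    have J: "J ps' (warr s0 ''x'' q) (?d(i := Suc (?d i))) ?z' (insert q R)"
      using ps p c step unfolding J_def by auto
    have dle: "Suc (?d i) < W"
    proof -
      have "?d i = card {q \<in> R. q mod n = i}" "R \<subseteq> {..<N}"
        using ps(2) \<open>i < n\<close> unfolding visited_def by simp_all
      moreover from this have "card {q \<in> R. q mod n = i} \<le> card (items i)"
        by (intro card_mono) (auto simp: items_def)
      ultimately have "?d i \<le> D" using card_items[OF \<open>i < n\<close>] by simp
      then show ?thesis using D_le_m m_less W_bounds(3) by linarith
    qed
    have KB: "rarr s1 ''K'' = K" "rreg s1 ''B'' = \<beta>" "warr s1 ''x'' = warr s0 ''x''"
      using fr s0 by simp_all
    have len: "length ps' = j - 1" "0 < j" using ps(1) p by auto
    have "runs W \<omega> visit_body s1 6 (?I (j - 1))"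
    proof (rule runs_visit_body)
      fix s' :: state
      assume *: "wreg s' ''q'' = warr s1 ''x'' q" "\<forall>x. x \<noteq> ''q'' \<longrightarrow> x \<noteq> ''i'' \<longrightarrow> wreg s' x = wreg s1 x"
        "warr s' = (warr s1)(''d'' := (warr s1 ''d'')(q mod n := Suc (warr s1 ''d'' (q mod n))))" "rreg s' = rreg s1"
        "rarr s' = (rarr s1)(''out'' := if Suc (warr s1 ''d'' (q mod n)) < clog n + 2
          then (rarr s1 ''out'')(q mod n := rarr s1 ''K'' (wreg s1 ''b'') + rreg s1 ''B'') else rarr s1 ''out'')"
      have fr': "?fr s'"
        using fr *(2-5) by (simp add: env_def)
      have "warr s' ''d'' = ?d(i := Suc (?d i))" "wreg s' ''q'' = warr s0 ''x'' q"
        using * KB by (simp_all add: i_def)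
      moreover have "rarr s' ''out'' = ?z'"
        using *(5) KB(1,2) fr q(2) by (simp add: i_def)
      ultimately have "J ps' (wreg s' ''q'') (warr s' ''d'') (rarr s' ''out'') (insert q R)"
        using J by (simp only:)
      then show "?I (j - 1) s'"
        using fr' len(1) by blast
    qed (use fr c(1) W' dle in \<open>simp_all add: env_def i_def\<close>)
    then show "0 < j \<and> runs W \<omega> visit_body s1 6 (?I (j - 1))"
      using len(2) by blast
  next
    fix j s1 assume I: "?I j s1" and b: "\<not> bval W \<omega> s1 (WLess (Const 0) (WReg ''q''))"
    then obtain ps R where ps: "J ps (wreg s1 ''q'') (warr s1 ''d'') (rarr s1 ''out'') R" by blast
    have "ps = []" using b ps unfolding J_def by (cases ps) auto
    with ps have "R = S \<union> bucket_items n s \<omega> N b"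
      unfolding J_def by simp
    moreover have "visited K \<beta> R (warr s1 ''d'') (rarr s1 ''out'')"
      using ps unfolding J_def by blast
    ultimately have "visited K \<beta> (S \<union> bucket_items n s \<omega> N b) (warr s1 ''d'') (rarr s1 ''out'')"
      by (simp only:)
    then show "env s1 \<and> wreg s1 ''r'' = wreg s0 ''r'' \<and> wreg s1 ''e'' = wreg s0 ''e'' \<and> rreg s1 = rreg s0 \<and>
       (\<forall>a. a \<noteq> ''out'' \<longrightarrow> rarr s1 a = rarr s0 a) \<and> (\<forall>a. a \<noteq> ''d'' \<longrightarrow> warr s1 a = warr s0 a) \<and>
       visited K \<beta> (S \<union> bucket_items n s \<omega> N b) (warr s1 ''d'') (rarr s1 ''out'')"
      using I by blast
  qed (use T in simp)
qed

end

section \<open>Sweeping the buckets in the order of their keys, and the whole recovery\<close>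

context sketch begin

definition swept :: "(nat \<Rightarrow> real) \<Rightarrow> real \<Rightarrow> nat \<Rightarrow> (nat \<Rightarrow> nat) \<Rightarrow> (nat \<Rightarrow> nat) \<Rightarrow> (nat \<Rightarrow> real) \<Rightarrow> nat set \<Rightarrow> bool" where
  "swept K \<beta> r t d z A \<longleftrightarrow> A \<subseteq> {..<m} \<and> r + card A = m \<and> tournament K m A t {} \<and>
    (\<forall>x\<in>{..<m} - A. \<forall>a\<in>A. K x \<le> K a) \<and> visited K \<beta> {q. q < N \<and> bkt q \<notin> A} d z"

text \<open>Amortised analysis: a single list may be long, but every item lies in exactly one
  bucket. The budget therefore reserves \<open>4 * clog n + 10\<close> steps for each bucket still
  in the tree and 7 steps for each item in such a bucket.\<close>

lemma runs_sweep:
  assumes s0: "env s0" "wreg s0 ''r'' = 0" "wreg s0 ''e'' = m" "rarr s0 ''K'' = K" "rreg s0 ''B'' = \<beta>"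
    and t: "tournament K m {..<m} (warr s0 ''t'') {}"
    and d: "warr s0 ''d'' = (\<lambda>_. 0)"
    and chain: "\<forall>b. \<exists>qs. set qs = bucket_items n s \<omega> N b \<and> distinct qs \<and> chain (warr s0 ''x'') (warr s0 ''h'' b) qs"
    and T: "m * (4 * clog n + 10) + 7 * N + 1 \<le> T"
  shows "runs W \<omega> sweep_prog s0 T (\<lambda>s'. \<forall>i<n. estimate K i (rarr s' ''out'' i - \<beta>))"
proof -
  let ?fr = "\<lambda>s' :: state. env s' \<and> wreg s' ''e'' = m \<and> rarr s' ''K'' = K \<and> rreg s' ''B'' = \<beta> \<and>
     warr s' ''x'' = warr s0 ''x'' \<and> warr s' ''h'' = warr s0 ''h''"
  let ?v = "\<lambda>A. card A * (4 * clog n + 10) + 7 * card {q. q < N \<and> bkt q \<in> A}"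
  let ?I = "\<lambda>v s'. ?fr s' \<and> (\<exists>A. v = ?v A \<and> swept K \<beta> (wreg s' ''r'') (warr s' ''t'') (warr s' ''d'') (rarr s' ''out'') A)"
  have W': "W \<noteq> Suc 0" "2 < W" "2 * m < W" using W_bounds by auto
  show ?thesis
    unfolding sweep_prog_def incr_def
  proof (rule runs_Loop[where I = ?I and v = "?v {..<m}"])
    have none: "{q. q < N \<and> bkt q \<notin> {..<m}} = {}"
      using bkt_less by auto
    have "swept K \<beta> 0 (warr s0 ''t'') (warr s0 ''d'') (rarr s0 ''out'') {..<m}"
      unfolding swept_def none using t d by (simp add: visited_def)
    then show "?I (?v {..<m}) s0"
      using s0 by (intro conjI exI[of _ "{..<m}"]) simp_all
  next
    fix v s1 assume I: "?I v s1" and b: "bval W \<omega> s1 (WLess (WReg ''r'') (WReg ''m''))"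
    then obtain A where A: "v = ?v A" "swept K \<beta> (wreg s1 ''r'') (warr s1 ''t'') (warr s1 ''d'') (rarr s1 ''out'') A"
      by blast
    have fr: "?fr s1" using I by blast
    have r: "wreg s1 ''r'' < m"
      using b fr by (simp add: env_def)
    have A': "A \<subseteq> {..<m}" "wreg s1 ''r'' + card A = m" "tournament K m A (warr s1 ''t'') {}"
      "\<forall>x\<in>{..<m} - A. \<forall>a\<in>A. K x \<le> K a" "visited K \<beta> {q. q < N \<and> bkt q \<notin> A} (warr s1 ''d'') (rarr s1 ''out'')"
      using A(2) unfolding swept_def by simp_all
    have "A \<noteq> {}" using r A'(2) by auto
    have finA: "finite A" using A'(1) finite_subset by blast
    define b where "b = champion (warr s1 ''t'')"
    have b: "b \<in> A" "\<And>a. a \<in> A \<Longrightarrow> K b \<le> K a"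
      using tournament_champion[OF A'(3,1) \<open>A \<noteq> {}\<close>] by (simp_all add: b_def)
    obtain qs where qs: "set qs = bucket_items n s \<omega> N b" "distinct qs" "chain (warr s0 ''x'') (warr s0 ''h'' b) qs"
      using chain by blast
    let ?S = "{q. q < N \<and> bkt q \<notin> A}"
    have S': "?S \<union> bucket_items n s \<omega> N b = {q. q < N \<and> bkt q \<notin> A - {b}}"
      using b(1) by (auto simp: bucket_items_def)
    let ?post = "\<lambda>s'. tree_frame s1 s' \<and> wreg s' ''b'' = b \<and> tournament K m (A - {b}) (warr s' ''t'') {}"
    have ex: "runs W \<omega> extract_prog s1 (4 * clog n + 5) ?post"
      using runs_extract[of s1 m W "clog n" "4 * clog n + 5" A, folded b_def] fr A' W' m_le_pow \<open>A \<noteq> {}\<close> by simp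
    have body: "runs W \<omega> (Seq (WSet ''q'' (WLoad ''h'' (WReg ''b'')))
        (Seq visit_prog (WSet ''r'' (WAdd (WReg ''r'') (Const 1))))) s' (7 * length qs + 3) (?I (?v (A - {b})))"
      if post: "?post s'" for s'
    proof (rule runs_Seq_assign)
      define s2 where "s2 = s'\<lparr>wreg := (wreg s')(''q'' := wval W \<omega> s' (WLoad ''h'' (WReg ''b'')))\<rparr>"
      have s2: "env s2" "wreg s2 ''e'' = m" "wreg s2 ''r'' = wreg s1 ''r''" "rarr s2 = rarr s1" "rreg s2 = rreg s1"
        "wreg s2 ''b'' = b" "wreg s2 ''q'' = warr s0 ''h'' b" "warr s2 ''x'' = warr s0 ''x''" "warr s2 ''h'' = warr s0 ''h''"
        "warr s2 ''d'' = warr s1 ''d''" "warr s2 ''t'' = warr s' ''t''"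
        using post fr by (simp_all add: s2_def env_def tree_frame_def)
      have visit: "runs W \<omega> visit_prog s2 (7 * length qs + 1)
        (\<lambda>s'. env s' \<and> wreg s' ''r'' = wreg s2 ''r'' \<and> wreg s' ''e'' = wreg s2 ''e'' \<and> rreg s' = rreg s2 \<and>
         (\<forall>a. a \<noteq> ''out'' \<longrightarrow> rarr s' a = rarr s2 a) \<and> (\<forall>a. a \<noteq> ''d'' \<longrightarrow> warr s' a = warr s2 a) \<and>
         visited K \<beta> (?S \<union> bucket_items n s \<omega> N b) (warr s' ''d'') (rarr s' ''out''))"
      proof (rule runs_visit)
        show "set qs \<inter> ?S = {}" using qs(1) b(1) by (auto simp: bucket_items_def)
        show "K (bkt p) \<le> K b" if "p \<in> ?S" for p
          using that A'(4) b(1) bkt_less[of p] by auto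
        show "K b \<le> K (bkt p)" if "p < N" "p \<notin> ?S" for p
          using that b(2) by auto
      qed (use s2 fr qs A'(5) in simp_all)
      have incr: "runs W \<omega> (WSet ''r'' (WAdd (WReg ''r'') (Const 1))) s3 1 (?I (?v (A - {b})))"
        if v: "env s3 \<and> wreg s3 ''r'' = wreg s2 ''r'' \<and> wreg s3 ''e'' = wreg s2 ''e'' \<and> rreg s3 = rreg s2 \<and>
         (\<forall>a. a \<noteq> ''out'' \<longrightarrow> rarr s3 a = rarr s2 a) \<and> (\<forall>a. a \<noteq> ''d'' \<longrightarrow> warr s3 a = warr s2 a) \<and>
         visited K \<beta> (?S \<union> bucket_items n s \<omega> N b) (warr s3 ''d'') (rarr s3 ''out'')" for s3
      proof (rule runs_WSet)
        define s4 where "s4 = s3\<lparr>wreg := (wreg s3)(''r'' := wval W \<omega> s3 (WAdd (WReg ''r'') (Const 1)))\<rparr>"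
        have "Suc (wreg s1 ''r'') < W" using r W' by linarith
        then have s4: "?fr s4" "wreg s4 ''r'' = Suc (wreg s1 ''r'')" "warr s4 ''t'' = warr s' ''t''"
          "warr s4 ''d'' = warr s3 ''d''" "rarr s4 ''out'' = rarr s3 ''out''"
          using v s2 fr W' by (simp_all add: s4_def env_def)
        have eq: "{..<m} - (A - {b}) = insert b ({..<m} - A)"
          using A'(1) b(1) by auto
        have "swept K \<beta> (Suc (wreg s1 ''r'')) (warr s' ''t'') (warr s3 ''d'') (rarr s3 ''out'') (A - {b})"
          unfolding swept_def eq
        proof (intro conjI)
          show "Suc (wreg s1 ''r'') + card (A - {b}) = m"
            using A'(2) card_Suc_Diff1[OF finA b(1)] by simp
          show "\<forall>x\<in>insert b ({..<m} - A). \<forall>a\<in>A - {b}. K x \<le> K a"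
            using A'(4) b(2) by auto
          show "visited K \<beta> {q. q < N \<and> bkt q \<notin> A - {b}} (warr s3 ''d'') (rarr s3 ''out'')"
            using v unfolding S' by blast
        qed (use A'(1) post in auto)
        then show "?I (?v (A - {b})) s4"
          using s4 by metis
      qed simp
      show "runs W \<omega> (Seq visit_prog (WSet ''r'' (WAdd (WReg ''r'') (Const 1))))
          (s'\<lparr>wreg := (wreg s')(''q'' := wval W \<omega> s' (WLoad ''h'' (WReg ''b'')))\<rparr>)
          (7 * length qs + 3 - 1) (?I (?v (A - {b})))"
        unfolding s2_def[symmetric]
        by (rule runs_Seq[OF runs_mono[OF visit order_refl incr]]) simp_all
    qed simp
    have "runs W \<omega> (Seq extract_prog (Seq (WSet ''q'' (WLoad ''h'' (WReg ''b''))) (Seq visit_prog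
      (WSet ''r'' (WAdd (WReg ''r'') (Const 1)))))) s1 (4 * clog n + 5 + (7 * length qs + 3)) (?I (?v (A - {b})))"
      by (rule runs_Seq[OF runs_mono[OF ex order_refl body] order_refl])
    moreover have "?v (A - {b}) + (4 * clog n + 5 + (7 * length qs + 3)) < v"
    proof -
      have "{q. q < N \<and> bkt q \<in> A} = {q. q < N \<and> bkt q \<in> A - {b}} \<union> set qs"
        using b(1) qs(1) by (auto simp: bucket_items_def)
      moreover have "{q. q < N \<and> bkt q \<in> A - {b}} \<inter> set qs = {}"
        using qs(1) by (auto simp: bucket_items_def)
      ultimately have "card {q. q < N \<and> bkt q \<in> A} = card {q. q < N \<and> bkt q \<in> A - {b}} + length qs"
        using qs(2) by (simp add: card_Un_disjoint distinct_card)
      moreover have "card A = Suc (card (A - {b}))"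
        using card_Suc_Diff1[OF finA b(1)] by simp
      ultimately show ?thesis
        using A(1) by simp
    qed
    ultimately show "\<exists>T u. runs W \<omega> (Seq extract_prog (Seq (WSet ''q'' (WLoad ''h'' (WReg ''b''))) (Seq visit_prog
      (WSet ''r'' (WAdd (WReg ''r'') (Const 1)))))) s1 T (?I u) \<and> u + T < v"
      by blast
  next
    fix v s1 assume I: "?I v s1" and b: "\<not> bval W \<omega> s1 (WLess (WReg ''r'') (WReg ''m''))"
    then obtain A where A: "swept K \<beta> (wreg s1 ''r'') (warr s1 ''t'') (warr s1 ''d'') (rarr s1 ''out'') A"
      by blast
    have "wreg s1 ''r'' \<ge> m" using I b by (simp add: env_def)
    moreover have "wreg s1 ''r'' + card A = m" "A \<subseteq> {..<m}"
      using A unfolding swept_def by simp_all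
    ultimately have "card A = 0" "finite A"
      by (linarith, blast intro: finite_subset)
    then have "A = {}" by simp
    then have vis: "visited K \<beta> {..<N} (warr s1 ''d'') (rarr s1 ''out'')"
      using A unfolding swept_def by (simp add: lessThan_def)
    show "\<forall>i<n. estimate K i (rarr s1 ''out'' i - \<beta>)"
    proof (intro allI impI)
      fix i assume i: "i < n"
      \<comment> \<open>After the sweep each coordinate has been met in all \<open>D\<close> rows,
        more than \<open>clog n\<close> times, so the second part of \<open>visited\<close>
        applies.\<close>
      have "items i = {q \<in> {..<N}. q mod n = i}" by (auto simp: items_def)
      then have "warr s1 ''d'' i = D"
        using vis i card_items[OF i] unfolding visited_def by simp
      then show "estimate K i (rarr s1 ''out'' i - \<beta>)"
        using vis i unfolding visited_def by (simp add: D_def)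
    qed
  next
    have "{q. q < N \<and> bkt q \<in> {..<m}} = {..<N}" using bkt_less by auto
    then show "?v {..<m} < T" using T by simp
  qed
qed

definition load :: "nat \<Rightarrow> nat" where
  "load b = card (bucket_items n s \<omega> N b)"

lemma median_of_cong: "(\<And>b. b < s \<Longrightarrow> K b = K' b) \<Longrightarrow> median_of K \<beta> = median_of K' \<beta>"
  unfolding median_of_def by (metis (mono_tags, lifting) Collect_cong)

lemma estimate_cong:
  assumes "\<And>b. b < m \<Longrightarrow> K b = K' b"
  shows "estimate K i z = estimate K' i z"
proof -
  have "K (bkt q) = K' (bkt q)" if "q \<in> items i" for q
    using assms bkt_less that by (simp add: items_def)
  then show ?thesis
    unfolding estimate_def by (metis (mono_tags, lifting) Collect_cong)
qed

lemma clog_pos: "1 \<le> clog n"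
  using clog[of n] n by (cases "clog n") auto

text \<open>Proved from the last stage backwards: each stage is verified together with everything
  that follows it, along the right nesting of the sequence.\<close>

lemma runs_recovery_main:
  assumes s0: "env s0" "wreg s0 ''q'' = 0" "warr s0 = (\<lambda>_ _. 0)" "rarr s0 ''in'' = X"
    and T: "110 * (n * clog n) \<le> T"
  shows "runs W \<omega> recovery_main s0 T (\<lambda>s'. \<exists>\<beta>. median_of (\<lambda>b. X b / real (load b)) \<beta> \<and>
    (\<forall>i<n. estimate (\<lambda>b. X b - \<beta> * real (load b)) i (rarr s' ''out'' i - \<beta>)))" (is "runs _ _ _ _ _ ?post")
proof -
  let ?L = "clog n"
  let ?F = "\<lambda>s' :: state. env s' \<and> rarr s' ''in'' = X \<and> (\<forall>b. warr s' ''c'' b = load b) \<and> warr s' ''d'' = (\<lambda>_. 0) \<and>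
    (\<forall>b. \<exists>qs. set qs = bucket_items n s \<omega> N b \<and> distinct qs \<and> chain (warr s' ''x'') (warr s' ''h'' b) qs)"
  have W': "1 \<le> s" "1 \<le> m" "2 * s < W" "2 * m < W" "0 < W"
    using W_bounds s_le_m s_pos by auto
  have sweep: "runs W \<omega> (Seq (WSet ''e'' (WReg ''m'')) (Seq build_prog (Seq (WSet ''r'' (Const 0)) sweep_prog))) s1
      (7 * m + 4 + m * (4 * ?L + 10) + 7 * N + 3) ?post"
    if F: "?F s1" and \<beta>: "median_of (\<lambda>b. X b / real (load b)) \<beta>" "rreg s1 ''B'' = \<beta>"
      and K: "\<forall>b<m. rarr s1 ''K'' b = X b - \<beta> * real (load b)" for s1 \<beta>
  proof (rule runs_Seq_assign)
    define s2 where "s2 = s1\<lparr>wreg := (wreg s1)(''e'' := wval W \<omega> s1 (WReg ''m''))\<rparr>"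
    let ?K = "rarr s1 ''K''"
    have s2: "wreg s2 ''e'' = m" "env s2" "rarr s2 = rarr s1" "rreg s2 = rreg s1" "warr s2 = warr s1"
      using F by (simp_all add: s2_def env_def)
    have build: "runs W \<omega> build_prog s2 (7 * m + 4) (\<lambda>s'. tree_frame s2 s' \<and>
      tournament (rarr s2 ''K'') m {..<m} (warr s' ''t'') {})"
      using s2 W' by (intro runs_build) simp_all
    have "runs W \<omega> (Seq (WSet ''r'' (Const 0)) sweep_prog) s3 (m * (4 * ?L + 10) + 7 * N + 2) ?post"
      if s3: "tree_frame s2 s3 \<and> tournament (rarr s2 ''K'') m {..<m} (warr s3 ''t'') {}" for s3
    proof (rule runs_Seq_assign)
      define s4 where "s4 = s3\<lparr>wreg := (wreg s3)(''r'' := wval W \<omega> s3 (Const 0))\<rparr>"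
      have "runs W \<omega> sweep_prog s4 (m * (4 * ?L + 10) + 7 * N + 1) (\<lambda>s'. \<forall>i<n. estimate ?K i (rarr s' ''out'' i - \<beta>))"
      proof (rule runs_sweep)
        show "env s4" "wreg s4 ''r'' = 0" "wreg s4 ''e'' = m" "rarr s4 ''K'' = ?K" "rreg s4 ''B'' = \<beta>"
          "tournament ?K m {..<m} (warr s4 ''t'') {}" "warr s4 ''d'' = (\<lambda>_. 0)"
          using s3 s2 F \<beta> by (simp_all add: s4_def env_def tree_frame_def)
        have "warr s4 ''x'' = warr s1 ''x''" "warr s4 ''h'' = warr s1 ''h''"
          using s3 s2 by (simp_all add: s4_def tree_frame_def)
        then show "\<forall>b. \<exists>qs. set qs = bucket_items n s \<omega> N b \<and> distinct qs \<and> chain (warr s4 ''x'') (warr s4 ''h'' b) qs"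
          using F by simp
      qed simp
      moreover have "estimate ?K i z = estimate (\<lambda>b. X b - \<beta> * real (load b)) i z" for i z
        using K by (intro estimate_cong) simp
      ultimately have "runs W \<omega> sweep_prog s4 (m * (4 * ?L + 10) + 7 * N + 1) ?post"
        using \<beta>(1) by (elim runs_mono) auto
      then show "runs W \<omega> sweep_prog (s3\<lparr>wreg := (wreg s3)(''r'' := wval W \<omega> s3 (Const 0))\<rparr>)
        (m * (4 * ?L + 10) + 7 * N + 2 - 1) ?post"
        unfolding s4_def by simp
    qed simp
    from runs_Seq[OF runs_mono[OF build order_refl this]]
    show "runs W \<omega> (Seq build_prog (Seq (WSet ''r'' (Const 0)) sweep_prog))
      (s1\<lparr>wreg := (wreg s1)(''e'' := wval W \<omega> s1 (WReg ''m''))\<rparr>) (7 * m + 4 + m * (4 * ?L + 10) + 7 * N + 3 - 1) ?post"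
      unfolding s2_def by simp
  qed simp
  let ?T1 = "7 * m + 4 + m * (4 * ?L + 10) + 7 * N + 3"
  let ?p1 = "Seq (WSet ''e'' (WReg ''m'')) (Seq build_prog (Seq (WSet ''r'' (Const 0)) sweep_prog))"
  have keys: "runs W \<omega> (Seq (WSet ''q'' (Const 0)) (Seq keys_prog ?p1)) s1 (3 * m + 2 + ?T1) ?post"
    if F: "?F s1" and \<beta>: "median_of (\<lambda>b. X b / real (load b)) (rreg s1 ''B'')" for s1
  proof (rule runs_Seq_assign)
    define s2 where "s2 = s1\<lparr>wreg := (wreg s1)(''q'' := wval W \<omega> s1 (Const 0))\<rparr>"
    have s2: "wreg s2 ''q'' = 0" "env s2" "rarr s2 = rarr s1" "rreg s2 = rreg s1" "warr s2 = warr s1"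
      using F by (simp_all add: s2_def env_def)
    note k = runs_keys[OF s2(2,1) order_refl]
    have "runs W \<omega> ?p1 s3 ?T1 ?post"
      if s3: "env s3 \<and> warr s3 = warr s2 \<and> rreg s3 = rreg s2 \<and> (\<forall>a. a \<noteq> ''K'' \<longrightarrow> rarr s3 a = rarr s2 a) \<and>
       (\<forall>b<m. rarr s3 ''K'' b = rarr s2 ''in'' b - rreg s2 ''B'' * real (warr s2 ''c'' b))" for s3
      using s3 s2 F \<beta> by (intro sweep[where \<beta> = "rreg s1 ''B''"]) simp_all
    from runs_Seq[OF runs_mono[OF k order_refl this]]
    show "runs W \<omega> (Seq keys_prog ?p1) (s1\<lparr>wreg := (wreg s1)(''q'' := wval W \<omega> s1 (Const 0))\<rparr>)
      (3 * m + 2 + ?T1 - 1) ?post"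
      unfolding s2_def by simp
  qed simp
  let ?T2 = "3 * m + 2 + ?T1"
  let ?p2 = "Seq (WSet ''q'' (Const 0)) (Seq keys_prog ?p1)"
  let ?T3 = "7 * s + 4 + (s div 2 + 1) * (4 * ?L + 8) + 3 + ?T2"
  let ?p3 = "Seq (WSet ''e'' (WReg ''s'')) (Seq build_prog (Seq (WSet ''r'' (Const 0)) (Seq bias_select_prog ?p2)))"
  have select: "runs W \<omega> ?p3 s1 ?T3 ?post"
    if F: "?F s1" and K: "\<forall>b<s. rarr s1 ''K'' b = X b / real (load b)" for s1
  proof (rule runs_Seq_assign)
    define s2 where "s2 = s1\<lparr>wreg := (wreg s1)(''e'' := wval W \<omega> s1 (WReg ''s''))\<rparr>"
    let ?K = "rarr s1 ''K''"
    have s2: "wreg s2 ''e'' = s" "env s2" "rarr s2 = rarr s1" "rreg s2 = rreg s1" "warr s2 = warr s1"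
      using F by (simp_all add: s2_def env_def)
    have build: "runs W \<omega> build_prog s2 (7 * s + 4) (\<lambda>s'. tree_frame s2 s' \<and>
      tournament (rarr s2 ''K'') s {..<s} (warr s' ''t'') {})"
      using s2 W' by (intro runs_build) simp_all
    let ?t = "(s div 2 + 1) * (4 * ?L + 8) + 1"
    have "runs W \<omega> (Seq (WSet ''r'' (Const 0)) (Seq bias_select_prog ?p2)) s3 (1 + (?t + ?T2)) ?post"
      if s3: "tree_frame s2 s3 \<and> tournament (rarr s2 ''K'') s {..<s} (warr s3 ''t'') {}" for s3
    proof (rule runs_Seq_assign)
      define s4 where "s4 = s3\<lparr>wreg := (wreg s3)(''r'' := wval W \<omega> s3 (Const 0))\<rparr>"
      have s4: "env s4" "wreg s4 ''r'' = 0" "wreg s4 ''e'' = s" "rarr s4 = rarr s1"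
          "tournament ?K s {..<s} (warr s4 ''t'') {}" "\<forall>a. a \<noteq> ''t'' \<longrightarrow> warr s4 a = warr s1 a"
        using s3 s2 F by (simp_all add: s4_def env_def tree_frame_def)
      have sel: "runs W \<omega> bias_select_prog s4 ?t
        (\<lambda>s'. env s' \<and> rarr s' = rarr s4 \<and> (\<forall>a. a \<noteq> ''t'' \<longrightarrow> warr s' a = warr s4 a) \<and> median_of ?K (rreg s' ''B''))"
        using s4 by (intro runs_bias_select) simp_all
      have "runs W \<omega> ?p2 s5 ?T2 ?post"
        if s5: "env s5 \<and> rarr s5 = rarr s4 \<and> (\<forall>a. a \<noteq> ''t'' \<longrightarrow> warr s5 a = warr s4 a) \<and> median_of ?K (rreg s5 ''B'')" for s5
      proof (rule keys)
        show "?F s5" using s5 s4 F by simp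
        show "median_of (\<lambda>b. X b / real (load b)) (rreg s5 ''B'')"
          using s5 K median_of_cong[of ?K "\<lambda>b. X b / real (load b)"] by simp
      qed
      from runs_Seq[OF runs_mono[OF sel order_refl this] order_refl]
      show "runs W \<omega> (Seq bias_select_prog ?p2) (s3\<lparr>wreg := (wreg s3)(''r'' := wval W \<omega> s3 (Const 0))\<rparr>)
        (1 + (?t + ?T2) - 1) ?post"
        unfolding s4_def by simp
    qed simp
    from runs_Seq[OF runs_mono[OF build order_refl this]]
    show "runs W \<omega> (Seq build_prog (Seq (WSet ''r'' (Const 0)) (Seq bias_select_prog ?p2)))
      (s1\<lparr>wreg := (wreg s1)(''e'' := wval W \<omega> s1 (WReg ''s''))\<rparr>) (?T3 - 1) ?post"
      unfolding s2_def by simp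
  qed simp
  let ?p4 = "Seq (WSet ''q'' (Const 0)) (Seq bias_keys_prog ?p3)"
  let ?T4 = "3 * s + 2 + ?T3"
  have bias: "runs W \<omega> ?p4 s1 ?T4 ?post" if F: "?F s1" for s1
  proof (rule runs_Seq_assign)
    define s2 where "s2 = s1\<lparr>wreg := (wreg s1)(''q'' := wval W \<omega> s1 (Const 0))\<rparr>"
    have s2: "wreg s2 ''q'' = 0" "env s2" "rarr s2 = rarr s1" "rreg s2 = rreg s1" "warr s2 = warr s1"
      using F by (simp_all add: s2_def env_def)
    note k = runs_bias_keys[OF s2(2,1) order_refl]
    have "runs W \<omega> ?p3 s3 ?T3 ?post"
      if s3: "env s3 \<and> warr s3 = warr s2 \<and> rreg s3 = rreg s2 \<and> (\<forall>a. a \<noteq> ''K'' \<longrightarrow> rarr s3 a = rarr s2 a) \<and>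
       (\<forall>b<s. rarr s3 ''K'' b = rarr s2 ''in'' b / real (warr s2 ''c'' b))" for s3
      using s3 s2 F by (intro select) simp_all
    from runs_Seq[OF runs_mono[OF k order_refl this]]
    show "runs W \<omega> (Seq bias_keys_prog ?p3) (s1\<lparr>wreg := (wreg s1)(''q'' := wval W \<omega> s1 (Const 0))\<rparr>)
      (?T4 - 1) ?post"
      unfolding s2_def by simp
  qed simp
  have count: "runs W \<omega> count_prog s0 (5 * N + 1) ?F"
    using s0 by (intro runs_mono[OF runs_count_prog order_refl]) (auto simp: load_def)
  have "5 * N + 1 + ?T4 \<le> 110 * (n * ?L)"
  proof -
    have "n * 1 \<le> n * ?L" using clog_pos by (intro mult_le_mono2)
    then have a: "n \<le> n * ?L" "2 \<le> n * ?L" "s \<le> n * ?L" "m \<le> n * ?L"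
      using n s_le_m m_less by linarith+
    have "m * ?L \<le> n * ?L" using m_less by (intro mult_le_mono1) simp
    moreover have "(s div 2 + 1) * (4 * ?L + 8) \<le> n * (12 * ?L)"
      using s_le_m m_less s_pos clog_pos by (intro mult_le_mono) auto
    moreover have "N = 2 * (n * ?L) + n" by (simp add: N_def D_def algebra_simps)
    moreover have "m * (4 * ?L + 10) = 4 * (m * ?L) + 10 * m" by (simp add: algebra_simps)
    ultimately show ?thesis using a by linarith
  qed
  then have T': "5 * N + 1 + ?T4 \<le> T" using T by linarith
  show ?thesis
    unfolding recovery_main_def
    by (rule runs_Seq[OF runs_mono[OF count order_refl bias] T'])
qed

end

section \<open>Accuracy\<close>

context sketch begin

lemma D_eq: "D = Suc (2 * clog n)"
  by (simp add: D_def)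

text \<open>By \<open>bkt_div\<close>, items of the other rows have bucket numbers from
  \<open>s\<close> on. Hence the contents of these buckets do not depend on the tape.\<close>

lemma bucket_items_row0:
  assumes "b < s"
  shows "bucket_items n s \<omega> N b = {i. i < n \<and> i mod s = b}"
proof -
  have *: "bkt q = b \<longleftrightarrow> q < n \<and> q mod s = b" for q
  proof
    assume q: "bkt q = b"
    then have "q div n = 0" using bkt_div[of q] assms by simp
    then have "q < n" using n by (simp add: div_eq_0_iff)
    with q show "q < n \<and> q mod s = b" by (simp add: bucket_def slot_def)
  qed (simp add: bucket_def slot_def)
  have "n \<le> N" by (simp add: N_def D_eq)
  then show ?thesis
    unfolding bucket_items_def * by (intro Collect_cong) linarith
qed

lemma load_row0_ge:
  assumes "b < s"
  shows "n div s \<le> load b"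
proof -
  have "(\<lambda>a. a * s + b) ` {..<n div s} \<subseteq> bucket_items n s \<omega> N b"
  proof
    fix i assume "i \<in> (\<lambda>a. a * s + b) ` {..<n div s}"
    then obtain a where a: "a < n div s" "i = a * s + b" by auto
    have "i < (a + 1) * s" using a assms by simp
    also have "\<dots> \<le> n div s * s" using a(1) by (intro mult_le_mono1) simp
    also have "\<dots> \<le> n" by simp
    finally show "i \<in> bucket_items n s \<omega> N b"
      using a assms bucket_items_row0[OF assms] by simp
  qed
  moreover have "inj_on (\<lambda>a. a * s + b) {..<n div s}"
    using s_pos by (auto intro: inj_onI)
  ultimately have "card {..<n div s} \<le> card (bucket_items n s \<omega> N b)"
    by (metis card_image card_mono finite_bucket_items)
  then show ?thesis
    by (simp add: load_def)
qed

text \<open>Since \<open>s \<le> n\<close>, rounding down loses at most a factor 2. Together with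
  the threshold of four times the average deviation, it produces the constant 8 in the bias
  error.\<close>

lemma n_le_2s: "real n \<le> 2 * (real s * real (n div s))"
proof -
  have "s \<le> n" using s_le_m m_less by simp
  then have "1 \<le> n div s" using s_pos by (simp add: div_greater_zero_iff Suc_le_eq)
  then have "s * 1 \<le> s * (n div s)" by (intro mult_le_mono2)
  moreover have "n = s * (n div s) + n mod s" by simp
  moreover have "n mod s < s" using s_pos by simp
  ultimately have "n \<le> 2 * (s * (n div s))" by linarith
  then show ?thesis by (metis of_nat_le_iff of_nat_mult of_nat_numeral)
qed

text \<open>
  Fewer than half of the buckets of row 0 contain one of the \<open>k\<close> outliers or more than
  four times the average deviation, so the median of the bucket means lies between the means
  of two of the other buckets.
\<close>

lemma bias_accuracy:
  fixes x :: "nat \<Rightarrow> real"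
  assumes T: "finite T" "card T \<le> k"
    and E: "(\<Sum>i\<in>{..<n} - T. \<bar>x i - \<beta>\<^sub>0\<bar>) \<le> E" "0 < E"
    and med: "median_of (\<lambda>b. (\<Sum>q\<in>bucket_items n s \<omega> N b. x (q mod n)) / real (load b)) \<beta>"
  shows "\<bar>\<beta> - \<beta>\<^sub>0\<bar> \<le> 8 * E / real n"
proof -
  define I where "I b = {i. i < n \<and> i mod s = b}" for b
  define err where "err b = (\<Sum>i\<in>I b - T. \<bar>x i - \<beta>\<^sub>0\<bar>)" for b
  define Y where "Y b = (\<Sum>q\<in>bucket_items n s \<omega> N b. x (q mod n)) / real (load b)" for b
  define G where "G = {b. b < s \<and> I b \<inter> T = {} \<and> err b \<le> 4 * E / real s}"
  have finI: "finite (I b)" for b by (simp add: I_def)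
  have good: "\<bar>Y b - \<beta>\<^sub>0\<bar> \<le> 8 * E / real n" if "b \<in> G" for b
  proof -
    have b: "b < s" "I b \<inter> T = {}" "err b \<le> 4 * E / real s" using that by (auto simp: G_def)
    have items: "bucket_items n s \<omega> N b = I b"
      using bucket_items_row0[OF b(1)] by (simp add: I_def)
    have load: "load b = card (I b)" by (simp add: load_def items)
    have "n div s \<noteq> 0"
      using n_le_2s n by (intro notI) simp
    then have "0 < real (n div s)" by simp
    moreover have ge: "real (n div s) \<le> real (load b)"
      using load_row0_ge[OF b(1)] by simp
    ultimately have pos: "0 < real (load b)" by linarith
    have "(\<Sum>q\<in>bucket_items n s \<omega> N b. x (q mod n)) = (\<Sum>i\<in>I b. x i)"
      unfolding items by (rule sum.cong) (auto simp: I_def)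
    then have "Y b - \<beta>\<^sub>0 = (\<Sum>i\<in>I b. x i - \<beta>\<^sub>0) / real (load b)"
      using pos unfolding Y_def by (simp add: sum_subtractf load field_simps)
    then have "\<bar>Y b - \<beta>\<^sub>0\<bar> = \<bar>\<Sum>i\<in>I b. x i - \<beta>\<^sub>0\<bar> / real (load b)"
      using pos by simp
    also have "\<dots> \<le> err b / real (load b)"
      using pos b(2) unfolding err_def by (intro divide_right_mono) (auto simp: Diff_triv intro: sum_abs)
    also have "\<dots> \<le> (4 * E / real s) / real (n div s)"
      using b(3) ge \<open>0 < real (n div s)\<close> E(2) by (intro frac_le) auto
    also have "\<dots> \<le> 8 * E / real n"
      using n_le_2s E(2) n s_pos \<open>0 < real (n div s)\<close> by (simp add: field_simps)
    finally show ?thesis .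
  qed
  have "card {b. b < s \<and> b \<notin> G} \<le> k + s div 4"
  proof -
    define H where "H = {b. b < s \<and> 4 * E / real s < err b}"
    have "{b. b < s \<and> b \<notin> G} \<subseteq> (\<lambda>i. i mod s) ` T \<union> H"
      by (auto simp: G_def I_def H_def)
    then have "card {b. b < s \<and> b \<notin> G} \<le> card ((\<lambda>i. i mod s) ` T \<union> H)"
      using T(1) by (intro card_mono) (auto simp: H_def)
    also have "\<dots> \<le> card T + card H"
      using card_Un_le card_image_le[OF T(1)] by (meson add_le_mono order_refl order_trans)
    \<comment> \<open>Markov's inequality by counting: the deviations in the buckets of row 0 add up
      to at most \<open>E\<close>, so at most a quarter of the buckets exceed
      \<open>4 * E / s\<close>.\<close>
    also have "card H \<le> s div 4"
    proof -
      have "real (card H) * (4 * E / real s) = (\<Sum>b\<in>H. 4 * E / real s)" by simp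
      also have "\<dots> \<le> (\<Sum>b\<in>H. err b)"
        by (intro sum_mono) (auto simp: H_def)
      also have "\<dots> \<le> (\<Sum>b<s. err b)"
        by (intro sum_mono2) (auto simp: H_def err_def sum_nonneg)
      also have "\<dots> = (\<Sum>b<s. \<Sum>i\<in>{i \<in> {..<n} - T. i mod s = b}. \<bar>x i - \<beta>\<^sub>0\<bar>)"
        unfolding err_def I_def by (intro sum.cong refl) auto
      also have "\<dots> = (\<Sum>i\<in>{..<n} - T. \<bar>x i - \<beta>\<^sub>0\<bar>)"
        using s_pos by (intro sum.group) auto
      finally have "real (card H) * (4 * E / real s) \<le> E" using E(1) by linarith
      then have "real (4 * card H) \<le> real s"
        using E(2) s_pos by (simp add: field_simps)
      then have "4 * card H \<le> s" by (simp only: of_nat_le_iff)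
      then show ?thesis by linarith
    qed
    finally show ?thesis using T(2) by linarith
  qed
  \<comment> \<open>With \<open>s = 320 * k\<close> the number of bad buckets is at most
    \<open>k + 80 * k\<close>, and twice that is below \<open>s\<close>.\<close>
  then have bad: "2 * card {b. b < s \<and> b \<notin> G} < s"
    using k by (simp add: s_def)
  have meet: "\<exists>b\<in>G. P b" if "s \<le> 2 * card {b. b < s \<and> P b}" for P
  proof (rule ccontr)
    assume "\<not> (\<exists>b\<in>G. P b)"
    then have "card {b. b < s \<and> P b} \<le> card {b. b < s \<and> b \<notin> G}"
      by (intro card_mono) auto
    with that bad show False by linarith
  qed
  obtain b b' where "b \<in> G" "Y b \<le> \<beta>" "b' \<in> G" "\<beta> \<le> Y b'"
    using meet[of "\<lambda>b. Y b \<le> \<beta>"] meet[of "\<lambda>b. \<beta> \<le> Y b"] med unfolding median_of_def Y_def by blast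
  with good[of b] good[of b'] show ?thesis by linarith
qed

definition collisions :: "nat \<Rightarrow> nat \<Rightarrow> nat set" where
  "collisions j i = {i'. i' < n \<and> i' \<noteq> i \<and> \<omega> (j * n + i') mod s = \<omega> (j * n + i) mod s}"

lemma bucket_items_row:
  assumes "0 < j" "j < D" "i < n"
  shows "bucket_items n s \<omega> N (bkt (j * n + i)) = (\<lambda>i'. j * n + i') ` insert i (collisions j i)"
proof -
  have slot: "bkt (j * n + i') = j * s + \<omega> (j * n + i') mod s" if "i' < n" for i'
  proof -
    have "\<not> j * n + i' < n" using assms(1) by (cases j) auto
    then show ?thesis using that by (simp add: bucket_def slot_def)
  qed
  have jN: "j * n + i' < N" if "i' < n" for i'
  proof -
    have "j * n + i' < (j + 1) * n" using that by simp
    also have "\<dots> \<le> D * n" using assms(2) by (intro mult_le_mono1) simp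
    finally show ?thesis by (simp add: N_def)
  qed
  show ?thesis
  proof (intro equalityI subsetI)
    fix q assume "q \<in> bucket_items n s \<omega> N (bkt (j * n + i))"
    then have q: "bkt q = bkt (j * n + i)" by (simp add: bucket_items_def)
    then have "q div n = j"
      using bkt_div[of q] bkt_div[of "j * n + i"] assms(3) by simp
    then have q': "q = j * n + q mod n" by (metis div_mult_mod_eq)
    have "q mod n < n" using n by simp
    with q q' slot[of "q mod n"] slot[OF assms(3)] have "\<omega> (j * n + q mod n) mod s = \<omega> (j * n + i) mod s"
      by (metis add_left_cancel)
    then have "q mod n \<in> insert i (collisions j i)"
      using \<open>q mod n < n\<close> by (simp add: collisions_def)
    with q' show "q \<in> (\<lambda>i'. j * n + i') ` insert i (collisions j i)" by blast
  next
    fix q assume "q \<in> (\<lambda>i'. j * n + i') ` insert i (collisions j i)"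
    then obtain i' where "q = j * n + i'" "i' < n" "\<omega> (j * n + i') mod s = \<omega> (j * n + i) mod s"
      using assms(3) by (auto simp: collisions_def)
    then show "q \<in> bucket_items n s \<omega> N (bkt (j * n + i))"
      using jN slot assms(3) by (simp add: bucket_items_def)
  qed
qed

text \<open>
  Scaled such that colliding with an outlier, or with deviations of total size at least \<open>E / k\<close>, weighs
  at least 1.
\<close>

definition weight :: "(nat \<Rightarrow> real) \<Rightarrow> nat set \<Rightarrow> real \<Rightarrow> real \<Rightarrow> nat \<Rightarrow> real" where
  "weight x T \<beta>\<^sub>0 E i = (if i \<in> T then 1 else (\<bar>x i - \<beta>\<^sub>0\<bar> + 8 * E / real n) * real k / E)"

text \<open>A sum below 1 admits no outlier, since one outlier already weighs 1. For any other
  coordinate, \<open>weight\<close> is \<open>k / E\<close> times a bound on its distance from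
  \<open>\<beta>\<close>: the summand \<open>8 * E / n\<close> covers the passage from
  \<open>\<beta>\<^sub>0\<close> to the estimated bias.\<close>

lemma row_accuracy:
  fixes x :: "nat \<Rightarrow> real"
  assumes \<beta>: "\<bar>\<beta> - \<beta>\<^sub>0\<bar> \<le> 8 * E / real n" and E: "0 < E"
    and j: "0 < j" "j < D" and i: "i < n"
    and good: "(\<Sum>i'\<in>collisions j i. weight x T \<beta>\<^sub>0 E i') < 1"
  shows "\<bar>(\<Sum>q\<in>bucket_items n s \<omega> N (bkt (j * n + i)). x (q mod n)) - \<beta> * real (load (bkt (j * n + i))) - (x i - \<beta>)\<bar> \<le> E / real k"
proof -
  let ?b = "bkt (j * n + i)" and ?C = "collisions j i"
  have C: "finite ?C" "i \<notin> ?C" "\<And>i'. i' \<in> ?C \<Longrightarrow> i' < n" by (simp_all add: collisions_def)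
  have w0: "0 \<le> weight x T \<beta>\<^sub>0 E i'" for i'
    using E by (simp add: weight_def)
  have noT: "i' \<notin> T" if "i' \<in> ?C" for i'
  proof
    assume "i' \<in> T"
    then have "1 \<le> (\<Sum>i'\<in>?C. weight x T \<beta>\<^sub>0 E i')"
      using member_le_sum[of i' ?C "weight x T \<beta>\<^sub>0 E"] that C(1) w0 by (simp add: weight_def)
    with good show False by simp
  qed
  have "(\<Sum>q\<in>bucket_items n s \<omega> N ?b. x (q mod n)) - \<beta> * real (load ?b) = (\<Sum>q\<in>bucket_items n s \<omega> N ?b. x (q mod n) - \<beta>)"
    by (simp add: load_def sum_subtractf mult.commute)
  also have "\<dots> = (\<Sum>i'\<in>insert i ?C. x ((j * n + i') mod n) - \<beta>)"
    unfolding bucket_items_row[OF j i] by (subst sum.reindex) (auto intro: inj_onI)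
  also have "\<dots> = (\<Sum>i'\<in>insert i ?C. x i' - \<beta>)"
    using i C(3) by (intro sum.cong) auto
  also have "\<dots> = (x i - \<beta>) + (\<Sum>i'\<in>?C. x i' - \<beta>)"
    using C by simp
  finally have "\<bar>(\<Sum>q\<in>bucket_items n s \<omega> N ?b. x (q mod n)) - \<beta> * real (load ?b) - (x i - \<beta>)\<bar> = \<bar>\<Sum>i'\<in>?C. x i' - \<beta>\<bar>"
    by simp
  also have "\<dots> \<le> (\<Sum>i'\<in>?C. \<bar>x i' - \<beta>\<bar>)" by (rule sum_abs)
  also have "\<dots> \<le> (\<Sum>i'\<in>?C. E / real k * weight x T \<beta>\<^sub>0 E i')"
  proof (rule sum_mono)
    fix i' assume "i' \<in> ?C"
    then have "E / real k * weight x T \<beta>\<^sub>0 E i' = \<bar>x i' - \<beta>\<^sub>0\<bar> + 8 * E / real n"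
      using noT E k by (simp add: weight_def)
    then show "\<bar>x i' - \<beta>\<bar> \<le> E / real k * weight x T \<beta>\<^sub>0 E i'"
      using \<beta> by linarith
  qed
  also have "\<dots> = E / real k * (\<Sum>i'\<in>?C. weight x T \<beta>\<^sub>0 E i')"
    by (simp add: sum_distrib_left)
  also have "\<dots> \<le> E / real k * 1"
    using good E by (intro mult_left_mono) auto
  finally show ?thesis by simp
qed

text \<open>Row 0 carries no guarantee here and is counted as bad. With fewer than
  \<open>clog n\<close> bad hash rows this makes at most \<open>clog n\<close> bad rows, whereas
  \<open>estimate\<close> provides more than \<open>clog n\<close> rows on each side of
  \<open>z\<close>; so \<open>z\<close> lies between two good row values.\<close>

lemma estimate_accuracy:
  assumes est: "estimate K i z" and i: "i < n"
    and few: "card {j \<in> {1..2 * clog n}. \<not> \<bar>K (bkt (j * n + i)) - a\<bar> \<le> r} < clog n"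
  shows "\<bar>z - a\<bar> \<le> r"
proof -
  let ?B = "{j \<in> {1..2 * clog n}. \<not> \<bar>K (bkt (j * n + i)) - a\<bar> \<le> r}"
  have meet: "\<exists>j. P (bkt (j * n + i)) \<and> \<bar>K (bkt (j * n + i)) - a\<bar> \<le> r"
    if "clog n < card {q \<in> items i. P (bkt q)}" for P
  proof (rule ccontr)
    assume "\<not> ?thesis"
    then have "{j. j < D \<and> P (bkt (j * n + i))} \<subseteq> insert 0 ?B"
      by (auto simp: D_eq)
    then have "card {j. j < D \<and> P (bkt (j * n + i))} \<le> card (insert 0 ?B)"
      by (intro card_mono) auto
    also have "\<dots> \<le> Suc (card ?B)" by (simp add: card_insert_if)
    finally show False
      using that few card_items_filter[OF i, of "\<lambda>q. P (bkt q)"] by simp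
  qed
  obtain j j' where "K (bkt (j * n + i)) \<le> z" "\<bar>K (bkt (j * n + i)) - a\<bar> \<le> r"
    "z \<le> K (bkt (j' * n + i))" "\<bar>K (bkt (j' * n + i)) - a\<bar> \<le> r"
    using meet[of "\<lambda>b. K b \<le> z"] meet[of "\<lambda>b. z \<le> K b"] est unfolding estimate_def by blast
  then show ?thesis by linarith
qed

text \<open>Reduces accuracy to an event that sees the tape only through \<open>collisions\<close>:
  a hash row whose value is off must have a heavy collision set.\<close>

lemma recovery_accuracy:
  fixes x :: "nat \<Rightarrow> real"
  assumes T: "finite T" "card T \<le> k"
    and E: "(\<Sum>i\<in>{..<n} - T. \<bar>x i - \<beta>\<^sub>0\<bar>) \<le> E" "0 < E"
    and med: "median_of (\<lambda>b. (\<Sum>q\<in>bucket_items n s \<omega> N b. x (q mod n)) / real (load b)) \<beta>"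
    and i: "i < n"
    and est: "estimate (\<lambda>b. (\<Sum>q\<in>bucket_items n s \<omega> N b. x (q mod n)) - \<beta> * real (load b)) i (z - \<beta>)"
    and few: "card {j \<in> {1..2 * clog n}. 1 \<le> (\<Sum>i'\<in>collisions j i. weight x T \<beta>\<^sub>0 E i')} < clog n"
  shows "\<bar>z - x i\<bar> \<le> E / real k"
proof -
  let ?K = "\<lambda>b. (\<Sum>q\<in>bucket_items n s \<omega> N b. x (q mod n)) - \<beta> * real (load b)"
  let ?bad = "{j \<in> {1..2 * clog n}. \<not> \<bar>?K (bkt (j * n + i)) - (x i - \<beta>)\<bar> \<le> E / real k}"
  let ?heavy = "{j \<in> {1..2 * clog n}. 1 \<le> (\<Sum>i'\<in>collisions j i. weight x T \<beta>\<^sub>0 E i')}"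
  have "?bad \<subseteq> ?heavy"
  proof
    fix j assume j: "j \<in> ?bad"
    then have "0 < j" "j < D" by (auto simp: D_eq)
    from row_accuracy[OF bias_accuracy[OF T E med] E(2) this i, of x T] j
    show "j \<in> ?heavy" by (simp add: not_less[symmetric]) blast
  qed
  then have "card ?bad \<le> card ?heavy" by (intro card_mono) simp_all
  then have "card ?bad < clog n" using few by linarith
  from estimate_accuracy[OF est i this] show ?thesis by simp
qed

lemma weight_nonneg: "0 < E \<Longrightarrow> 0 \<le> weight x T \<beta>\<^sub>0 E i"
  by (simp add: weight_def)

lemma sum_weight_le:
  assumes T: "finite T" "card T \<le> k"
    and E: "(\<Sum>i\<in>{..<n} - T. \<bar>x i - \<beta>\<^sub>0\<bar>) \<le> E" "0 < E"
  shows "(\<Sum>i<n. weight x T \<beta>\<^sub>0 E i) \<le> 10 * real k"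
proof -
  have "(\<Sum>i<n. weight x T \<beta>\<^sub>0 E i) = (\<Sum>i\<in>{..<n} \<inter> T. weight x T \<beta>\<^sub>0 E i) + (\<Sum>i\<in>{..<n} - T. weight x T \<beta>\<^sub>0 E i)"
    by (rule sum.Int_Diff) simp
  also have "(\<Sum>i\<in>{..<n} \<inter> T. weight x T \<beta>\<^sub>0 E i) = real (card ({..<n} \<inter> T))"
    by (simp add: weight_def)
  also have "\<dots> \<le> real k"
    using T card_mono[of T "{..<n} \<inter> T"] by simp
  also have "(\<Sum>i\<in>{..<n} - T. weight x T \<beta>\<^sub>0 E i) = (\<Sum>i\<in>{..<n} - T. (\<bar>x i - \<beta>\<^sub>0\<bar> + 8 * E / real n) * (real k / E))"
    by (intro sum.cong) (auto simp: weight_def)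
  also have "\<dots> = ((\<Sum>i\<in>{..<n} - T. \<bar>x i - \<beta>\<^sub>0\<bar>) + real (card ({..<n} - T)) * (8 * E / real n)) * (real k / E)"
    by (simp only: sum_distrib_right[symmetric] sum.distrib sum_constant)
  also have "\<dots> \<le> (E + real n * (8 * E / real n)) * (real k / E)"
  proof (intro mult_right_mono add_mono E(1))
    have "card ({..<n} - T) \<le> n"
      using card_mono[of "{..<n}" "{..<n} - T"] by simp
    then show "real (card ({..<n} - T)) \<le> real n" by simp
  qed (use E(2) in auto)
  also have "\<dots> = 9 * real k"
    using E(2) n by (simp add: field_simps)
  finally show ?thesis by simp
qed

end

section \<open>The sketching scheme\<close>

lemma runs_imp_computes_within:
  assumes "runs W \<omega> p (init_state n k u) T (\<lambda>s. vec (dim_vec v) (rarr s ''out'') = v)" "real T \<le> T'"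
  shows "computes_within W \<omega> p n k u v T'"
  using assms unfolding runs_def computes_within_def
  by (meson of_nat_le_iff order_trans)

context sketch begin

text \<open>A bucket number determines its row, so the entries are 0 or 1; in the form of
  cardinalities the matrix product becomes a sum regrouped by coordinates.\<close>

definition sketch_matrix :: "real mat" where
  "sketch_matrix = mat m n (\<lambda>(b, i). real (card {q \<in> bucket_items n s \<omega> N b. q mod n = i}))"

lemma sketch_matrix_carrier: "sketch_matrix \<in> carrier_mat m n"
  by (simp add: sketch_matrix_def)

lemma sketch_matrix_mult:
  assumes "x \<in> carrier_vec n" "b < m"
  shows "(sketch_matrix *\<^sub>v x) $ b = (\<Sum>q\<in>bucket_items n s \<omega> N b. x $ (q mod n))"
proof -
  have "(sketch_matrix *\<^sub>v x) $ b = (\<Sum>i<n. real (card {q \<in> bucket_items n s \<omega> N b. q mod n = i}) * x $ i)"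
    using assms by (simp add: sketch_matrix_def scalar_prod_def atLeast0LessThan)
  also have "\<dots> = (\<Sum>i<n. \<Sum>q\<in>{q \<in> bucket_items n s \<omega> N b. q mod n = i}. x $ (q mod n))"
    by (intro sum.cong) auto
  also have "\<dots> = (\<Sum>q\<in>bucket_items n s \<omega> N b. x $ (q mod n))"
    using n by (intro sum.group) auto
  finally show ?thesis .
qed

lemma runs_init_main:
  assumes "3 * clog n + 5 \<le> T"
    and Q: "\<And>s'. env s' \<Longrightarrow> wreg s' ''q'' = 0 \<Longrightarrow> warr s' = (\<lambda>_ _. 0) \<Longrightarrow>
      rarr s' = (\<lambda>_ _. 0)(''in'' := (\<lambda>i. if i < dim_vec u then u $ i else 0)) \<Longrightarrow> Q s'"
  shows "runs W \<omega> init_prog (init_state n k u) T Q"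
proof (rule runs_init[where n = n and k = k])
  show "(2 * clog n + 1) * (320 * k) < W" "(2 * clog n + 1) * n < W"
    using W_bounds by (simp_all only: m_def[symmetric] N_def[symmetric] D_def[symmetric] s_def[symmetric])
  show "320 < W"
    using W_bounds(4) s_le_m k by (simp add: s_def)
  have "2 * n < n * n"
    using n m_less s_le_m s_pos by simp
  then show "2 * n < W" using W by linarith
  fix s' :: state
  assume "wreg s' ''n'' = n" "wreg s' ''l'' = clog n" "wreg s' ''s'' = 320 * k"
    "wreg s' ''m'' = (2 * clog n + 1) * (320 * k)" "wreg s' ''N'' = (2 * clog n + 1) * n"
    "wreg s' ''q'' = wreg (init_state n k u) ''q''" "warr s' = warr (init_state n k u)" "rarr s' = rarr (init_state n k u)"
  then show "Q s'"
    by (intro Q) (simp_all only: env_def m_def N_def D_def s_def, simp_all add: init_state_def)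
qed (use assms(1) k in \<open>simp_all add: init_state_def\<close>)

lemma sketch_computes:
  assumes "x \<in> carrier_vec n"
  shows "computes_within W \<omega> sketch_prog n k x (sketch_matrix *\<^sub>v x) (real (30 * (n * clog n)))"
proof (rule runs_imp_computes_within)
  have L: "n \<le> n * clog n" "clog n \<le> n * clog n"
    using clog_pos n by simp_all
  have main: "runs W \<omega> (Cond (WLess (WReg ''m'') (WReg ''n'')) sketch_main copy_prog) s' (3 * N + 2)
    (\<lambda>s'. vec (dim_vec (sketch_matrix *\<^sub>v x)) (rarr s' ''out'') = sketch_matrix *\<^sub>v x)"
    if s': "env s'" "wreg s' ''q'' = 0" "rarr s' = (\<lambda>_ _. 0)(''in'' := (\<lambda>i. if i < dim_vec x then x $ i else 0))" for s'
  proof (rule runs_Cond)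
    have *: "rarr s' ''out'' = (\<lambda>_. 0)" "\<And>i. i < n \<Longrightarrow> rarr s' ''in'' i = x $ i"
      using s' assms by simp_all
    show "runs W \<omega> sketch_main s' (3 * N + 1)
      (\<lambda>s'. vec (dim_vec (sketch_matrix *\<^sub>v x)) (rarr s' ''out'') = sketch_matrix *\<^sub>v x)"
    proof (rule runs_mono[OF runs_sketch_main[OF s'(1,2) *(1) order_refl] order_refl])
      fix s1 :: state
      assume out: "\<forall>b. rarr s1 ''out'' b = (\<Sum>q\<in>bucket_items n s \<omega> N b. rarr s' ''in'' (q mod n))"
      have "rarr s1 ''out'' b = (sketch_matrix *\<^sub>v x) $ b" if "b < m" for b
        unfolding sketch_matrix_mult[OF assms that] out[rule_format] using n *(2) by (intro sum.cong) auto
      then show "vec (dim_vec (sketch_matrix *\<^sub>v x)) (rarr s1 ''out'') = sketch_matrix *\<^sub>v x"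
        using sketch_matrix_carrier by (intro eq_vecI) simp_all
    qed
  qed (use s' m_less in \<open>simp_all add: env_def\<close>)
  show "runs W \<omega> sketch_prog (init_state n k x) (30 * (n * clog n))
    (\<lambda>s'. vec (dim_vec (sketch_matrix *\<^sub>v x)) (rarr s' ''out'') = sketch_matrix *\<^sub>v x)"
    unfolding sketch_prog_def
  proof (rule runs_Seq[OF runs_init_main[OF order_refl main]])
    have "N = 2 * (n * clog n) + n" by (simp add: N_def D_def algebra_simps)
    moreover have "2 \<le> n * clog n" using L n by linarith
    ultimately show "3 * clog n + 5 + (3 * N + 2) \<le> 30 * (n * clog n)"
      using L by linarith
  qed
qed simp

text \<open>A relation between sketch and output, from which the recovery function is later obtained
  by choice. It couples the timed run with the combinatorial facts about its output, so that a
  single choice provides both.\<close>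

definition recovers :: "rvec \<Rightarrow> rvec \<Rightarrow> bool" where
  "recovers y z \<longleftrightarrow> z \<in> carrier_vec n \<and>
    computes_within W \<omega> recovery_prog n k y z (real (130 * (n * clog n))) \<and>
    (\<exists>\<beta>. median_of (\<lambda>b. y $ b / real (load b)) \<beta> \<and>
      (\<forall>i<n. estimate (\<lambda>b. y $ b - \<beta> * real (load b)) i (z $ i - \<beta>)))"

lemma recovers_carrier: "recovers y z \<Longrightarrow> z \<in> carrier_vec n"
  by (simp add: recovers_def)

lemma recovers_computes:
  "recovers y z \<Longrightarrow> computes_within W \<omega> recovery_prog n k y z (real (130 * (n * clog n)))"
  unfolding recovers_def by blast

lemma ex_recovers:
  assumes y: "y \<in> carrier_vec m"
  shows "\<exists>z. recovers y z"
proof -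
  have L: "n \<le> n * clog n" "clog n \<le> n * clog n"
    using clog_pos n by simp_all
  let ?X = "\<lambda>i. if i < dim_vec y then y $ i else 0"
  let ?post = "\<lambda>s' :: state. \<exists>\<beta>. median_of (\<lambda>b. ?X b / real (load b)) \<beta> \<and>
    (\<forall>i<n. estimate (\<lambda>b. ?X b - \<beta> * real (load b)) i (rarr s' ''out'' i - \<beta>))"
  have main: "runs W \<omega> (Cond (WLess (WReg ''m'') (WReg ''n'')) recovery_main copy_prog) s' (110 * (n * clog n) + 1) ?post"
    if s': "env s'" "wreg s' ''q'' = 0" "warr s' = (\<lambda>_ _. 0)" "rarr s' = (\<lambda>_ _. 0)(''in'' := ?X)" for s'
  proof (rule runs_Cond)
    show "runs W \<omega> recovery_main s' (110 * (n * clog n)) ?post"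
      by (rule runs_recovery_main) (use s' in simp_all)
  qed (use s' m_less in \<open>simp_all add: env_def\<close>)
  have le: "3 * clog n + 5 + (110 * (n * clog n) + 1) \<le> 130 * (n * clog n)"
    using L n by linarith
  have "runs W \<omega> recovery_prog (init_state n k y) (130 * (n * clog n)) ?post"
    unfolding recovery_prog_def by (rule runs_Seq[OF runs_init_main[OF order_refl main] le])
  then obtain t s1 where ex: "exec W \<omega> recovery_prog (init_state n k y) t s1" "t \<le> 130 * (n * clog n)" "?post s1"
    unfolding runs_def by blast
  then obtain \<beta> where \<beta>: "median_of (\<lambda>b. ?X b / real (load b)) \<beta>"
      "\<forall>i<n. estimate (\<lambda>b. ?X b - \<beta> * real (load b)) i (rarr s1 ''out'' i - \<beta>)" by blast
  define z where "z = vec n (rarr s1 ''out'')"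
  have "computes_within W \<omega> recovery_prog n k y z (real (130 * (n * clog n)))"
  proof -
    have "real t \<le> real (130 * (n * clog n))" using ex(2) by (simp only: of_nat_le_iff)
    then show ?thesis
      unfolding computes_within_def using ex(1) by (intro exI[of _ t] exI[of _ s1]) (simp add: z_def)
  qed
  \<comment> \<open>Only entries below \<open>m\<close> are looked at, so the zero padding of the
    input array makes no difference.\<close>
  moreover have "median_of (\<lambda>b. y $ b / real (load b)) \<beta>"
    using \<beta>(1) y s_le_m by (subst median_of_cong[where K' = "\<lambda>b. ?X b / real (load b)"]) auto
  moreover have "estimate (\<lambda>b. y $ b - \<beta> * real (load b)) i (z $ i - \<beta>)" if "i < n" for i
    using \<beta>(2) y that by (subst estimate_cong[where K' = "\<lambda>b. ?X b - \<beta> * real (load b)"]) (auto simp: z_def)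
  ultimately show ?thesis
    unfolding recovers_def by (intro exI[of _ z]) (auto simp: z_def)
qed

lemma recovers_accurate:
  assumes x: "x \<in> carrier_vec n" and z: "recovers (sketch_matrix *\<^sub>v x) z"
    and T: "finite T" "card T \<le> k"
    and E: "(\<Sum>i\<in>{..<n} - T. \<bar>x $ i - \<beta>\<^sub>0\<bar>) \<le> E" "0 < E"
    and few: "\<And>i. i < n \<Longrightarrow>
      card {j \<in> {1..2 * clog n}. 1 \<le> (\<Sum>i'\<in>collisions j i. weight (($) x) T \<beta>\<^sub>0 E i')} < clog n"
    and i: "i < n"
  shows "\<bar>z $ i - x $ i\<bar> \<le> E / real k"
proof -
  let ?Y = "\<lambda>b. (\<Sum>q\<in>bucket_items n s \<omega> N b. x $ (q mod n))"
  obtain \<beta> where \<beta>: "median_of (\<lambda>b. (sketch_matrix *\<^sub>v x) $ b / real (load b)) \<beta>"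
      "\<forall>i<n. estimate (\<lambda>b. (sketch_matrix *\<^sub>v x) $ b - \<beta> * real (load b)) i (z $ i - \<beta>)"
    using z unfolding recovers_def by blast
  have "median_of (\<lambda>b. ?Y b / real (load b)) \<beta>"
    using \<beta>(1) s_le_m sketch_matrix_mult[OF x]
    by (subst median_of_cong[where K' = "\<lambda>b. (sketch_matrix *\<^sub>v x) $ b / real (load b)"]) auto
  moreover have "estimate (\<lambda>b. ?Y b - \<beta> * real (load b)) i (z $ i - \<beta>)"
    using \<beta>(2) i sketch_matrix_mult[OF x]
    by (subst estimate_cong[where K' = "\<lambda>b. (sketch_matrix *\<^sub>v x) $ b - \<beta> * real (load b)"]) auto
  ultimately show ?thesis
    using recovery_accuracy[OF T E _ i _ few[OF i]] by simp
qed

end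

section \<open>Norms\<close>

lemma lp_norm_1: "lp_norm 1 v = (\<Sum>i<dim_vec v. \<bar>v $ i\<bar>)"
  by (simp add: lp_norm_def sum_nonneg)

lemma lp_norm_nonneg: "0 \<le> lp_norm p v"
  by (simp add: lp_norm_def)

lemma k_sparse_zero: "k_sparse k (0\<^sub>v d)"
proof -
  have "{i. i < dim_vec (0\<^sub>v d :: rvec) \<and> (0\<^sub>v d :: rvec) $ i \<noteq> 0} = {}" by auto
  then show ?thesis by (simp only: k_sparse_def card.empty)
qed

lemma sparse_errs_nonempty: "{lp_norm p (v - x') |x'. x' \<in> carrier_vec (dim_vec v) \<and> k_sparse k x'} \<noteq> {}"
  using zero_carrier_vec k_sparse_zero by blast

lemma sparse_err_nonneg: "0 \<le> sparse_err p k v"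
  unfolding sparse_err_def by (rule cInf_greatest[OF sparse_errs_nonempty]) (auto intro: lp_norm_nonneg)

lemma min_bias_err_nonneg: "0 \<le> min_bias_err p k v"
  unfolding min_bias_err_def by (intro cINF_greatest) (auto intro: sparse_err_nonneg)

text \<open>A strict bound on the two nested infima yields an actual shift and an actual sparse
  vector, whose support becomes the outlier set \<open>T\<close>.\<close>

lemma min_bias_err_less:
  assumes "min_bias_err 1 k x < r" "x \<in> carrier_vec n"
  obtains \<beta> T where "finite T" "card T \<le> k" "(\<Sum>i\<in>{..<n} - T. \<bar>x $ i - \<beta>\<bar>) \<le> r"
proof -
  obtain \<beta> where "sparse_err 1 k (shift_vec x \<beta>) < r"
    using assms(1) cInf_lessD[of "range (\<lambda>\<beta>. sparse_err 1 k (shift_vec x \<beta>))" r]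
    unfolding min_bias_err_def by auto
  then obtain x' where x': "x' \<in> carrier_vec (dim_vec (shift_vec x \<beta>))" "k_sparse k x'" "lp_norm 1 (shift_vec x \<beta> - x') < r"
    using cInf_lessD[OF sparse_errs_nonempty] unfolding sparse_err_def by blast
  then have dim: "dim_vec x' = n" using assms(2) by (simp add: shift_vec_def)
  let ?T = "{i. i < n \<and> x' $ i \<noteq> 0}"
  have "(\<Sum>i\<in>{..<n} - ?T. \<bar>x $ i - \<beta>\<bar>) = (\<Sum>i\<in>{..<n} - ?T. \<bar>(shift_vec x \<beta> - x') $ i\<bar>)"
    using dim assms(2) by (intro sum.cong) (auto simp: shift_vec_def)
  also have "\<dots> \<le> (\<Sum>i<n. \<bar>(shift_vec x \<beta> - x') $ i\<bar>)"
    by (intro sum_mono2) auto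
  also have "\<dots> = lp_norm 1 (shift_vec x \<beta> - x')"
    using dim by (simp add: lp_norm_1)
  finally show ?thesis
    using that[of ?T \<beta>] x'(2,3) dim by (simp add: k_sparse_def)
qed

lemma linf_norm_le:
  assumes "0 < dim_vec v" "\<And>i. i < dim_vec v \<Longrightarrow> \<bar>v $ i\<bar> \<le> r"
  shows "linf_norm v \<le> r"
proof -
  have "{\<bar>v $ i\<bar> |i. i < dim_vec v} = (\<lambda>i. \<bar>v $ i\<bar>) ` {..<dim_vec v}" by auto
  then show ?thesis
    using assms unfolding linf_norm_def by (subst Max_le_iff) auto
qed

text \<open>Continuity from above along \<open>a + 1 / (i + 1)\<close>. It transfers the guarantee
  from all strictly larger bounds to the exact one, in particular to the bound 0.\<close>

lemma prob_le_right_continuous: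
  fixes f :: "'a \<Rightarrow> real"
  assumes "\<And>r. a < r \<Longrightarrow> c \<le> measure_pmf.prob M {\<omega>. f \<omega> \<le> r}"
  shows "c \<le> measure_pmf.prob M {\<omega>. f \<omega> \<le> a}"
proof -
  let ?A = "\<lambda>i. {\<omega>. f \<omega> \<le> a + 1 / real (Suc i)}"
  have "decseq ?A"
  proof (rule decseq_SucI, safe)
    fix i \<omega> assume "f \<omega> \<le> a + 1 / real (Suc (Suc i))"
    also have "\<dots> \<le> a + 1 / real (Suc i)" by (simp add: field_simps)
    finally show "f \<omega> \<le> a + 1 / real (Suc i)" .
  qed
  then have "(\<lambda>i. measure_pmf.prob M (?A i)) \<longlonglongrightarrow> measure_pmf.prob M (\<Inter>i. ?A i)"
    by (intro measure_pmf.finite_Lim_measure_decseq) auto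
  moreover have "(\<Inter>i. ?A i) = {\<omega>. f \<omega> \<le> a}"
  proof (intro equalityI subsetI)
    fix \<omega> assume \<omega>: "\<omega> \<in> (\<Inter>i. ?A i)"
    have "f \<omega> \<le> a"
    proof (rule ccontr)
      assume "\<not> f \<omega> \<le> a"
      then obtain i where "inverse (real (Suc i)) < f \<omega> - a"
        using reals_Archimedean[of "f \<omega> - a"] by auto
      with \<omega> show False by (auto simp: field_simps dest!: spec[of _ i])
    qed
    then show "\<omega> \<in> {\<omega>. f \<omega> \<le> a}" by simp
  qed (auto intro: order_trans)
  ultimately show ?thesis
    using assms by (intro LIMSEQ_le_const[of "\<lambda>i. measure_pmf.prob M (?A i)"]) (auto simp del: of_nat_Suc)
qed

section \<open>Failure probability\<close>

text \<open>The default 0 stored at addresses outside \<open>{..<W}\<close> is a word as well, so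
  the bound holds at every address.\<close>

lemma tape_less:
  assumes "0 < W" "\<omega> \<in> set_pmf (random_tape W)"
  shows "\<omega> q < W"
proof -
  have "\<omega> \<in> PiE_dflt {..<W} 0 (set_pmf \<circ> (\<lambda>_. pmf_of_set {..<W}))"
    using assms(2) by (simp add: random_tape_def set_Pi_pmf)
  then show ?thesis
    using assms(1) by (cases "q < W") (auto simp: PiE_dflt_def lessThan_empty_iff)
qed

text \<open>The weights are fixed while the tape is random. Row \<open>j\<close> reads only the
  block of words from \<open>j * n\<close> to \<open>j * n + n - 1\<close>; these blocks are
  disjoint, which makes the rows independent. Of the bound \<open>1 / n\<^sup>2\<close> per
  coordinate, a union bound over all coordinates leaves \<open>1 / n\<close>.\<close>

lemma failure_prob_le:
  fixes w :: "nat \<Rightarrow> real"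
  assumes n: "2 \<le> n" "1 \<le> k" "(2 * clog n + 1) * (320 * k) < n" "n * n \<le> W"
    and w: "\<And>i. 0 \<le> w i" "(\<Sum>i<n. w i) \<le> 10 * real k"
  shows "measure_pmf.prob (random_tape W) {\<omega>. \<exists>i<n. clog n \<le> card {j \<in> {1..2 * clog n}.
    1 \<le> (\<Sum>i'\<in>{i'. i' < n \<and> i' \<noteq> i \<and> \<omega> (j * n + i') mod (320 * k) = \<omega> (j * n + i) mod (320 * k)}. w i')}} \<le> 1 / real n"
proof -
  define bad where "bad = (\<lambda>i j (\<omega> :: tape). 1 \<le> (\<Sum>i'\<in>{i'. i' < n \<and> i' \<noteq> i \<and> \<omega> (j * n + i') mod (320 * k) = \<omega> (j * n + i) mod (320 * k)}. w i'))"
  let ?L = "clog n" and ?s = "320 * k"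
  have rows: "j * n + n \<le> W" if "j \<le> 2 * ?L" for j
  proof -
    have "(2 * ?L + 1) * 1 \<le> (2 * ?L + 1) * ?s" using n(2) by (intro mult_le_mono2) simp
    then have "(j + 1) * n \<le> n * n" using n(3) that by (intro mult_le_mono1) simp
    then show ?thesis using n(4) by simp
  qed
  have "?s \<le> (2 * ?L + 1) * ?s" by simp
  then have s: "0 < ?s" "?s \<le> W"
    using n rows[of 0] by auto
  have one: "measure_pmf.prob (random_tape W) {\<omega>. ?L \<le> card {j \<in> {1..2 * ?L}. bad i j \<omega>}} \<le> 1 / (real n * real n)"
    if i: "i < n" for i
  proof -
    have "measure_pmf.prob (random_tape W) {\<omega>. ?L \<le> card {j \<in> {1..2 * ?L}. bad i j \<omega>}} \<le> 2 ^ card {1..2 * ?L} * (1 / 16) ^ ?L"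
      unfolding random_tape_def
    proof (rule Pi_pmf_prob_many_le[where P = "bad i" and B = "\<lambda>j. {j * n..<j * n + n}"])
      show "disjoint_family_on (\<lambda>j. {j * n..<j * n + n}) {1..2 * ?L}"
        unfolding disjoint_family_on_def
      proof (intro ballI impI equals0I)
        fix a b q assume "a \<noteq> b" and q: "q \<in> {a * n..<a * n + n} \<inter> {b * n..<b * n + n}"
        have "q div n = a" "q div n = b"
          using q n(1) by (auto intro!: div_nat_eqI simp: algebra_simps)
        with \<open>a \<noteq> b\<close> show False by simp
      qed
      show "{j * n..<j * n + n} \<subseteq> {..<W}" if "j \<in> {1..2 * ?L}" for j
        using rows[of j] that by auto
      show "bad i j f = bad i j g" if "\<And>q. q \<in> {j * n..<j * n + n} \<Longrightarrow> f q = g q" for j f g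
      proof -
        have "f (j * n + i') = g (j * n + i')" if "i' < n" for i'
          using \<open>\<And>q. q \<in> {j * n..<j * n + n} \<Longrightarrow> f q = g q\<close>[of "j * n + i'"] that by simp
        then have "{i'. i' < n \<and> i' \<noteq> i \<and> f (j * n + i') mod ?s = f (j * n + i) mod ?s} =
          {i'. i' < n \<and> i' \<noteq> i \<and> g (j * n + i') mod ?s = g (j * n + i) mod ?s}"
          using i by (intro Collect_cong) auto
        then show ?thesis by (simp add: bad_def)
      qed
      show "measure_pmf.prob (Pi_pmf {..<W} 0 (\<lambda>_. pmf_of_set {..<W})) {\<omega>. bad i j \<omega>} \<le> 1 / 16"
        if "j \<in> {1..2 * ?L}" for j
      proof -
        have "measure_pmf.prob (random_tape W) {\<omega>. bad i j \<omega>} \<le> 2 / real ?s * (\<Sum>i<n. w i)"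
          unfolding bad_def using rows[of j] that s i w(1) by (intro weighted_collision_le) auto
        also have "\<dots> \<le> 2 / real ?s * (10 * real k)"
          using w(2) by (intro mult_left_mono) auto
        also have "\<dots> = 1 / 16" using n(2) by simp
        finally show ?thesis by (simp add: random_tape_def)
      qed
    qed simp_all
    also have "\<dots> = (1 / 4) ^ ?L"
      by (simp add: power_mult power_mult_distrib[symmetric])
    also have "\<dots> = 1 / (2 ^ ?L * 2 ^ ?L)"
      by (simp add: power_one_over power_mult_distrib[symmetric])
    also have "\<dots> \<le> 1 / (real n * real n)"
    proof -
      have "real n \<le> 2 ^ ?L"
        using clog[of n] by (metis of_nat_le_iff of_nat_numeral of_nat_power)
      then show ?thesis
        using n(1) by (intro divide_left_mono mult_mono) auto
    qed
    finally show ?thesis .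
  qed
  have "measure_pmf.prob (random_tape W) {\<omega>. \<exists>i<n. ?L \<le> card {j \<in> {1..2 * ?L}. bad i j \<omega>}} =
      measure_pmf.prob (random_tape W) (\<Union>i\<in>{..<n}. {\<omega>. ?L \<le> card {j \<in> {1..2 * ?L}. bad i j \<omega>}})"
    by (intro arg_cong[where f = "measure_pmf.prob (random_tape W)"]) auto
  also have "\<dots> \<le> (\<Sum>i<n. measure_pmf.prob (random_tape W) {\<omega>. ?L \<le> card {j \<in> {1..2 * ?L}. bad i j \<omega>}})"
    by (rule measure_pmf.finite_measure_subadditive_finite) auto
  also have "\<dots> \<le> (\<Sum>i<n. 1 / (real n * real n))"
    using one by (intro sum_mono) auto
  also have "\<dots> = 1 / real n"
    using n(1) by simp
  finally show ?thesis unfolding bad_def .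
qed

text \<open>From \<open>2 ^ (clog n - 1) < n\<close> and \<open>ln 2 \<ge> 2 / 3\<close> follows
  \<open>clog n - 1 < 3 / 2 * ln n\<close>, and since \<open>n \<ge> 2\<close> the missing 1 is at
  most \<open>3 / 2 * ln n\<close> as well.\<close>

lemma clog_le_ln:
  assumes "2 \<le> n"
  shows "real (clog n) \<le> 3 * ln (real n)"
proof (cases "clog n")
  case (Suc l)
  then have "2 ^ l < n" using less_clog[of l n] by simp
  then have "(2::real) ^ l < real n"
    by (metis of_nat_less_iff of_nat_numeral of_nat_power)
  then have "ln (2 ^ l) < ln (real n)"
    using assms by (intro ln_less_cancel_iff[THEN iffD2]) auto
  then have "real l * ln 2 < ln (real n)"
    by (simp add: ln_realpow)
  moreover have "real l * (2 / 3) \<le> real l * ln 2"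
    using ln2_ge_two_thirds by (intro mult_left_mono) auto
  moreover have "ln 2 \<le> ln (real n)"
    using assms by simp
  ultimately show ?thesis
    using ln2_ge_two_thirds Suc by simp
qed (use assms in simp)

text \<open>3000 is a common upper bound: there are at most \<open>960 * k * clog n\<close> buckets,
  hence at most \<open>2880 * k * ln n\<close>, and the running times of
  \<open>30 * n * clog n\<close> and \<open>130 * n * clog n\<close> stay well below it.\<close>

definition is_scheme :: "nat \<Rightarrow> nat \<Rightarrow> nat \<Rightarrow> nat \<Rightarrow> (tape \<Rightarrow> real mat) \<Rightarrow> (tape \<Rightarrow> rvec \<Rightarrow> rvec) \<Rightarrow> bool" where
  "is_scheme W n k m \<Phi> \<R> \<longleftrightarrow>
    real m \<le> 3000 * (real k * ln (real n)) \<and>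
    (\<forall>\<omega> \<in> set_pmf (random_tape W). \<Phi> \<omega> \<in> carrier_mat m n \<and> \<R> \<omega> \<in> carrier_vec m \<rightarrow> carrier_vec n) \<and>
    (\<forall>x \<in> carrier_vec n. measure_pmf.prob (random_tape W)
       {\<omega>. linf_norm (\<R> \<omega> (\<Phi> \<omega> *\<^sub>v x) - x) \<le> 1 / real k * min_bias_err 1 k x} \<ge> 1 - 1 / real n) \<and>
    (\<forall>\<omega> \<in> set_pmf (random_tape W). \<forall>x \<in> carrier_vec n.
       computes_within W \<omega> sketch_prog n k x (\<Phi> \<omega> *\<^sub>v x) (3000 * (real n * ln (real n))) \<and>
       computes_within W \<omega> recovery_prog n k (\<Phi> \<omega> *\<^sub>v x) (\<R> \<omega> (\<Phi> \<omega> *\<^sub>v x)) (3000 * (real n * ln (real n))))"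

lemma computes_within_mono:
  "computes_within W \<omega> p n k u v T \<Longrightarrow> T \<le> T' \<Longrightarrow> computes_within W \<omega> p n k u v T'"
  unfolding computes_within_def by (meson order_trans)

lemma time_le:
  assumes "2 \<le> n" "c \<le> 1000"
  shows "real (c * (n * clog n)) \<le> 3000 * (real n * ln (real n))"
proof -
  have "real (c * (n * clog n)) \<le> 1000 * (real n * real (clog n))"
    using assms(2) mult_right_mono[of "real c" 1000 "real n * real (clog n)"] by simp
  also have "\<dots> \<le> 1000 * (real n * (3 * ln (real n)))"
    using clog_le_ln[OF assms(1)] by (intro mult_left_mono) auto
  finally show ?thesis by simp
qed

lemma buckets_le:
  assumes "2 \<le> n"
  shows "real ((2 * clog n + 1) * (320 * k)) \<le> 3000 * (real k * ln (real n))"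
proof -
  have "1 \<le> clog n" using clog[of n] assms by (cases "clog n") auto
  then have "(2 * clog n + 1) * (320 * k) \<le> 3 * clog n * (320 * k)"
    by (intro mult_le_mono1) simp
  then have "real ((2 * clog n + 1) * (320 * k)) \<le> real (3 * clog n * (320 * k))"
    by (simp only: of_nat_le_iff)
  also have "\<dots> = 960 * (real k * real (clog n))" by simp
  also have "\<dots> \<le> 960 * (real k * (3 * ln (real n)))"
    using clog_le_ln[OF assms] by (intro mult_left_mono) auto
  also have "\<dots> \<le> 3000 * (real k * ln (real n))"
    using assms by simp
  finally show ?thesis .
qed

text \<open>With \<open>n\<close> at most the planned number of buckets, the identity matrix is
  within the size bound, both programs take the copying branch, and recovery is exact on every
  tape.\<close>

lemma trivial_scheme:
  assumes n: "2 \<le> n" "1 \<le> k" "k < n" "n \<le> (2 * clog n + 1) * (320 * k)"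
  shows "is_scheme (n ^ 20) n k n (\<lambda>_. 1\<^sub>m n) (\<lambda>_ y. y)"
proof -
  \<comment> \<open>The factor \<open>n ^ 17\<close>, at least \<open>2 ^ 17\<close>, absorbs all
    numerical constants even for \<open>n = 2\<close>, and \<open>n ^ 3\<close> is left for the
    quantities that grow with \<open>n\<close>; hence the word size \<open>n ^ 20\<close>.\<close>
  have pow: "(2::nat) ^ 17 \<le> n ^ 17" using n(1) by (intro power_mono) auto
  have L: "clog n < n"
  proof (cases "clog n")
    case (Suc l)
    then have "2 ^ l < n" using less_clog[of l n] by simp
    moreover have "l < 2 ^ l" by simp
    ultimately show ?thesis using Suc by linarith
  qed (use n in simp)
  have W: "(2 * clog n + 1) * (320 * k) < n ^ 20" "(2 * clog n + 1) * n < n ^ 20" "320 < n ^ 20" "2 * n < n ^ 20"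
  proof -
    have 20: "n ^ 20 = n ^ 17 * (n * n * n)" by (simp add: power_add[symmetric] power3_eq_cube[symmetric] numeral_eq_Suc)
    have pos: "1 \<le> n * n" "n \<le> n * n" "n * n \<le> n * n * n" using n(1) by simp_all
    have "(2 * clog n + 1) * (320 * k) \<le> (2 * n) * (320 * n)"
      using L n(3) by (intro mult_le_mono) auto
    also have "\<dots> < 2 ^ 17 * (n * n)" using n(1) by simp
    also have "\<dots> \<le> n ^ 20" unfolding 20 using pow pos by (intro mult_le_mono) auto
    finally show "(2 * clog n + 1) * (320 * k) < n ^ 20" .
    have "(2 * clog n + 1) * n \<le> (2 * n) * n"
      using L by (intro mult_le_mono) auto
    also have "\<dots> < 2 ^ 17 * (n * n)" using n(1) by simp
    also have "\<dots> \<le> n ^ 20" unfolding 20 using pow pos by (intro mult_le_mono) auto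
    finally show "(2 * clog n + 1) * n < n ^ 20" .
    have "2 * n \<le> 2 * (n * n)" "320 * 1 \<le> 320 * (n * n)" using pos by simp_all
    moreover have "320 * (n * n) < 2 ^ 17 * (n * n)" "2 * (n * n) < 2 ^ 17 * (n * n)" using n(1) by simp_all
    moreover have "2 ^ 17 * (n * n) \<le> n ^ 20" unfolding 20 using pow pos by (intro mult_le_mono) auto
    ultimately show "320 < n ^ 20" "2 * n < n ^ 20" by linarith+
  qed
  have copy: "computes_within (n ^ 20) \<omega> (Seq init_prog (Cond (WLess (WReg ''m'') (WReg ''n'')) p copy_prog)) n k x x
      (3000 * (real n * ln (real n)))" if x: "x \<in> carrier_vec n" for x \<omega> p
  proof (rule runs_imp_computes_within)
    let ?Q = "\<lambda>s. vec (dim_vec x) (rarr s ''out'') = x"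
    have "runs (n ^ 20) \<omega> (Cond (WLess (WReg ''m'') (WReg ''n'')) p copy_prog) s' (3 * n + 2) ?Q"
      if s': "wreg s' ''n'' = n" "wreg s' ''m'' = (2 * clog n + 1) * (320 * k)" "wreg s' ''q'' = wreg (init_state n k x) ''q''"
        "rarr s' = rarr (init_state n k x)" for s'
    proof (rule runs_Cond)
      have in_x: "rarr s' ''in'' i = x $ i" if "i < n" for i
        using s'(4) x that by (simp add: init_state_def)
      have "runs (n ^ 20) \<omega> copy_prog s' (3 * n + 1) (\<lambda>s1. \<forall>i<n. rarr s1 ''out'' i = rarr s' ''in'' i)"
        using s' W n by (intro runs_copy) (simp_all add: init_state_def)
      then show "runs (n ^ 20) \<omega> copy_prog s' (3 * n + 1) ?Q"
        by (rule runs_mono) (use in_x x in \<open>auto intro: eq_vecI\<close>)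
    qed (use s'(1,2) n(4) in \<open>simp_all del: mult_Suc mult_Suc_right add: not_less\<close>)
    then have init: "runs (n ^ 20) \<omega> init_prog (init_state n k x) (3 * clog n + 5)
      (\<lambda>s'. runs (n ^ 20) \<omega> (Cond (WLess (WReg ''m'') (WReg ''n'')) p copy_prog) s' (3 * n + 2) ?Q)"
      using W n(2) by (intro runs_init[where n = n and k = k]) (simp_all add: init_state_def)
    show "runs (n ^ 20) \<omega> (Seq init_prog (Cond (WLess (WReg ''m'') (WReg ''n'')) p copy_prog)) (init_state n k x) (30 * (n * clog n)) ?Q"
    proof (rule runs_Seq[OF init])
      have "1 \<le> clog n" using clog[of n] n(1) by (cases "clog n") auto
      then have "n * 1 \<le> n * clog n" "1 * clog n \<le> n * clog n" using n(1) by (intro mult_le_mono; simp)+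
      then show "3 * clog n + 5 + (3 * n + 2) \<le> 30 * (n * clog n)" using n(1) by linarith
    qed
  qed (use time_le[OF n(1), of 30] in simp)
  have "linf_norm (x - x) \<le> 1 / real k * min_bias_err 1 k x" if "x \<in> carrier_vec n" for x
    using that n(1) min_bias_err_nonneg[of 1 k x] by (intro linf_norm_le) auto
  moreover have "real n \<le> 3000 * (real k * ln (real n))"
  proof -
    have "real n \<le> real ((2 * clog n + 1) * (320 * k))" using n(4) by (simp only: of_nat_le_iff)
    then show ?thesis using buckets_le[OF n(1), of k] by linarith
  qed
  ultimately show ?thesis
    unfolding is_scheme_def sketch_prog_def recovery_prog_def using copy by simp
qed

lemma sketch_scheme:
  assumes n: "2 \<le> n" "1 \<le> k" "(2 * clog n + 1) * (320 * k) < n"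
  shows "is_scheme (n ^ 20) n k ((2 * clog n + 1) * (320 * k)) (sketch.sketch_matrix n k)
    (\<lambda>\<omega> y. SOME z. sketch.recovers n k (n ^ 20) \<omega> y z)" (is "is_scheme ?W n k ?m ?\<Phi> ?\<R>")
proof -
  have W: "n * n \<le> ?W"
  proof -
    have "n ^ 2 \<le> n ^ 20" using n(1) by (intro power_increasing) auto
    then show ?thesis by (simp only: power2_eq_square)
  qed
  have loc: "sketch n k ?W \<omega>" if "\<omega> \<in> set_pmf (random_tape ?W)" for \<omega>
    using n W tape_less[OF _ that] by unfold_locales auto
  have m: "sketch.m n k = ?m" if "\<omega> \<in> set_pmf (random_tape ?W)" for \<omega>
    unfolding sketch.m_def[OF loc[OF that]] sketch.D_def[OF loc[OF that]] sketch.s_def[OF loc[OF that]] ..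
  have \<Phi>: "?\<Phi> \<omega> \<in> carrier_mat ?m n" if "\<omega> \<in> set_pmf (random_tape ?W)" for \<omega>
    using sketch.sketch_matrix_carrier[OF loc[OF that]] m[OF that] by simp
  have \<R>: "sketch.recovers n k ?W \<omega> y (?\<R> \<omega> y)" if "\<omega> \<in> set_pmf (random_tape ?W)" "y \<in> carrier_vec ?m" for \<omega> y
    using someI_ex[OF sketch.ex_recovers[OF loc[OF that(1)]]] that(2) m[OF that(1)] by simp
  have prob: "1 - 1 / real n \<le> measure_pmf.prob (random_tape ?W) {\<omega>. linf_norm (?\<R> \<omega> (?\<Phi> \<omega> *\<^sub>v x) - x) \<le> 1 / real k * min_bias_err 1 k x}"
    if x: "x \<in> carrier_vec n" for x
  proof (rule prob_le_right_continuous)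
    fix r assume r: "1 / real k * min_bias_err 1 k x < r"
    \<comment> \<open>As \<open>r\<close> is strictly above the bound, \<open>E\<close> is strictly
      above the best error: it is positive, and a shift and an outlier set with deviation at most
      \<open>E\<close> exist.\<close>
    define E where "E = r * real k"
    have "min_bias_err 1 k x < E"
      using r n(2) by (simp add: E_def field_simps)
    then obtain \<beta> T where T: "finite T" "card T \<le> k" "(\<Sum>i\<in>{..<n} - T. \<bar>x $ i - \<beta>\<bar>) \<le> E"
      by (rule min_bias_err_less[OF _ x])
    have E: "0 < E" using \<open>min_bias_err 1 k x < E\<close> min_bias_err_nonneg[of 1 k x] by linarith
    define w where "w = sketch.weight n k (($) x) T \<beta> E"
    define F where "F = {\<omega>. \<exists>i<n. clog n \<le> card {j \<in> {1..2 * clog n}.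
      1 \<le> (\<Sum>i'\<in>{i'. i' < n \<and> i' \<noteq> i \<and> \<omega> (j * n + i') mod (320 * k) = \<omega> (j * n + i) mod (320 * k)}. w i')}}"
    \<comment> \<open>The weights do not depend on the tape, but their lemmas live in a locale that
      fixes one; any tape of the support will do.\<close>
    obtain \<omega>\<^sub>0 where \<omega>\<^sub>0: "\<omega>\<^sub>0 \<in> set_pmf (random_tape ?W)"
      using set_pmf_not_empty[of "random_tape ?W"] by blast
    have "measure_pmf.prob (random_tape ?W) F \<le> 1 / real n"
      unfolding F_def
    proof (rule failure_prob_le[OF n W])
      show "0 \<le> w i" for i
        unfolding w_def by (rule sketch.weight_nonneg[OF loc[OF \<omega>\<^sub>0] E])
      show "(\<Sum>i<n. w i) \<le> 10 * real k"
        unfolding w_def by (rule sketch.sum_weight_le[OF loc[OF \<omega>\<^sub>0] T E])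
    qed
    moreover have "linf_norm (?\<R> \<omega> (?\<Phi> \<omega> *\<^sub>v x) - x) \<le> r" if \<omega>: "\<omega> \<in> set_pmf (random_tape ?W)" "\<omega> \<notin> F" for \<omega>
    proof (rule linf_norm_le)
      let ?z = "?\<R> \<omega> (?\<Phi> \<omega> *\<^sub>v x)"
      note l = loc[OF \<omega>(1)]
      have z: "sketch.recovers n k ?W \<omega> (?\<Phi> \<omega> *\<^sub>v x) ?z"
        by (rule \<R>[OF \<omega>(1) mult_mat_vec_carrier[OF \<Phi>[OF \<omega>(1)] x]])
      have few: "card {j \<in> {1..2 * clog n}. 1 \<le> (\<Sum>i'\<in>sketch.collisions n k \<omega> j i. sketch.weight n k (($) x) T \<beta> E i')} < clog n"
        if "i < n" for i
        using \<omega>(2) that unfolding F_def w_def sketch.collisions_def[OF l] sketch.s_def[OF l] by (simp add: not_le)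
      show "0 < dim_vec (?z - x)" using x n(1) by simp
      fix i assume "i < dim_vec (?z - x)"
      then have i: "i < n" using x by simp
      have "\<bar>?z $ i - x $ i\<bar> \<le> E / real k"
        by (rule sketch.recovers_accurate[OF l x z T E few i])
      then show "\<bar>(?z - x) $ i\<bar> \<le> r"
        using i x n(2) by (simp add: E_def)
    qed
    \<comment> \<open>Only tapes in the support are known to satisfy the locale assumptions, so the
      complement of \<open>F\<close> is first intersected with it.\<close>
    then have "- F \<inter> set_pmf (random_tape ?W) \<subseteq> {\<omega>. linf_norm (?\<R> \<omega> (?\<Phi> \<omega> *\<^sub>v x) - x) \<le> r}" by auto
    then have "measure_pmf.prob (random_tape ?W) (- F) \<le> measure_pmf.prob (random_tape ?W) {\<omega>. linf_norm (?\<R> \<omega> (?\<Phi> \<omega> *\<^sub>v x) - x) \<le> r}"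
      by (subst measure_Int_set_pmf[symmetric]) (rule measure_pmf.finite_measure_mono; simp)
    moreover have "measure_pmf.prob (random_tape ?W) (- F) = 1 - measure_pmf.prob (random_tape ?W) F"
      using measure_pmf.prob_compl[of F "random_tape ?W"] by (simp add: Compl_eq_Diff_UNIV)
    ultimately show "1 - 1 / real n \<le> measure_pmf.prob (random_tape ?W) {\<omega>. linf_norm (?\<R> \<omega> (?\<Phi> \<omega> *\<^sub>v x) - x) \<le> r}"
      by linarith
  qed
  show ?thesis
    unfolding is_scheme_def
  proof (intro conjI ballI prob buckets_le[OF n(1)] \<Phi>)
    fix \<omega> assume \<omega>: "\<omega> \<in> set_pmf (random_tape ?W)"
    note l = loc[OF \<omega>]
    show "?\<R> \<omega> \<in> carrier_vec ?m \<rightarrow> carrier_vec n"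
      using sketch.recovers_carrier[OF l \<R>[OF \<omega>]] by blast
    fix x :: rvec assume x: "x \<in> carrier_vec n"
    show "computes_within ?W \<omega> sketch_prog n k x (?\<Phi> \<omega> *\<^sub>v x) (3000 * (real n * ln (real n)))"
      by (rule computes_within_mono[OF sketch.sketch_computes[OF l x] time_le[OF n(1)]]) simp
    have "?\<Phi> \<omega> *\<^sub>v x \<in> carrier_vec ?m"
      by (rule mult_mat_vec_carrier[OF \<Phi>[OF \<omega>] x])
    from sketch.recovers_computes[OF l \<R>[OF \<omega> this]]
    show "computes_within ?W \<omega> recovery_prog n k (?\<Phi> \<omega> *\<^sub>v x) (?\<R> \<omega> (?\<Phi> \<omega> *\<^sub>v x)) (3000 * (real n * ln (real n)))"
      by (rule computes_within_mono[OF _ time_le[OF n(1)]]) simp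
  qed
qed

lemma ex_scheme:
  assumes "2 \<le> n" "1 \<le> k" "k < n"
  shows "\<exists>m \<Phi> \<R>. is_scheme (n ^ 20) n k m \<Phi> \<R>"
  using trivial_scheme[OF assms] sketch_scheme[OF assms(1,2)] by (meson not_le)

theorem theorem3:
  shows "\<exists>C\<^sub>1 C\<^sub>2 :: real. C\<^sub>1 > 0 \<and> C\<^sub>2 > 0 \<and>
    (\<exists>(C :: real) (c :: nat) (sketch_prog :: prog) (recovery_prog :: prog).
      c \<ge> 2 \<and> (\<forall>n k :: nat. 2 \<le> n \<and> 1 \<le> k \<and> k < n \<longrightarrow>
        (\<exists>(m :: nat) (\<Phi> :: tape \<Rightarrow> real mat) (\<R> :: tape \<Rightarrow> rvec \<Rightarrow> rvec).
          real m \<le> C * (real k * ln (real n)) \<and>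
          (\<forall>\<omega> \<in> set_pmf (random_tape (n ^ c)).
             \<Phi> \<omega> \<in> carrier_mat m n \<and> \<R> \<omega> \<in> carrier_vec m \<rightarrow> carrier_vec n) \<and>
          (\<forall>x \<in> carrier_vec n.
             measure_pmf.prob (random_tape (n ^ c))
               {\<omega>. linf_norm (\<R> \<omega> (\<Phi> \<omega> *\<^sub>v x) - x) \<le> C\<^sub>1 / real k * min_bias_err 1 k x}
             \<ge> 1 - C\<^sub>2 / real n) \<and>
          (\<forall>\<omega> \<in> set_pmf (random_tape (n ^ c)). \<forall>x \<in> carrier_vec n.
             computes_within (n ^ c) \<omega> sketch_prog n k x (\<Phi> \<omega> *\<^sub>v x)
               (C * (real n * ln (real n))) \<and>
             real (dim_vec (\<Phi> \<omega> *\<^sub>v x)) \<le> C * (real k * ln (real n)) \<and>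
             computes_within (n ^ c) \<omega> recovery_prog n k (\<Phi> \<omega> *\<^sub>v x) (\<R> \<omega> (\<Phi> \<omega> *\<^sub>v x))
               (C * (real n * ln (real n)))))))"
proof -
  have dims: "real (dim_vec (\<Phi> \<omega> *\<^sub>v x)) \<le> 3000 * (real k * ln (real n))"
    if "is_scheme W n k m \<Phi> \<R>" "\<omega> \<in> set_pmf (random_tape W)" for W n k m \<Phi> \<R> \<omega> and x :: rvec
    using that unfolding is_scheme_def by (metis carrier_matD(1) dim_mult_mat_vec)
  have *: "\<exists>m \<Phi> \<R>. real m \<le> 3000 * (real k * ln (real n)) \<and>
          (\<forall>\<omega> \<in> set_pmf (random_tape (n ^ 20)).
             \<Phi> \<omega> \<in> carrier_mat m n \<and> \<R> \<omega> \<in> carrier_vec m \<rightarrow> carrier_vec n) \<and>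
          (\<forall>x \<in> carrier_vec n.
             measure_pmf.prob (random_tape (n ^ 20))
               {\<omega>. linf_norm (\<R> \<omega> (\<Phi> \<omega> *\<^sub>v x) - x) \<le> 1 / real k * min_bias_err 1 k x}
             \<ge> 1 - 1 / real n) \<and>
          (\<forall>\<omega> \<in> set_pmf (random_tape (n ^ 20)). \<forall>x \<in> carrier_vec n.
             computes_within (n ^ 20) \<omega> sketch_prog n k x (\<Phi> \<omega> *\<^sub>v x)
               (3000 * (real n * ln (real n))) \<and>
             real (dim_vec (\<Phi> \<omega> *\<^sub>v x)) \<le> 3000 * (real k * ln (real n)) \<and>
             computes_within (n ^ 20) \<omega> recovery_prog n k (\<Phi> \<omega> *\<^sub>v x) (\<R> \<omega> (\<Phi> \<omega> *\<^sub>v x))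
               (3000 * (real n * ln (real n))))"
    if nk: "2 \<le> n \<and> 1 \<le> k \<and> k < n" for n k :: nat
  proof -
    from nk obtain m \<Phi> \<R> where "is_scheme (n ^ 20) n k m \<Phi> \<R>"
      using ex_scheme by blast
    with dims show ?thesis
      unfolding is_scheme_def by (intro exI[of _ m] exI[of _ \<Phi>] exI[of _ \<R>]) auto
  qed
  show ?thesis
    by (rule exI[of _ "1 :: real"], rule exI[of _ "1 :: real"], intro conjI, simp, simp,
        rule exI[of _ "3000 :: real"], rule exI[of _ "20 :: nat"], rule exI[of _ sketch_prog], rule exI[of _ recovery_prog]) (use * in simp)
qed

end
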